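(* Assume that $F\in\mathcal M(\eta^*,U_\hbar\mathfrak g\otimes U_\hbar\mathfrak g)$ is of zero weight, and set $\mathcal F=F(\lambda)\Theta\in H\otimes_RH$, where $H=\mathcal D\otimes U_\hbar\mathfrak g$. Then $\mathcal F$ is a twistor, i.e. satisfies $$(\Delta\otimes_R\mathrm{id})\mathcal F\;\mathcal F^{12}=(\mathrm{id}\otimes_R\Delta)\mathcal F\;\mathcal F^{23}\ \text{ in } H\otimes_RH\otimes_RH,\qquad (\epsilon\otimes_R\mathrm{id})\mathcal F=1_H,\quad(\mathrm{id}\otimes_R\epsilon)\mathcal F=1_H,$$ if and only if $$[(\Delta_0\otimes\mathrm{id})F(\lambda)]\,F^{12}(\lambda+\hbar h^{(3)})=[(\mathrm{id}\otimes\Delta_0)F(\lambda)]\,F^{23}(\lambda)$$ and $$(\epsilon_0\otimes\mathrm{id})F(\lambda)=1,\qquad(\mathrm{id}\otimes\epsilon_0)F(\lambda)=1,$$ where $\Delta_0$ is the coproduct and $\epsilon_0$ the counit of $U_\hbar\mathfrak g$.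
   Context: $U_\hbar\mathfrak g$ is a quasi-triangular quantum universal enveloping algebra over $\mathbb C$ (a deformation of $U\mathfrak g$, so $U_\hbar\mathfrak g\cong U\mathfrak g[[\hbar]]$ as a $\mathbb C[[\hbar]]$-module) with coproduct $\Delta_0$ and counit $\epsilon_0$; $\eta\subset\mathfrak g$ is a finite-dimensional abelian Lie subalgebra such that $U\eta[[\hbar]]$ is a commutative subalgebra of $U_\hbar\mathfrak g$. $\mathcal M(\eta^* )$ is the algebra of meromorphic functions on $\eta^*$ and $\mathcal D$ the algebra of meromorphic differential operators on $\eta^*$. Tensor products are understood in the topological ($\hbar$-adic) sense. $H=\mathcal D\otimes U_\hbar\mathfrak g$ is the Hopf algebroid over $\mathbb C$ with base algebra $R=\mathcal M(\eta^* )[[\hbar]]$ which is the tensor product of the Hopf algebroids $\mathcal D$ and $U_\hbar\mathfrak g$: source and target maps are both the inclusion $f\mapsto f\otimes1$ (so $H\otimes_RH$ is the tensor product with respect to left multiplication by functions on both factors); the coproduct $\Delta:H\to H\otimes_RH$ is the tensor product of the coproduct of $\mathcal D$, $\Delta(D)(f,g)=D(fg)$ (elements of $\mathcal D\otimes_{\mathcal M(\eta^* )}\mathcal D$ being regarded as bidifferential operators), with $\Delta_0$; and the counit is $\epsilon(D\otimes u)=\epsilon_0(u)D(1)$. It has the anchor $\mu(D\otimes u)(f)=\epsilon_0(u)D(f)$ for $D\in\mathcal D$, $u\in U_\hbar\mathfrak g$, $f\in\mathcal M(\eta^* )[[\hbar]]$. For $\mathcal F=\sum_i x_i\otimes_Ry_i\in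 H\otimes_RH$, one writes $\mathcal F^{12}=\mathcal F\otimes1$ and $\mathcal F^{23}=1\otimes\mathcal F$, and $(\Delta\otimes_R\mathrm{id})\mathcal F\,\mathcal F^{12}=\sum_{ij}\Delta x_i(x_j\otimes_R y_j)\otimes_Ry_i$, $(\mathrm{id}\otimes_R\Delta)\mathcal F\,\mathcal F^{23}=\sum_{ij}x_i\otimes_R\Delta y_i(x_j\otimes_R y_j)$. In the counit conditions $R\otimes_RH\cong H\otimes_RR\cong H$. Fix a basis $h_1,\dots,h_k$ of $\eta$; its dual basis defines linear coordinates $\lambda_1,\dots,\lambda_k$ on $\eta^*$. Set $\theta=\sum_{i=1}^k\frac{\partial}{\partial\lambda_i}\otimes h_i\in H\otimes H$ and $\Theta=\exp(\hbar\theta)\in H\otimes H$ (both independent of the choice of basis). $\mathcal M(\eta^*,U_\hbar\mathfrak g\otimes U_\hbar\mathfrak g)$ denotes the meromorphic $U_\hbar\mathfrak g\otimes U_\hbar\mathfrak g$-valued functions on $\eta^*$, regarded as elements of $H\otimes_RH$. Such an $F$ is said to be of zero weight if $[F(\lambda),1\otimes h+h\otimes1]=0$ for all $\lambda\in\eta^*$, $h\in\eta$. One sets $F^{12}(\lambda+\hbar h^{(3)})=\sum_{n\ge0}\frac{\hbar^n}{n!}\sum_{i_1,\dots,i_n}\frac{\partial^nF}{\partial\lambda_{i_1}\cdots\partial\lambda_{i_n}}\otimes h_{i_1}\cdots h_{i_n}$ (the $n=0$ term being $F(\lambda)\otimes1$) and $F^{23}(\lambda)=1\otimes F(\lambda)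$.
   Formalization: The elements of η are additionally assumed primitive, Δ₀h = h⊗1 + 1⊗h; without this the claim fails (F = 1, η = ℂH in the Jordanian twist of the Borel algebra's enveloping algebra). The trivial case η = 0 is excluded. *)

theory Defs
  imports
    "HOL-Analysis.Analysis"
    "HOL-Library.Poly_Mapping"
    "HOL-Computational_Algebra.Formal_Power_Series"
begin

section \<open>Complex vector spaces and Lie algebras\<close>

class complex_vector = ab_group_add +
  fixes scaleC :: "complex \<Rightarrow> 'a \<Rightarrow> 'a"  (infixr \<open>*\<^sub>C\<close> 75)
  assumes scaleC_add_right: "c *\<^sub>C (x + y) = c *\<^sub>C x + c *\<^sub>C y"
    and scaleC_add_left: "(c + d) *\<^sub>C x = c *\<^sub>C x + d *\<^sub>C x"
    and scaleC_scaleC: "c *\<^sub>C d *\<^sub>C x = (c * d) *\<^sub>C x"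
    and scaleC_one: "1 *\<^sub>C x = x"

global_interpretation complex_vector: vector_space "scaleC :: complex \<Rightarrow> 'a \<Rightarrow> 'a::complex_vector"
  by unfold_locales
    (simp_all add: scaleC_add_right scaleC_add_left scaleC_scaleC scaleC_one)

class complex_lie_algebra = complex_vector +
  fixes lie :: "'a \<Rightarrow> 'a \<Rightarrow> 'a"
  assumes lie_add_left: "lie (x + y) z = lie x z + lie y z"
    and lie_add_right: "lie x (y + z) = lie x y + lie x z"
    and lie_scale_left: "lie (c *\<^sub>C x) y = c *\<^sub>C lie x y"
    and lie_scale_right: "lie x (c *\<^sub>C y) = c *\<^sub>C lie x y"
    and lie_self: "lie x x = 0"
    and lie_jacobi: "lie x (lie y z) + lie y (lie z x) + lie z (lie x y) = 0"

instantiation complex :: complex_vector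
begin
definition scaleC_complex :: "complex \<Rightarrow> complex \<Rightarrow> complex" where "scaleC_complex c x = c * x"
instance by standard (simp_all add: scaleC_complex_def algebra_simps)
end

instantiation poly_mapping :: (type, complex_vector) complex_vector
begin
definition scaleC_poly_mapping :: "complex \<Rightarrow> ('a \<Rightarrow>\<^sub>0 'b) \<Rightarrow> ('a \<Rightarrow>\<^sub>0 'b)"
  where "scaleC_poly_mapping c p = Poly_Mapping.map (scaleC c) p"
lemma lookup_scaleC: "Poly_Mapping.lookup (c *\<^sub>C p) k = c *\<^sub>C Poly_Mapping.lookup p k"
  by (simp add: scaleC_poly_mapping_def Poly_Mapping.map.rep_eq when_def)
instance
  by standard
    (rule poly_mapping_eqI, simp add: lookup_scaleC lookup_add scaleC_add_right scaleC_add_left)+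
end

definition clinear :: "('a::complex_vector \<Rightarrow> 'b::complex_vector) \<Rightarrow> bool"
  where "clinear f \<longleftrightarrow> (\<forall>x y. f (x + y) = f x + f y) \<and> (\<forall>c x. f (c *\<^sub>C x) = c *\<^sub>C f x)"

definition cbilinear :: "('a::complex_vector \<Rightarrow> 'b::complex_vector \<Rightarrow> 'c::complex_vector) \<Rightarrow> bool"
  where "cbilinear f \<longleftrightarrow> (\<forall>y. clinear (\<lambda>x. f x y)) \<and> (\<forall>x. clinear (f x))"


section \<open>Tensor products over the complex numbers\<close>

text \<open>The free vector space on pairs, modulo the bilinearity relations.\<close>

definition free_pair :: "'a \<Rightarrow> 'b \<Rightarrow> (('a \<times> 'b) \<Rightarrow>\<^sub>0 complex)"
  where "free_pair a b = Poly_Mapping.single (a, b) 1"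

definition tensor_null :: "(('a::complex_vector \<times> 'b::complex_vector) \<Rightarrow>\<^sub>0 complex) set" where
  "tensor_null = complex_vector.span
     ({free_pair (a + a') b - free_pair a b - free_pair a' b | a a' b. True} \<union>
      {free_pair a (b + b') - free_pair a b - free_pair a b' | a b b'. True} \<union>
      {free_pair (c *\<^sub>C a) b - c *\<^sub>C free_pair a b | c a b. True} \<union>
      {free_pair a (c *\<^sub>C b) - c *\<^sub>C free_pair a b | c a b. True})"

lemma equivp_mod_span:
  fixes S :: "'a::complex_vector set"
  shows "equivp (\<lambda>x y. x - y \<in> complex_vector.span S)"
proof (rule equivpI)
  show "reflp (\<lambda>x y. x - y \<in> complex_vector.span S)"
    by (simp add: reflp_def complex_vector.span_zero)
  show "symp (\<lambda>x y. x - y \<in> complex_vector.span S)"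
    by (rule sympI) (metis complex_vector.span_neg minus_diff_eq)
  show "transp (\<lambda>x y. x - y \<in> complex_vector.span S)"
  proof (rule transpI)
    fix x y z :: 'a
    assume "x - y \<in> complex_vector.span S" "y - z \<in> complex_vector.span S"
    from complex_vector.span_add[OF this] show "x - z \<in> complex_vector.span S" by simp
  qed
qed

lemma span_diff_add:
  fixes S :: "'a::complex_vector set"
  assumes "x - x' \<in> complex_vector.span S" "y - y' \<in> complex_vector.span S"
  shows "(x + y) - (x' + y') \<in> complex_vector.span S"
  using complex_vector.span_add[OF assms] by (simp add: algebra_simps)

lemma span_diff_diff:
  fixes S :: "'a::complex_vector set"
  assumes "x - x' \<in> complex_vector.span S" "y - y' \<in> complex_vector.span S"
  shows "(x - y) - (x' - y') \<in> complex_vector.span S"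
  using complex_vector.span_diff[OF assms] by (simp add: algebra_simps)

lemma span_diff_uminus:
  fixes S :: "'a::complex_vector set"
  assumes "x - x' \<in> complex_vector.span S"
  shows "(- x) - (- x') \<in> complex_vector.span S"
  using complex_vector.span_neg[OF assms] by (simp add: algebra_simps)

lemma span_diff_scale:
  fixes S :: "'a::complex_vector set"
  assumes "x - x' \<in> complex_vector.span S"
  shows "c *\<^sub>C x - c *\<^sub>C x' \<in> complex_vector.span S"
  using complex_vector.span_scale[OF assms, of c]
  by (simp add: complex_vector.scale_right_diff_distrib)

quotient_type (overloaded) ('a, 'b) tensor (infixr \<open>\<otimes>\<close> 75) =
  "('a::complex_vector \<times> 'b::complex_vector) \<Rightarrow>\<^sub>0 complex" / "\<lambda>p q. p - q \<in> tensor_null"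
  unfolding tensor_null_def by (rule equivp_mod_span)

instantiation tensor :: (complex_vector, complex_vector) complex_vector
begin
lift_definition zero_tensor :: "('a, 'b) tensor" is 0 .
lift_definition plus_tensor :: "('a, 'b) tensor \<Rightarrow> ('a, 'b) tensor \<Rightarrow> ('a, 'b) tensor" is "(+)"
  unfolding tensor_null_def by (rule span_diff_add)
lift_definition minus_tensor :: "('a, 'b) tensor \<Rightarrow> ('a, 'b) tensor \<Rightarrow> ('a, 'b) tensor" is "(-)"
  unfolding tensor_null_def by (rule span_diff_diff)
lift_definition uminus_tensor :: "('a, 'b) tensor \<Rightarrow> ('a, 'b) tensor" is uminus
  unfolding tensor_null_def by (rule span_diff_uminus)
lift_definition scaleC_tensor :: "complex \<Rightarrow> ('a, 'b) tensor \<Rightarrow> ('a, 'b) tensor" is scaleC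
  unfolding tensor_null_def by (rule span_diff_scale)
instance
  by standard (transfer, simp add: tensor_null_def complex_vector.span_zero algebra_simps
      scaleC_add_right scaleC_add_left)+
end

lift_definition tens :: "'a::complex_vector \<Rightarrow> 'b::complex_vector \<Rightarrow> ('a, 'b) tensor"
  (infixr \<open>\<otimes>\<close> 75) is free_pair .

text \<open>The linear map on the tensor product induced by a bilinear map (meaningful only for
  bilinear arguments, see \<open>tlift_tens\<close> and \<open>clinear_tlift\<close>).\<close>

definition free_lift :: "('a \<Rightarrow> 'b \<Rightarrow> 'c) \<Rightarrow> (('a \<times> 'b) \<Rightarrow>\<^sub>0 complex) \<Rightarrow> 'c::complex_vector"
  where "free_lift f p =
    (\<Sum>k \<in> Poly_Mapping.keys p. Poly_Mapping.lookup p k *\<^sub>C f (fst k) (snd k))"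

definition tlift :: "('a::complex_vector \<Rightarrow> 'b::complex_vector \<Rightarrow> 'c::complex_vector) \<Rightarrow>
    ('a, 'b) tensor \<Rightarrow> 'c"
  where "tlift f t = free_lift f (rep_tensor t)"

lemma free_lift_superset:
  assumes "finite K" "Poly_Mapping.keys p \<subseteq> K"
  shows "free_lift f p = (\<Sum>k \<in> K. Poly_Mapping.lookup p k *\<^sub>C f (fst k) (snd k))"
  unfolding free_lift_def
  by (rule sum.mono_neutral_left) (use assms in \<open>auto simp: in_keys_iff\<close>)

lemma free_lift_add: "free_lift f (p + q) = free_lift f p + free_lift f q"
proof -
  let ?K = "Poly_Mapping.keys p \<union> Poly_Mapping.keys q"
  have K: "finite ?K" by simp
  show ?thesis
    by (simp add: free_lift_superset[OF K keys_add] free_lift_superset[OF K, of p]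
        free_lift_superset[OF K, of q] lookup_add scaleC_add_left sum.distrib)
qed

lemma free_lift_scale: "free_lift f (c *\<^sub>C p) = c *\<^sub>C free_lift f p"
proof -
  have "Poly_Mapping.keys (c *\<^sub>C p) \<subseteq> Poly_Mapping.keys p"
    by (auto simp: in_keys_iff lookup_scaleC)
  then show ?thesis
    by (simp add: free_lift_superset[of "Poly_Mapping.keys p"] lookup_scaleC
        complex_vector.scale_sum_right scaleC_complex_def)
qed

lemma free_lift_minus: "free_lift f (p - q) = free_lift f p - free_lift f q"
  using free_lift_add[of f "p - q" q] by simp

lemma free_lift_pair: "free_lift f (free_pair a b) = f a b"
  by (simp add: free_lift_def free_pair_def)

lemma free_lift_null:
  assumes "cbilinear f" "p \<in> tensor_null"
  shows "free_lift f p = 0"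
proof -
  have "free_lift f 0 = 0" by (simp add: free_lift_def)
  then have "complex_vector.subspace {p. free_lift f p = 0}"
    by (auto simp: complex_vector.subspace_def free_lift_add free_lift_scale)
  then have "tensor_null \<subseteq> {p. free_lift f p = 0}"
    unfolding tensor_null_def using assms(1)
    by (intro complex_vector.span_minimal)
      (auto simp: cbilinear_def clinear_def free_lift_minus free_lift_scale free_lift_pair)
  then show ?thesis using assms(2) by auto
qed

lemma free_lift_cong:
  assumes "cbilinear f" "p - q \<in> tensor_null"
  shows "free_lift f p = free_lift f q"
  using free_lift_null[OF assms] by (simp add: free_lift_minus)

lemma rep_tensor_null: "rep_tensor (abs_tensor p) - p \<in> tensor_null"
  using Quotient_rep_abs[OF Quotient_tensor, of p]
  by (simp add: tensor_null_def complex_vector.span_zero)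

lemma tlift_tens: "cbilinear f \<Longrightarrow> tlift f (a \<otimes> b) = f a b"
  unfolding tlift_def tens.abs_eq
  by (metis free_lift_cong free_lift_pair rep_tensor_null)

lemma tlift_abs: "cbilinear f \<Longrightarrow> tlift f (abs_tensor p) = free_lift f p"
  unfolding tlift_def by (rule free_lift_cong) (auto simp: rep_tensor_null)

lemma clinear_tlift:
  assumes "cbilinear f"
  shows "clinear (tlift f)"
  unfolding clinear_def
proof (intro conjI allI)
  fix x y :: "('a, 'b) tensor" and c
  obtain p q where "x = abs_tensor p" "y = abs_tensor q"
    by (metis Quotient_abs_rep[OF Quotient_tensor])
  then show "tlift f (x + y) = tlift f x + tlift f y" "tlift f (c *\<^sub>C x) = c *\<^sub>C tlift f x"
    by (simp_all add: plus_tensor.abs_eq scaleC_tensor.abs_eq tlift_abs[OF assms]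
        free_lift_add free_lift_scale)
qed

definition tmap :: "('a::complex_vector \<Rightarrow> 'c::complex_vector) \<Rightarrow>
    ('b::complex_vector \<Rightarrow> 'd::complex_vector) \<Rightarrow> ('a, 'b) tensor \<Rightarrow> ('c, 'd) tensor"
  where "tmap f g = tlift (\<lambda>a b. f a \<otimes> g b)"

definition tflip :: "('a::complex_vector, 'b::complex_vector) tensor \<Rightarrow> ('b, 'a) tensor"
  where "tflip = tlift (\<lambda>a b. b \<otimes> a)"

definition tassoc :: "(('a::complex_vector \<otimes> 'b::complex_vector) \<otimes> 'c::complex_vector) \<Rightarrow>
    'a \<otimes> ('b \<otimes> 'c)"
  where "tassoc = tlift (\<lambda>t c. tlift (\<lambda>a b. a \<otimes> (b \<otimes> c)) t)"

definition tinterchange ::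
  "(('a::complex_vector \<otimes> 'b::complex_vector) \<otimes> ('c::complex_vector \<otimes> 'd::complex_vector)) \<Rightarrow>
    (('a \<otimes> 'c) \<otimes> ('b \<otimes> 'd))"
  where "tinterchange =
    tlift (\<lambda>s t. tlift (\<lambda>a b. tlift (\<lambda>c d. (a \<otimes> c) \<otimes> (b \<otimes> d)) t) s)"


section \<open>Topologically free modules over the ring of formal power series\<close>

text \<open>The module \<open>V[[\<hbar>]]\<close> over \<open>\<complex>[[\<hbar>]]\<close> is \<open>'v fps\<close>. The completed tensor product of
  \<open>V[[\<hbar>]]\<close> and \<open>W[[\<hbar>]]\<close> is \<open>(V \<otimes> W)[[\<hbar>]]\<close>. The multiplication which the library puts on
  \<open>'v fps\<close> for a ring \<open>'v\<close> is used only for \<open>'v = complex\<close>.\<close>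

instantiation fps :: (complex_vector) complex_vector
begin
definition scaleC_fps :: "complex \<Rightarrow> 'a fps \<Rightarrow> 'a fps"
  where "scaleC_fps c x = Abs_fps (\<lambda>n. c *\<^sub>C fps_nth x n)"
instance
  by standard (simp_all add: scaleC_fps_def fps_eq_iff scaleC_add_right scaleC_add_left)
end

text \<open>\<open>hseries s\<close> is the \<open>\<hbar>\<close>-adically convergent sum of the \<open>\<hbar>^n s n\<close>.\<close>

definition hseries :: "(nat \<Rightarrow> 'a::complex_vector fps) \<Rightarrow> 'a fps"
  where "hseries s = Abs_fps (\<lambda>N. \<Sum>n\<le>N. fps_nth (s n) (N - n))"

definition hcauchy :: "('a::zero \<Rightarrow> 'b::zero \<Rightarrow> 'c::complex_vector) \<Rightarrow> 'a fps \<Rightarrow> 'b fps \<Rightarrow> 'c fps"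
  where "hcauchy f x y = Abs_fps (\<lambda>N. \<Sum>n\<le>N. f (fps_nth x n) (fps_nth y (N - n)))"

definition hscale :: "complex fps \<Rightarrow> 'a::complex_vector fps \<Rightarrow> 'a fps"
  where "hscale = hcauchy scaleC"

definition htens :: "'a::complex_vector fps \<Rightarrow> 'b::complex_vector fps \<Rightarrow> ('a \<otimes> 'b) fps"
  (infixr \<open>\<otimes>\<^sub>h\<close> 75)
  where "htens = hcauchy tens"

definition hlinear :: "('a::complex_vector fps \<Rightarrow> 'b::complex_vector fps) \<Rightarrow> bool"
  where "hlinear T \<longleftrightarrow>
    (\<forall>x y. T (x + y) = T x + T y) \<and> (\<forall>c x. T (hscale c x) = hscale c (T x))"

definition hbilinear ::
  "('a::complex_vector fps \<Rightarrow> 'b::complex_vector fps \<Rightarrow> 'c::complex_vector fps) \<Rightarrow> bool"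
  where "hbilinear m \<longleftrightarrow> (\<forall>y. hlinear (\<lambda>x. m x y)) \<and> (\<forall>x. hlinear (m x))"

definition hmap :: "('a::zero \<Rightarrow> 'b::zero) \<Rightarrow> 'a fps \<Rightarrow> 'b fps"
  where "hmap f x = Abs_fps (\<lambda>n. f (fps_nth x n))"

text \<open>\<open>hlift b\<close>, for bilinear \<open>b\<close>, is the \<open>\<complex>[[\<hbar>]]\<close>-linear map on \<open>(A \<otimes> B)[[\<hbar>]]\<close> that sends
  \<open>x \<otimes> y\<close> with \<open>x \<in> A\<close>, \<open>y \<in> B\<close> to \<open>b x y\<close>.\<close>

definition hlift :: "('a::complex_vector \<Rightarrow> 'b::complex_vector \<Rightarrow> 'c::complex_vector fps) \<Rightarrow>
    ('a \<otimes> 'b) fps \<Rightarrow> 'c fps"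
  where "hlift b X = hseries (\<lambda>n. tlift b (fps_nth X n))"

definition htensor_map :: "('a::complex_vector fps \<Rightarrow> 'c::complex_vector fps) \<Rightarrow>
    ('b::complex_vector fps \<Rightarrow> 'd::complex_vector fps) \<Rightarrow> ('a \<otimes> 'b) fps \<Rightarrow> ('c \<otimes> 'd) fps"
  (infixr \<open>\<boxtimes>\<close> 75)
  where "f \<boxtimes> g = hlift (\<lambda>a b. f (fps_const a) \<otimes>\<^sub>h g (fps_const b))"

text \<open>Multiplication of the tensor product of two algebras:
  \<open>(a \<otimes> b) (c \<otimes> d) = (a c) \<otimes> (b d)\<close>.\<close>

definition htensor_mult :: "('a::complex_vector fps \<Rightarrow> 'a fps \<Rightarrow> 'a fps) \<Rightarrow>
    ('b::complex_vector fps \<Rightarrow> 'b fps \<Rightarrow> 'b fps) \<Rightarrow>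
    ('a \<otimes> 'b) fps \<Rightarrow> ('a \<otimes> 'b) fps \<Rightarrow> ('a \<otimes> 'b) fps"
  (infixr \<open>\<boxtimes>\<^sub>m\<close> 75)
  where "(m \<boxtimes>\<^sub>m m') X Y =
    hlift (\<lambda>a b. hlift (\<lambda>c d. m (fps_const a) (fps_const c) \<otimes>\<^sub>h m' (fps_const b) (fps_const d)) Y) X"

abbreviation hassoc :: "(('a::complex_vector \<otimes> 'b::complex_vector) \<otimes> 'c::complex_vector) fps \<Rightarrow>
    ('a \<otimes> ('b \<otimes> 'c)) fps"
  where "hassoc \<equiv> hmap tassoc"

text \<open>\<open>hexp m e x\<close> is the exponential of \<open>\<hbar> x\<close> in the algebra with multiplication \<open>m\<close> and unit \<open>e\<close>.\<close>

definition hexp :: "('a::complex_vector fps \<Rightarrow> 'a fps \<Rightarrow> 'a fps) \<Rightarrow> 'a fps \<Rightarrow> 'a fps \<Rightarrow> 'a fps"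
  where "hexp m e x = hseries (\<lambda>n. (1 / fact n) *\<^sub>C ((m x ^^ n) e))"


section \<open>Universal enveloping algebras\<close>

datatype 'g word = Word (letters: "'g list")

instantiation word :: (type) monoid_add
begin
definition zero_word :: "'a word" where "zero_word = Word []"
definition plus_word :: "'a word \<Rightarrow> 'a word \<Rightarrow> 'a word"
  where "plus_word v w = Word (letters v @ letters w)"
instance by standard (simp_all add: zero_word_def plus_word_def)
end

text \<open>The free associative algebra on the underlying set of \<open>\<gg>\<close> is the monoid algebra of the
  free monoid; the convolution product of \<open>Poly_Mapping\<close> is its multiplication.\<close>

type_synonym 'g free_algebra = "'g word \<Rightarrow>\<^sub>0 complex"

definition free_gen :: "'g \<Rightarrow> 'g free_algebra"
  where "free_gen x = Poly_Mapping.single (Word [x]) 1"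

inductive_set uea_ideal :: "'g::complex_lie_algebra free_algebra set" where
  zero: "0 \<in> uea_ideal"
| add: "p \<in> uea_ideal \<Longrightarrow> q \<in> uea_ideal \<Longrightarrow> p + q \<in> uea_ideal"
| mult: "p \<in> uea_ideal \<Longrightarrow> a * p * b \<in> uea_ideal"
| gen_add: "free_gen (x + y) - free_gen x - free_gen y \<in> uea_ideal"
| gen_scale: "free_gen (c *\<^sub>C x) - c *\<^sub>C free_gen x \<in> uea_ideal"
| gen_lie: "free_gen x * free_gen y - free_gen y * free_gen x - free_gen (lie x y) \<in> uea_ideal"

lemma word_add_eq_zero: "(0::'g word) = v + w \<longleftrightarrow> w = 0 \<and> v = 0"
  by (cases v; cases w) (auto simp: zero_word_def plus_word_def)

lemma lookup_times_zero:
  fixes p q :: "'g free_algebra"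
  shows "Poly_Mapping.lookup (p * q) 0 = Poly_Mapping.lookup p 0 * Poly_Mapping.lookup q 0"
proof -
  have *: "(Poly_Mapping.lookup q w when 0 = v + w) =
      ((Poly_Mapping.lookup q w when w = 0) when v = 0)" for v w :: "'g word"
    by (simp add: when_def word_add_eq_zero)
  have "Poly_Mapping.lookup (p * q) 0 =
      (\<Sum>v. Poly_Mapping.lookup p v * (\<Sum>w. Poly_Mapping.lookup q w when 0 = v + w))"
    by (rule lookup_mult)
  also have "\<dots> = (\<Sum>v. Poly_Mapping.lookup p v * Poly_Mapping.lookup q 0 when v = 0)"
    unfolding * by (rule Sum_any.cong) (simp add: when_def)
  finally show ?thesis by simp
qed

lemma lookup_free_gen_zero: "Poly_Mapping.lookup (free_gen x) 0 = 0"
  by (simp add: free_gen_def lookup_single zero_word_def when_def)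

lemma uea_ideal_lookup_zero: "p \<in> uea_ideal \<Longrightarrow> Poly_Mapping.lookup p 0 = 0"
  by (induction rule: uea_ideal.induct)
    (simp_all add: lookup_add lookup_minus lookup_times_zero lookup_scaleC
      lookup_free_gen_zero)

lemma uea_ideal_left: "p \<in> uea_ideal \<Longrightarrow> a * p \<in> uea_ideal"
  using uea_ideal.mult[of p a 1] by simp

lemma uea_ideal_right: "p \<in> uea_ideal \<Longrightarrow> p * b \<in> uea_ideal"
  using uea_ideal.mult[of p 1 b] by simp

lemma uea_ideal_uminus: "p \<in> uea_ideal \<Longrightarrow> - p \<in> uea_ideal"
  using uea_ideal_left[of p "- 1"] by simp

lemma uea_ideal_diff: "p \<in> uea_ideal \<Longrightarrow> q \<in> uea_ideal \<Longrightarrow> p - q \<in> uea_ideal"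
  using uea_ideal.add[OF _ uea_ideal_uminus, of p q] by simp

lemma diff_diff_add_both: "(p - q) - (p' - q') = (p - p') - (q - (q' :: 'a::ab_group_add))"
  by (simp add: algebra_simps)

lemma minus_diff_minus: "- p - - q = - (p - (q :: 'a::ab_group_add))"
  by simp

lemma uea_ideal_times_cong:
  assumes "p - p' \<in> uea_ideal" "q - q' \<in> uea_ideal"
  shows "p * q - p' * q' \<in> uea_ideal"
proof -
  have "p * q - p' * q' = (p - p') * q + p' * (q - q')"
    by (simp add: left_diff_distrib right_diff_distrib)
  then show ?thesis
    using uea_ideal.add[OF uea_ideal_right[OF assms(1)] uea_ideal_left[OF assms(2)]] by metis
qed

lemma scaleC_free_algebra:
  fixes p :: "'g free_algebra"
  shows "c *\<^sub>C p = Poly_Mapping.single 0 c * p"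
proof (rule poly_mapping_eqI)
  fix k
  have "Poly_Mapping.lookup (Poly_Mapping.single 0 c * p) k = c * Poly_Mapping.lookup p k"
    by (simp flip: mult_map_scale_conv_mult add: Poly_Mapping.map.rep_eq when_def)
  then show "Poly_Mapping.lookup (c *\<^sub>C p) k = Poly_Mapping.lookup (Poly_Mapping.single 0 c * p) k"
    by (simp add: lookup_scaleC scaleC_complex_def)
qed

lemma uea_ideal_scale: "p \<in> uea_ideal \<Longrightarrow> c *\<^sub>C p \<in> uea_ideal"
  by (simp add: scaleC_free_algebra uea_ideal_left)

quotient_type (overloaded) 'g uea = "'g::complex_lie_algebra free_algebra" / "\<lambda>p q. p - q \<in> uea_ideal"
proof (rule equivpI)
  show "reflp (\<lambda>p q :: 'g free_algebra. p - q \<in> uea_ideal)"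
    by (simp add: reflp_def uea_ideal.zero)
  show "symp (\<lambda>p q :: 'g free_algebra. p - q \<in> uea_ideal)"
    by (rule sympI) (metis minus_diff_eq uea_ideal_uminus)
  show "transp (\<lambda>p q :: 'g free_algebra. p - q \<in> uea_ideal)"
  proof (rule transpI)
    fix p q r :: "'g free_algebra"
    assume "p - q \<in> uea_ideal" "q - r \<in> uea_ideal"
    from uea_ideal.add[OF this] show "p - r \<in> uea_ideal" by simp
  qed
qed

instantiation uea :: (complex_lie_algebra) "{ring_1, complex_vector}"
begin
lift_definition zero_uea :: "'a uea" is 0 .
lift_definition one_uea :: "'a uea" is 1 .
lift_definition plus_uea :: "'a uea \<Rightarrow> 'a uea \<Rightarrow> 'a uea" is "(+)"
  by (simp add: add_diff_add uea_ideal.add)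
lift_definition minus_uea :: "'a uea \<Rightarrow> 'a uea \<Rightarrow> 'a uea" is "(-)"
  by (subst diff_diff_add_both) (rule uea_ideal_diff)
lift_definition uminus_uea :: "'a uea \<Rightarrow> 'a uea" is uminus
  by (subst minus_diff_minus) (rule uea_ideal_uminus)
lift_definition times_uea :: "'a uea \<Rightarrow> 'a uea \<Rightarrow> 'a uea" is "(*)"
  by (rule uea_ideal_times_cong)
lift_definition scaleC_uea :: "complex \<Rightarrow> 'a uea \<Rightarrow> 'a uea" is scaleC
  by (subst complex_vector.scale_right_diff_distrib[symmetric]) (rule uea_ideal_scale)
instance
proof
  fix a b c :: "'a uea" and r s :: complex
  show "a + b + c = a + (b + c)" by transfer (simp add: uea_ideal.zero add.assoc)
  show "a + b = b + a" by transfer (simp add: uea_ideal.zero add.commute)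
  show "0 + a = a" by transfer (simp add: uea_ideal.zero)
  show "- a + a = 0" by transfer (simp add: uea_ideal.zero)
  show "a - b = a + - b" by transfer (simp add: uea_ideal.zero)
  show "a * b * c = a * (b * c)" by transfer (simp add: uea_ideal.zero mult.assoc)
  show "1 * a = a" by transfer (simp add: uea_ideal.zero)
  show "a * 1 = a" by transfer (simp add: uea_ideal.zero)
  show "(a + b) * c = a * c + b * c" by transfer (simp add: uea_ideal.zero distrib_right)
  show "a * (b + c) = a * b + a * c" by transfer (simp add: uea_ideal.zero distrib_left)
  show "(0::'a uea) \<noteq> 1"
  proof transfer
    show "(0 :: 'a free_algebra) - 1 \<notin> uea_ideal"
      by (rule notI, drule uea_ideal_lookup_zero) (simp add: lookup_minus)
  qed
  show "r *\<^sub>C (a + b) = r *\<^sub>C a + r *\<^sub>C b"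
    by transfer (simp add: uea_ideal.zero scaleC_add_right)
  show "(r + s) *\<^sub>C a = r *\<^sub>C a + s *\<^sub>C a"
    by transfer (simp add: uea_ideal.zero scaleC_add_left)
  show "r *\<^sub>C s *\<^sub>C a = (r * s) *\<^sub>C a" by transfer (simp add: uea_ideal.zero)
  show "1 *\<^sub>C a = a" by transfer (simp add: uea_ideal.zero)
qed
end


definition uea_in :: "'g::complex_lie_algebra \<Rightarrow> 'g uea"
  where "uea_in x = abs_uea (free_gen x)"

text \<open>The standard coproduct, the algebra homomorphism with \<open>x \<mapsto> x \<otimes> 1 + 1 \<otimes> x\<close> on \<open>\<gg>\<close>,
  and the standard counit, the algebra homomorphism with \<open>x \<mapsto> 0\<close> on \<open>\<gg>\<close>.\<close>

definition tensor_times :: "('a::{ring_1,complex_vector} \<otimes> 'a) \<Rightarrow> ('a \<otimes> 'a) \<Rightarrow> ('a \<otimes> 'a)"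
  where "tensor_times X Y = tlift (\<lambda>a b. tlift (\<lambda>c d. (a * c) \<otimes> (b * d)) Y) X"

definition uea_comult :: "'g::complex_lie_algebra uea \<Rightarrow> 'g uea \<otimes> 'g uea" where
  "uea_comult u = (\<Sum>w \<in> Poly_Mapping.keys (rep_uea u). Poly_Mapping.lookup (rep_uea u) w *\<^sub>C
     foldr (\<lambda>x. tensor_times (uea_in x \<otimes> 1 + 1 \<otimes> uea_in x)) (letters w) (1 \<otimes> 1))"

definition uea_counit :: "'g::complex_lie_algebra uea \<Rightarrow> complex"
  where "uea_counit u = Poly_Mapping.lookup (rep_uea u) (Word [])"

text \<open>The image of \<open>U\<eta>\<close> in \<open>U\<gg>\<close>.\<close>

definition uea_sub :: "'g::complex_lie_algebra set \<Rightarrow> 'g uea set"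
  where "uea_sub \<eta> = complex_vector.span {prod_list (map uea_in xs) | xs. set xs \<subseteq> \<eta>}"

definition hseries_in :: "'a::zero set \<Rightarrow> 'a fps set"
  where "hseries_in S = {a. \<forall>n. fps_nth a n \<in> S}"


section \<open>Quasi-triangular quantum universal enveloping algebras\<close>

record (overloaded) 'a hopf =
  hmul :: "'a fps \<Rightarrow> 'a fps \<Rightarrow> 'a fps"
  hone :: "'a fps"
  hcomul :: "'a fps \<Rightarrow> ('a \<otimes> 'a) fps"
  hcounit :: "'a fps \<Rightarrow> complex fps"

abbreviation hmul2 :: "'a::complex_vector hopf \<Rightarrow> ('a \<otimes> 'a) fps \<Rightarrow> ('a \<otimes> 'a) fps \<Rightarrow> ('a \<otimes> 'a) fps"
  where "hmul2 A \<equiv> hmul A \<boxtimes>\<^sub>m hmul A"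

abbreviation hmul3 :: "'a::complex_vector hopf \<Rightarrow>
    ('a \<otimes> 'a \<otimes> 'a) fps \<Rightarrow> ('a \<otimes> 'a \<otimes> 'a) fps \<Rightarrow> ('a \<otimes> 'a \<otimes> 'a) fps"
  where "hmul3 A \<equiv> hmul A \<boxtimes>\<^sub>m hmul A \<boxtimes>\<^sub>m hmul A"

definition comul_id :: "'a::complex_vector hopf \<Rightarrow> ('a \<otimes> 'a) fps \<Rightarrow> ('a \<otimes> 'a \<otimes> 'a) fps"
  where "comul_id A X = hassoc ((hcomul A \<boxtimes> id) X)"

definition id_comul :: "'a::complex_vector hopf \<Rightarrow> ('a \<otimes> 'a) fps \<Rightarrow> ('a \<otimes> 'a \<otimes> 'a) fps"
  where "id_comul A X = (id \<boxtimes> hcomul A) X"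

definition counit_id :: "'a::complex_vector hopf \<Rightarrow> ('a \<otimes> 'a) fps \<Rightarrow> 'a fps"
  where "counit_id A = hlift (\<lambda>a b. hscale (hcounit A (fps_const a)) (fps_const b))"

definition id_counit :: "'a::complex_vector hopf \<Rightarrow> ('a \<otimes> 'a) fps \<Rightarrow> 'a fps"
  where "id_counit A = hlift (\<lambda>a b. hscale (hcounit A (fps_const b)) (fps_const a))"

definition topological_hopf_algebra :: "'a::complex_vector hopf \<Rightarrow> bool" where
  "topological_hopf_algebra A \<longleftrightarrow>
    hbilinear (hmul A) \<and>
    (\<forall>x y z. hmul A (hmul A x y) z = hmul A x (hmul A y z)) \<and>
    (\<forall>x. hmul A (hone A) x = x \<and> hmul A x (hone A) = x) \<and>
    hlinear (hcomul A) \<and>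
    (\<forall>x. comul_id A (hcomul A x) = id_comul A (hcomul A x)) \<and>
    hlinear (hcounit A) \<and>
    (\<forall>x. counit_id A (hcomul A x) = x \<and> id_counit A (hcomul A x) = x) \<and>
    (\<forall>x y. hcomul A (hmul A x y) = hmul2 A (hcomul A x) (hcomul A y)) \<and>
    hcomul A (hone A) = hone A \<otimes>\<^sub>h hone A \<and>
    (\<forall>x y. hcounit A (hmul A x y) = hcounit A x * hcounit A y) \<and>
    hcounit A (hone A) = 1 \<and>
    (\<exists>S. hlinear S \<and>
      (\<forall>x. hlift (\<lambda>a b. hmul A (S (fps_const a)) (fps_const b)) (hcomul A x) =
             hscale (hcounit A x) (hone A) \<and>
           hlift (\<lambda>a b. hmul A (fps_const a) (S (fps_const b))) (hcomul A x) =
             hscale (hcounit A x) (hone A)))"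

text \<open>A topological Hopf algebra structure on \<open>U\<gg>[[\<hbar>]]\<close> that reduces modulo \<open>\<hbar>\<close> to the
  standard one on \<open>U\<gg>\<close>.\<close>

definition quantum_enveloping_algebra :: "'g::complex_lie_algebra uea hopf \<Rightarrow> bool" where
  "quantum_enveloping_algebra A \<longleftrightarrow>
    topological_hopf_algebra A \<and>
    (\<forall>x y. fps_nth (hmul A x y) 0 = fps_nth x 0 * fps_nth y 0) \<and>
    fps_nth (hone A) 0 = 1 \<and>
    (\<forall>x. fps_nth (hcomul A x) 0 = uea_comult (fps_nth x 0)) \<and>
    (\<forall>x. fps_nth (hcounit A x) 0 = uea_counit (fps_nth x 0))"

definition quasi_triangular :: "'a::complex_vector hopf \<Rightarrow> ('a \<otimes> 'a) fps \<Rightarrow> bool" where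
  "quasi_triangular A R \<longleftrightarrow>
    (let one2 = hone A \<otimes>\<^sub>h hone A;
         R12 = hassoc (R \<otimes>\<^sub>h hone A);
         R23 = hone A \<otimes>\<^sub>h R;
         R13 = hlift (\<lambda>a b. fps_const a \<otimes>\<^sub>h hone A \<otimes>\<^sub>h fps_const b) R
     in (\<exists>R'. hmul2 A R R' = one2 \<and> hmul2 A R' R = one2) \<and>
        (\<forall>x. hmul2 A R (hcomul A x) = hmul2 A (hmap tflip (hcomul A x)) R) \<and>
        comul_id A R = hmul3 A R13 R23 \<and>
        id_comul A R = hmul3 A R13 R12)"

definition commutative_subalgebra :: "'a::complex_vector hopf \<Rightarrow> 'a fps set \<Rightarrow> bool" where
  "commutative_subalgebra A S \<longleftrightarrow>
    hone A \<in> S \<and>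
    (\<forall>x\<in>S. \<forall>y\<in>S. x + y \<in> S \<and> hmul A x y \<in> S \<and> hmul A x y = hmul A y x) \<and>
    (\<forall>c. \<forall>x\<in>S. hscale c x \<in> S)"


section \<open>Meromorphic functions and meromorphic differential operators\<close>

text \<open>A basis of \<open>\<eta>\<close> indexed by \<open>'n\<close> identifies \<open>\<eta>\<^sup>*\<close> with \<open>complex ^ 'n\<close>.\<close>

definition holomorphic_vec :: "(complex ^ 'n \<Rightarrow> complex) \<Rightarrow> (complex ^ 'n) set \<Rightarrow> bool" where
  "holomorphic_vec f U \<longleftrightarrow>
    (\<forall>z\<in>U. \<exists>L. (f has_derivative L) (at z) \<and> (\<forall>c v. L (c *s v) = c * L v))"

definition meromorphic_vec :: "(complex ^ 'n \<Rightarrow> complex) \<Rightarrow> bool" where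
  "meromorphic_vec f \<longleftrightarrow>
    (\<forall>p. \<exists>U g h. open U \<and> p \<in> U \<and> holomorphic_vec g U \<and> holomorphic_vec h U \<and>
      (\<forall>V. open V \<and> V \<noteq> {} \<and> V \<subseteq> U \<longrightarrow> (\<exists>z\<in>V. h z \<noteq> 0)) \<and>
      (\<forall>z\<in>U. h z \<noteq> 0 \<longrightarrow> f z = g z / h z))"

text \<open>The values of a meromorphic function at poles and at points of indeterminacy are
  irrelevant: functions that agree on a dense open set are identified.\<close>

definition mero_eq :: "(complex ^ 'n \<Rightarrow> complex) \<Rightarrow> (complex ^ 'n \<Rightarrow> complex) \<Rightarrow> bool" where
  "mero_eq f g \<longleftrightarrow> meromorphic_vec f \<and> meromorphic_vec g \<and>
    (\<exists>S. open S \<and> closure S = UNIV \<and> (\<forall>z\<in>S. f z = g z))"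

lemma holomorphic_vec_const: "holomorphic_vec (\<lambda>_. c) U"
  unfolding holomorphic_vec_def by (auto intro!: exI[of _ "\<lambda>_. 0"])

lemma holomorphic_vec_add:
  assumes "holomorphic_vec f U" "holomorphic_vec g U"
  shows "holomorphic_vec (\<lambda>z. f z + g z) U"
  unfolding holomorphic_vec_def
proof
  fix z assume "z \<in> U"
  then obtain L M where "(f has_derivative L) (at z)" "\<forall>c v. L (c *s v) = c * L v"
    "(g has_derivative M) (at z)" "\<forall>c v. M (c *s v) = c * M v"
    using assms unfolding holomorphic_vec_def by meson
  then show "\<exists>L. ((\<lambda>z. f z + g z) has_derivative L) (at z) \<and> (\<forall>c v. L (c *s v) = c * L v)"
    by (intro exI[of _ "\<lambda>v. L v + M v"])
      (auto intro!: derivative_intros simp: distrib_left)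
qed

lemma holomorphic_vec_mult:
  assumes "holomorphic_vec f U" "holomorphic_vec g U"
  shows "holomorphic_vec (\<lambda>z. f z * g z) U"
  unfolding holomorphic_vec_def
proof
  fix z assume "z \<in> U"
  then obtain L M where "(f has_derivative L) (at z)" "\<forall>c v. L (c *s v) = c * L v"
    "(g has_derivative M) (at z)" "\<forall>c v. M (c *s v) = c * M v"
    using assms unfolding holomorphic_vec_def by meson
  then show "\<exists>L. ((\<lambda>z. f z * g z) has_derivative L) (at z) \<and> (\<forall>c v. L (c *s v) = c * L v)"
    by (intro exI[of _ "\<lambda>v. f z * M v + L v * g z"])
      (auto intro!: derivative_eq_intros simp: algebra_simps)
qed

lemma holomorphic_vec_subset: "holomorphic_vec f U \<Longrightarrow> V \<subseteq> U \<Longrightarrow> holomorphic_vec f V"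
  unfolding holomorphic_vec_def by blast

lemma holomorphic_vec_open_nonzero:
  assumes "holomorphic_vec h V" "open V"
  shows "open {z \<in> V. h z \<noteq> 0}"
proof -
  have "continuous_on V h"
    using assms unfolding holomorphic_vec_def
    by (meson continuous_at_imp_continuous_on has_derivative_continuous)
  then have "open (V \<inter> h -` (- {0}))"
    by (rule continuous_open_preimage) (simp_all add: assms open_Compl)
  moreover have "V \<inter> h -` (- {0}) = {z \<in> V. h z \<noteq> 0}" by auto
  ultimately show ?thesis by simp
qed

lemma meromorphic_vec_const: "meromorphic_vec (\<lambda>_. c)"
  unfolding meromorphic_vec_def
  by (rule allI, rule exI[of _ UNIV], rule exI[of _ "\<lambda>_. c"], rule exI[of _ "\<lambda>_. 1"])
    (auto simp: holomorphic_vec_const)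

lemma meromorphic_vec_combine:
  fixes f f' :: "complex ^ 'n \<Rightarrow> complex"
  assumes "meromorphic_vec f" "meromorphic_vec f'"
    and num: "\<And>g h g' h' (U :: (complex ^ 'n) set). holomorphic_vec g U \<Longrightarrow> holomorphic_vec h U \<Longrightarrow>
      holomorphic_vec g' U \<Longrightarrow> holomorphic_vec h' U \<Longrightarrow>
      holomorphic_vec (\<lambda>z. N (g z) (h z) (g' z) (h' z)) U"
    and eq: "\<And>a b a' b'. b \<noteq> 0 \<Longrightarrow> b' \<noteq> 0 \<Longrightarrow> K (a / b) (a' / b') = N a b a' b' / (b * b')"
  shows "meromorphic_vec (\<lambda>z. K (f z) (f' z))"
  unfolding meromorphic_vec_def
proof
  fix p
  obtain U g h where U: "open U" "p \<in> U" "holomorphic_vec g U" "holomorphic_vec h U"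
    "\<And>V. open V \<Longrightarrow> V \<noteq> {} \<Longrightarrow> V \<subseteq> U \<Longrightarrow> \<exists>z\<in>V. h z \<noteq> 0"
    "\<And>z. z \<in> U \<Longrightarrow> h z \<noteq> 0 \<Longrightarrow> f z = g z / h z"
    using assms(1) unfolding meromorphic_vec_def by (metis (full_types))
  obtain U' g' h' where U': "open U'" "p \<in> U'" "holomorphic_vec g' U'" "holomorphic_vec h' U'"
    "\<And>V. open V \<Longrightarrow> V \<noteq> {} \<Longrightarrow> V \<subseteq> U' \<Longrightarrow> \<exists>z\<in>V. h' z \<noteq> 0"
    "\<And>z. z \<in> U' \<Longrightarrow> h' z \<noteq> 0 \<Longrightarrow> f' z = g' z / h' z"
    using assms(2) unfolding meromorphic_vec_def by (metis (full_types))
  have hol: "holomorphic_vec g (U \<inter> U')" "holomorphic_vec h (U \<inter> U')"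
    "holomorphic_vec g' (U \<inter> U')" "holomorphic_vec h' (U \<inter> U')"
    using U U' by (auto intro: holomorphic_vec_subset)
  have nz: "\<exists>z\<in>V. h z * h' z \<noteq> 0" if V: "open V" "V \<noteq> {}" "V \<subseteq> U \<inter> U'" for V
  proof -
    let ?W = "{z \<in> V. h z \<noteq> 0}"
    have "open ?W"
      using V hol by (intro holomorphic_vec_open_nonzero) (auto intro: holomorphic_vec_subset)
    moreover have "?W \<noteq> {}" using U(5)[of V] V by auto
    ultimately have "\<exists>z\<in>?W. h' z \<noteq> 0" using U'(5)[of ?W] V by auto
    then show ?thesis by auto
  qed
  show "\<exists>U g h. open U \<and> p \<in> U \<and> holomorphic_vec g U \<and> holomorphic_vec h U \<and>
      (\<forall>V. open V \<and> V \<noteq> {} \<and> V \<subseteq> U \<longrightarrow> (\<exists>z\<in>V. h z \<noteq> 0)) \<and>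
      (\<forall>z\<in>U. h z \<noteq> 0 \<longrightarrow> K (f z) (f' z) = g z / h z)"
  proof (intro exI conjI allI impI ballI)
    show "open (U \<inter> U')" "p \<in> U \<inter> U'" using U U' by auto
    show "holomorphic_vec (\<lambda>z. N (g z) (h z) (g' z) (h' z)) (U \<inter> U')" by (intro num hol)
    show "holomorphic_vec (\<lambda>z. h z * h' z) (U \<inter> U')" by (intro holomorphic_vec_mult hol)
    show "\<exists>z\<in>V. h z * h' z \<noteq> 0" if "open V \<and> V \<noteq> {} \<and> V \<subseteq> U \<inter> U'" for V
      using nz that by blast
    show "K (f z) (f' z) = N (g z) (h z) (g' z) (h' z) / (h z * h' z)"
      if "z \<in> U \<inter> U'" "h z * h' z \<noteq> 0" for z
      using that U(6)[of z] U'(6)[of z] eq by auto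
  qed
qed

lemma meromorphic_vec_add:
  assumes "meromorphic_vec f" "meromorphic_vec g"
  shows "meromorphic_vec (\<lambda>z. f z + g z)"
  by (rule meromorphic_vec_combine[OF assms, where N = "\<lambda>a b a' b'. a * b' + a' * b"])
    (auto intro!: holomorphic_vec_add holomorphic_vec_mult simp: divide_simps)

lemma meromorphic_vec_mult:
  assumes "meromorphic_vec f" "meromorphic_vec g"
  shows "meromorphic_vec (\<lambda>z. f z * g z)"
  by (rule meromorphic_vec_combine[OF assms, where N = "\<lambda>a b a' b'. a * a'"])
    (auto intro!: holomorphic_vec_mult)

lemma meromorphic_vec_uminus: "meromorphic_vec f \<Longrightarrow> meromorphic_vec (\<lambda>z. - f z)"
  using meromorphic_vec_mult[OF meromorphic_vec_const[of "- 1"], of f] by simp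

lemma meromorphic_vec_diff:
  "meromorphic_vec f \<Longrightarrow> meromorphic_vec g \<Longrightarrow> meromorphic_vec (\<lambda>z. f z - g z)"
  using meromorphic_vec_add[OF _ meromorphic_vec_uminus, of f g] by simp

lemma dense_open_Int:
  assumes "open S" "closure S = UNIV" "open T" "closure T = (UNIV :: 'a::topological_space set)"
  shows "open (S \<inter> T) \<and> closure (S \<inter> T) = UNIV"
proof -
  have "S \<subseteq> closure (S \<inter> T)"
    using open_Int_closure_subset[of S T] assms by simp
  then have "closure S \<subseteq> closure (S \<inter> T)" by (simp add: closure_minimal)
  then show ?thesis using assms by auto
qed

lemma mero_eq_refl: "meromorphic_vec f \<Longrightarrow> mero_eq f f"
  unfolding mero_eq_def by (auto intro!: exI[of _ UNIV])

lemma mero_eq_D: "mero_eq f g \<Longrightarrow> meromorphic_vec f"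
  by (simp add: mero_eq_def)

lemma mero_eq_map2:
  fixes f f' g g' :: "complex ^ 'n \<Rightarrow> complex"
  assumes "mero_eq f f'" "mero_eq g g'"
    and K: "\<And>f g :: complex ^ 'n \<Rightarrow> complex.
      meromorphic_vec f \<Longrightarrow> meromorphic_vec g \<Longrightarrow> meromorphic_vec (\<lambda>z. K (f z) (g z))"
  shows "mero_eq (\<lambda>z. K (f z) (g z)) (\<lambda>z. K (f' z) (g' z))"
  unfolding mero_eq_def
proof (intro conjI)
  show "meromorphic_vec (\<lambda>z. K (f z) (g z))" "meromorphic_vec (\<lambda>z. K (f' z) (g' z))"
    using assms(1,2) by (simp_all add: mero_eq_def K)
  obtain S T where "open S" "closure S = UNIV" "\<forall>z\<in>S. f z = f' z"
    and "open T" "closure T = UNIV" "\<forall>z\<in>T. g z = g' z"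
    using assms(1,2) unfolding mero_eq_def by blast
  then show "\<exists>S. open S \<and> closure S = UNIV \<and> (\<forall>z\<in>S. K (f z) (g z) = K (f' z) (g' z))"
    using dense_open_Int[of S T] by (intro exI[of _ "S \<inter> T"]) auto
qed

quotient_type 'n mero = "complex ^ 'n \<Rightarrow> complex" / partial: mero_eq
proof (rule part_equivpI)
  show "\<exists>f :: complex ^ 'n \<Rightarrow> complex. mero_eq f f"
    using mero_eq_refl[OF meromorphic_vec_const] by blast
  show "symp (mero_eq :: (complex ^ 'n \<Rightarrow> complex) \<Rightarrow> _)"
    by (rule sympI) (metis (no_types, lifting) mero_eq_def)
  show "transp (mero_eq :: (complex ^ 'n \<Rightarrow> complex) \<Rightarrow> _)"
  proof (rule transpI)
    fix f g k :: "complex ^ 'n \<Rightarrow> complex"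
    assume "mero_eq f g" "mero_eq g k"
    moreover obtain S T where "open S" "closure S = UNIV" "\<forall>z\<in>S. f z = g z"
      and "open T" "closure T = UNIV" "\<forall>z\<in>T. g z = k z"
      using calculation unfolding mero_eq_def by blast
    ultimately show "mero_eq f k"
      using dense_open_Int[of S T] unfolding mero_eq_def
      by (intro conjI exI[of _ "S \<inter> T"]) auto
  qed
qed

instantiation mero :: (finite) "{comm_ring_1, complex_vector}"
begin
lift_definition zero_mero :: "'a mero" is "\<lambda>_. 0"
  by (intro mero_eq_refl meromorphic_vec_const)
lift_definition one_mero :: "'a mero" is "\<lambda>_. 1"
  by (intro mero_eq_refl meromorphic_vec_const)
lift_definition plus_mero :: "'a mero \<Rightarrow> 'a mero \<Rightarrow> 'a mero" is "\<lambda>f g z. f z + g z"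
  by (rule mero_eq_map2) (auto intro: meromorphic_vec_add)
lift_definition minus_mero :: "'a mero \<Rightarrow> 'a mero \<Rightarrow> 'a mero" is "\<lambda>f g z. f z - g z"
  by (rule mero_eq_map2) (auto intro: meromorphic_vec_diff)
lift_definition uminus_mero :: "'a mero \<Rightarrow> 'a mero" is "\<lambda>f z. - f z"
  by (rule mero_eq_map2[where K = "\<lambda>a b. - a"]) (auto intro: meromorphic_vec_uminus)
lift_definition times_mero :: "'a mero \<Rightarrow> 'a mero \<Rightarrow> 'a mero" is "\<lambda>f g z. f z * g z"
  by (rule mero_eq_map2) (auto intro: meromorphic_vec_mult)
lift_definition scaleC_mero :: "complex \<Rightarrow> 'a mero \<Rightarrow> 'a mero" is "\<lambda>c f z. c * f z"
  by (rule mero_eq_map2[where K = "\<lambda>a b. _ * a"])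
    (auto intro: meromorphic_vec_mult meromorphic_vec_const)
instance
proof
  fix a b c :: "'a mero" and r s :: complex
  note intros = mero_eq_refl meromorphic_vec_add meromorphic_vec_mult meromorphic_vec_diff
    meromorphic_vec_uminus meromorphic_vec_const mero_eq_D
  show "a + b + c = a + (b + c)" by transfer (simp add: add.assoc intros)
  show "a + b = b + a" by transfer (simp add: add.commute intros)
  show "0 + a = a" by transfer simp
  show "- a + a = 0" by transfer (simp add: intros)
  show "a - b = a + - b" by transfer (simp add: intros)
  show "a * b * c = a * (b * c)" by transfer (simp add: mult.assoc intros)
  show "a * b = b * a" by transfer (simp add: mult.commute intros)
  show "1 * a = a" by transfer simp
  show "(a + b) * c = a * c + b * c" by transfer (simp add: distrib_right intros)
  show "(0::'a mero) \<noteq> 1" by transfer (auto simp: mero_eq_def)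
  show "r *\<^sub>C (a + b) = r *\<^sub>C a + r *\<^sub>C b" by transfer (simp add: distrib_left intros)
  show "(r + s) *\<^sub>C a = r *\<^sub>C a + s *\<^sub>C a" by transfer (simp add: distrib_right intros)
  show "r *\<^sub>C s *\<^sub>C a = (r * s) *\<^sub>C a" by transfer (simp add: mult.assoc intros)
  show "1 *\<^sub>C a = a" by transfer simp
qed
end

text \<open>The partial derivative of a representative exists on the dense open set on which it is
  locally a quotient of holomorphic functions.\<close>

definition mero_partial :: "'n \<Rightarrow> 'n mero \<Rightarrow> 'n::finite mero" where
  "mero_partial i f = abs_mero (\<lambda>z. deriv (\<lambda>t. rep_mero f (z + t *s axis i 1)) 0)"

text \<open>The algebra of meromorphic differential operators is the algebra of operators on
  meromorphic functions generated by multiplications and partial derivatives.\<close>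

inductive_set diffops :: "('n::finite mero \<Rightarrow> 'n mero) set" where
  mult: "(\<lambda>g. f * g) \<in> diffops"
| partial: "mero_partial i \<in> diffops"
| add: "D \<in> diffops \<Longrightarrow> E \<in> diffops \<Longrightarrow> (\<lambda>g. D g + E g) \<in> diffops"
| comp: "D \<in> diffops \<Longrightarrow> E \<in> diffops \<Longrightarrow> D \<circ> E \<in> diffops"

typedef 'n diffop = "diffops :: ('n::finite mero \<Rightarrow> 'n mero) set"
  morphisms diffop_apply Diffop
  using diffops.mult by blast

setup_lifting type_definition_diffop

lemma scaleC_mero_conv: "c *\<^sub>C f = (c *\<^sub>C 1) * (f :: 'n::finite mero)"
  by transfer (simp add: mero_eq_refl meromorphic_vec_mult meromorphic_vec_const mero_eq_D)

instantiation diffop :: (finite) complex_vector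
begin
lift_definition zero_diffop :: "'a diffop" is "\<lambda>_. 0"
proof -
  have "(\<lambda>g :: 'a mero. 0 * g) = (\<lambda>_. 0)" by (simp add: fun_eq_iff)
  then show "(\<lambda>_. 0) \<in> (diffops :: ('a mero \<Rightarrow> 'a mero) set)" using diffops.mult[of 0] by metis
qed
lift_definition plus_diffop :: "'a diffop \<Rightarrow> 'a diffop \<Rightarrow> 'a diffop" is "\<lambda>D E g. D g + E g"
  by (rule diffops.add)
lift_definition uminus_diffop :: "'a diffop \<Rightarrow> 'a diffop" is "\<lambda>D g. - D g"
  subgoal for D using diffops.comp[OF diffops.mult[of "- 1"], of D] by (simp add: comp_def)
  done
lift_definition minus_diffop :: "'a diffop \<Rightarrow> 'a diffop \<Rightarrow> 'a diffop" is "\<lambda>D E g. D g - E g"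
  subgoal for D E
    using diffops.add[OF _ diffops.comp[OF diffops.mult[of "- 1"]], of D E] by (simp add: comp_def)
  done
lift_definition scaleC_diffop :: "complex \<Rightarrow> 'a diffop \<Rightarrow> 'a diffop" is "\<lambda>c D g. c *\<^sub>C D g"
  subgoal for c D
    using diffops.comp[OF diffops.mult[of "c *\<^sub>C 1"], of D]
    by (simp add: comp_def flip: scaleC_mero_conv)
  done
instance
  by standard (transfer, simp add: fun_eq_iff algebra_simps scaleC_add_right scaleC_add_left)+
end

definition diffop_fun :: "'n::finite mero \<Rightarrow> 'n diffop"
  where "diffop_fun f = Diffop (\<lambda>g. f * g)"

definition diffop_partial :: "'n \<Rightarrow> 'n::finite diffop"
  where "diffop_partial i = Diffop (mero_partial i)"

lift_definition diffop_comp :: "'n::finite diffop \<Rightarrow> 'n diffop \<Rightarrow> 'n diffop" is "(\<circ>)"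
  by (rule diffops.comp)


section \<open>The Hopf algebroid\<close>

text \<open>\<open>H = ('n diffop \<otimes> 'u) fps\<close>. First the algebras \<open>H\<close> and \<open>H \<otimes> H\<close>, the latter the tensor
  product over \<open>\<complex>[[\<hbar>]]\<close>.\<close>

type_synonym ('n, 'u) hd = "'n diffop \<otimes> 'u"

definition H_mul :: "'u::complex_vector hopf \<Rightarrow>
    ('n::finite, 'u) hd fps \<Rightarrow> ('n, 'u) hd fps \<Rightarrow> ('n, 'u) hd fps"
  where "H_mul A = hcauchy diffop_comp \<boxtimes>\<^sub>m hmul A"

definition H_one :: "'u::complex_vector hopf \<Rightarrow> ('n::finite, 'u) hd fps"
  where "H_one A = fps_const (diffop_fun 1) \<otimes>\<^sub>h hone A"

definition HH_mul :: "'u::complex_vector hopf \<Rightarrow>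
    (('n::finite, 'u) hd \<otimes> ('n, 'u) hd) fps \<Rightarrow> (('n, 'u) hd \<otimes> ('n, 'u) hd) fps \<Rightarrow>
    (('n, 'u) hd \<otimes> ('n, 'u) hd) fps"
  where "HH_mul A = H_mul A \<boxtimes>\<^sub>m H_mul A"

text \<open>Left multiplication by functions, and the tensor products \<open>H \<otimes>\<^sub>R H\<close> and
  \<open>H \<otimes>\<^sub>R H \<otimes>\<^sub>R H\<close>: these are \<open>('n, 'u) hh fps\<close> and \<open>('n, 'u) hhh fps\<close>.\<close>

definition hd_act :: "'n::finite mero \<Rightarrow> ('n, 'u::complex_vector) hd \<Rightarrow> ('n, 'u) hd"
  where "hd_act f = tmap (diffop_comp (diffop_fun f)) id"

definition balance2 :: "(('n::finite, 'u::complex_vector) hd \<otimes> ('n, 'u) hd) set"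
  where "balance2 = complex_vector.span {hd_act f x \<otimes> y - x \<otimes> hd_act f y | f x y. True}"

definition balance3 :: "(('n::finite, 'u::complex_vector) hd \<otimes> ('n, 'u) hd \<otimes> ('n, 'u) hd) set"
  where "balance3 = complex_vector.span
    ({hd_act f x \<otimes> y \<otimes> z - x \<otimes> hd_act f y \<otimes> z | f x y z. True} \<union>
     {x \<otimes> hd_act f y \<otimes> z - x \<otimes> y \<otimes> hd_act f z | f x y z. True})"

quotient_type (overloaded) ('n, 'u) hh =
  "('n::finite, 'u::complex_vector) hd \<otimes> ('n, 'u) hd" / "\<lambda>x y. x - y \<in> balance2"
  unfolding balance2_def by (rule equivp_mod_span)

quotient_type (overloaded) ('n, 'u) hhh =
  "('n::finite, 'u::complex_vector) hd \<otimes> ('n, 'u) hd \<otimes> ('n, 'u) hd" / "\<lambda>x y. x - y \<in> balance3"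
  unfolding balance3_def by (rule equivp_mod_span)

instantiation hh :: (finite, complex_vector) complex_vector
begin
lift_definition zero_hh :: "('a, 'b) hh" is 0 .
lift_definition plus_hh :: "('a, 'b) hh \<Rightarrow> ('a, 'b) hh \<Rightarrow> ('a, 'b) hh" is "(+)"
  unfolding balance2_def by (rule span_diff_add)
lift_definition minus_hh :: "('a, 'b) hh \<Rightarrow> ('a, 'b) hh \<Rightarrow> ('a, 'b) hh" is "(-)"
  unfolding balance2_def by (rule span_diff_diff)
lift_definition uminus_hh :: "('a, 'b) hh \<Rightarrow> ('a, 'b) hh" is uminus
  unfolding balance2_def by (rule span_diff_uminus)
lift_definition scaleC_hh :: "complex \<Rightarrow> ('a, 'b) hh \<Rightarrow> ('a, 'b) hh" is scaleC
  unfolding balance2_def by (rule span_diff_scale)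
instance
  by standard (transfer, simp add: balance2_def complex_vector.span_zero algebra_simps
      scaleC_add_right scaleC_add_left)+
end

instantiation hhh :: (finite, complex_vector) complex_vector
begin
lift_definition zero_hhh :: "('a, 'b) hhh" is 0 .
lift_definition plus_hhh :: "('a, 'b) hhh \<Rightarrow> ('a, 'b) hhh \<Rightarrow> ('a, 'b) hhh" is "(+)"
  unfolding balance3_def by (rule span_diff_add)
lift_definition minus_hhh :: "('a, 'b) hhh \<Rightarrow> ('a, 'b) hhh \<Rightarrow> ('a, 'b) hhh" is "(-)"
  unfolding balance3_def by (rule span_diff_diff)
lift_definition uminus_hhh :: "('a, 'b) hhh \<Rightarrow> ('a, 'b) hhh" is uminus
  unfolding balance3_def by (rule span_diff_uminus)
lift_definition scaleC_hhh :: "complex \<Rightarrow> ('a, 'b) hhh \<Rightarrow> ('a, 'b) hhh" is scaleC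
  unfolding balance3_def by (rule span_diff_scale)
instance
  by standard (transfer, simp add: balance3_def complex_vector.span_zero algebra_simps
      scaleC_add_right scaleC_add_left)+
end

abbreviation to_HH :: "(('n::finite, 'u::complex_vector) hd \<otimes> ('n, 'u) hd) fps \<Rightarrow> ('n, 'u) hh fps"
  where "to_HH \<equiv> hmap abs_hh"

abbreviation to_HHH :: "(('n::finite, 'u::complex_vector) hd \<otimes> ('n, 'u) hd \<otimes> ('n, 'u) hd) fps \<Rightarrow>
    ('n, 'u) hhh fps"
  where "to_HHH \<equiv> hmap abs_hhh"

text \<open>A representative in \<open>H \<otimes> H\<close> of an element of \<open>H \<otimes>\<^sub>R H\<close>. Everything below that uses it
  is independent of the choice.\<close>

abbreviation HH_rep :: "('n::finite, 'u::complex_vector) hh fps \<Rightarrow> (('n, 'u) hd \<otimes> ('n, 'u) hd) fps"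
  where "HH_rep \<equiv> hmap rep_hh"

text \<open>The bidifferential operator \<open>(f, g) \<mapsto> \<Sum> D\<^sub>i f \<cdot> E\<^sub>i g\<close> of \<open>\<Sum> D\<^sub>i \<otimes> E\<^sub>i\<close>. It determines the
  class of \<open>\<Sum> D\<^sub>i \<otimes> E\<^sub>i\<close> in the tensor product over meromorphic functions, so that the choice
  in \<open>diffop_comul\<close> does not affect \<open>H_comul\<close>.\<close>

definition bidiff :: "('n::finite diffop \<otimes> 'n diffop) \<Rightarrow> 'n mero \<Rightarrow> 'n mero \<Rightarrow> 'n mero"
  where "bidiff T f g = tlift (\<lambda>D E. diffop_apply D f * diffop_apply E g) T"

definition diffop_comul :: "'n::finite diffop \<Rightarrow> 'n diffop \<otimes> 'n diffop"
  where "diffop_comul D = (SOME T. \<forall>f g. bidiff T f g = diffop_apply D (f * g))"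

definition H_comul :: "'u::complex_vector hopf \<Rightarrow> ('n::finite, 'u) hd fps \<Rightarrow> ('n, 'u) hh fps"
  where "H_comul A = hlift (\<lambda>D u.
    to_HH (hmap tinterchange (fps_const (diffop_comul D) \<otimes>\<^sub>h hcomul A (fps_const u))))"

text \<open>The counit has values in \<open>R = ('n mero) fps\<close>.\<close>

definition H_counit :: "'u::complex_vector hopf \<Rightarrow> ('n::finite, 'u) hd fps \<Rightarrow> 'n mero fps"
  where "H_counit A = hlift (\<lambda>D u.
    hscale (hcounit A (fps_const u)) (fps_const (diffop_apply D 1)))"

text \<open>\<open>comul_act A x Z\<close> is \<open>\<Delta> x \<cdot> Z\<close> for \<open>Z \<in> H \<otimes>\<^sub>R H\<close>. The product of \<open>H \<otimes> H\<close> does not descend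
  to \<open>H \<otimes>\<^sub>R H\<close>, but left multiplication by elements \<open>\<Delta> x\<close> does.\<close>

definition comul_act :: "'u::complex_vector hopf \<Rightarrow> ('n::finite, 'u) hd fps \<Rightarrow>
    ('n, 'u) hh fps \<Rightarrow> ('n, 'u) hh fps"
  where "comul_act A x Z = to_HH (HH_mul A (HH_rep (H_comul A x)) (HH_rep Z))"

definition HH_tensor_H :: "('n::finite, 'u::complex_vector) hh fps \<Rightarrow> ('n, 'u) hd fps \<Rightarrow>
    ('n, 'u) hhh fps"
  where "HH_tensor_H Z y = to_HHH (hassoc (HH_rep Z \<otimes>\<^sub>h y))"

definition H_tensor_HH :: "('n::finite, 'u::complex_vector) hd fps \<Rightarrow> ('n, 'u) hh fps \<Rightarrow>
    ('n, 'u) hhh fps"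
  where "H_tensor_HH x Z = to_HHH (x \<otimes>\<^sub>h HH_rep Z)"

text \<open>For \<open>\<F> = \<Sum> x\<^sub>i \<otimes>\<^sub>R y\<^sub>i\<close> the two sides of the twistor equation are
  \<open>\<Sum> (\<Delta> x\<^sub>i \<cdot> \<F>) \<otimes>\<^sub>R y\<^sub>i\<close> and \<open>\<Sum> x\<^sub>i \<otimes>\<^sub>R (\<Delta> y\<^sub>i \<cdot> \<F>)\<close>. In the counit conditions
  \<open>f \<otimes>\<^sub>R x\<close> and \<open>x \<otimes>\<^sub>R f\<close> correspond to \<open>f x\<close>, as source and target map coincide.\<close>

definition twist_left :: "'u::complex_vector hopf \<Rightarrow> ('n::finite, 'u) hh fps \<Rightarrow> ('n, 'u) hhh fps"
  where "twist_left A \<F> =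
    hlift (\<lambda>x y. HH_tensor_H (comul_act A (fps_const x) \<F>) (fps_const y)) (HH_rep \<F>)"

definition twist_right :: "'u::complex_vector hopf \<Rightarrow> ('n::finite, 'u) hh fps \<Rightarrow> ('n, 'u) hhh fps"
  where "twist_right A \<F> =
    hlift (\<lambda>x y. H_tensor_HH (fps_const x) (comul_act A (fps_const y) \<F>)) (HH_rep \<F>)"

definition H_counit_id :: "'u::complex_vector hopf \<Rightarrow> ('n::finite, 'u) hh fps \<Rightarrow> ('n, 'u) hd fps"
  where "H_counit_id A \<F> =
    hlift (\<lambda>x y. hcauchy hd_act (H_counit A (fps_const x)) (fps_const y)) (HH_rep \<F>)"

definition H_id_counit :: "'u::complex_vector hopf \<Rightarrow> ('n::finite, 'u) hh fps \<Rightarrow> ('n, 'u) hd fps"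
  where "H_id_counit A \<F> =
    hlift (\<lambda>x y. hcauchy hd_act (H_counit A (fps_const y)) (fps_const x)) (HH_rep \<F>)"

definition twistor :: "'u::complex_vector hopf \<Rightarrow> ('n::finite, 'u) hh fps \<Rightarrow> bool" where
  "twistor A \<F> \<longleftrightarrow>
    twist_left A \<F> = twist_right A \<F> \<and> H_counit_id A \<F> = H_one A \<and> H_id_counit A \<F> = H_one A"


section \<open>Dynamical twists\<close>

text \<open>Meromorphic functions on \<open>\<eta>\<^sup>*\<close> with values in \<open>U\<^sub>\<hbar>\<gg> \<otimes> U\<^sub>\<hbar>\<gg>\<close>, as a completed tensor
  product. Below, \<open>h i\<close> is the \<open>i\<close>-th basis element of \<open>\<eta>\<close>.\<close>

type_synonym ('n, 'u) mero2 = "('n mero \<otimes> 'u \<otimes> 'u) fps"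
type_synonym ('n, 'u) mero3 = "('n mero \<otimes> 'u \<otimes> 'u \<otimes> 'u) fps"

definition mero2_mul :: "'u::complex_vector hopf \<Rightarrow>
    ('n::finite, 'u) mero2 \<Rightarrow> ('n, 'u) mero2 \<Rightarrow> ('n, 'u) mero2"
  where "mero2_mul A = hcauchy (*) \<boxtimes>\<^sub>m hmul2 A"

definition mero3_mul :: "'u::complex_vector hopf \<Rightarrow>
    ('n::finite, 'u) mero3 \<Rightarrow> ('n, 'u) mero3 \<Rightarrow> ('n, 'u) mero3"
  where "mero3_mul A = hcauchy (*) \<boxtimes>\<^sub>m hmul3 A"

definition h_elem :: "'g::complex_lie_algebra \<Rightarrow> 'g uea fps"
  where "h_elem x = fps_const (uea_in x)"

definition delta :: "'g::complex_lie_algebra uea hopf \<Rightarrow> 'g \<Rightarrow> ('g uea \<otimes> 'g uea) fps"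
  where "delta A x = h_elem x \<otimes>\<^sub>h hone A + hone A \<otimes>\<^sub>h h_elem x"

definition zero_weight :: "'g::complex_lie_algebra uea hopf \<Rightarrow> 'g set \<Rightarrow>
    ('n::finite, 'g uea) mero2 \<Rightarrow> bool"
  where "zero_weight A \<eta> F \<longleftrightarrow>
    (\<forall>x\<in>\<eta>. mero2_mul A F (1 \<otimes>\<^sub>h delta A x) = mero2_mul A (1 \<otimes>\<^sub>h delta A x) F)"

text \<open>\<open>f \<otimes> u \<otimes> v \<mapsto> f u \<otimes> v\<close>; in \<open>H \<otimes>\<^sub>R H\<close> the position of \<open>f\<close> does not matter.\<close>

definition mero2_to_H2 :: "('n::finite, 'u::complex_vector) mero2 \<Rightarrow>
    (('n, 'u) hd \<otimes> ('n, 'u) hd) fps"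
  where "mero2_to_H2 =
    hmap (tlift (\<lambda>f. tlift (\<lambda>u v. (diffop_fun f \<otimes> u) \<otimes> (diffop_fun 1 \<otimes> v))))"

definition theta :: "'g::complex_lie_algebra uea hopf \<Rightarrow> ('n::finite \<Rightarrow> 'g) \<Rightarrow>
    (('n, 'g uea) hd \<otimes> ('n, 'g uea) hd) fps"
  where "theta A h = (\<Sum>i\<in>UNIV.
    (fps_const (diffop_partial i) \<otimes>\<^sub>h hone A) \<otimes>\<^sub>h (fps_const (diffop_fun 1) \<otimes>\<^sub>h h_elem (h i)))"

definition Theta :: "'g::complex_lie_algebra uea hopf \<Rightarrow> ('n::finite \<Rightarrow> 'g) \<Rightarrow>
    (('n, 'g uea) hd \<otimes> ('n, 'g uea) hd) fps"
  where "Theta A h = hexp (HH_mul A) (H_one A \<otimes>\<^sub>h H_one A) (theta A h)"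

definition dynamical_twistor :: "'g::complex_lie_algebra uea hopf \<Rightarrow> ('n::finite \<Rightarrow> 'g) \<Rightarrow>
    ('n, 'g uea) mero2 \<Rightarrow> ('n, 'g uea) hh fps"
  where "dynamical_twistor A h F = to_HH (HH_mul A (mero2_to_H2 F) (Theta A h))"

definition mero2_partial :: "'n::finite \<Rightarrow> ('n, 'u::complex_vector) mero2 \<Rightarrow> ('n, 'u) mero2"
  where "mero2_partial i = hmap (tmap (mero_partial i) id)"

definition mero2_tensor :: "('n::finite, 'u::complex_vector) mero2 \<Rightarrow> 'u fps \<Rightarrow> ('n, 'u) mero3"
  where "mero2_tensor F w = (id \<boxtimes> hassoc) (hassoc (F \<otimes>\<^sub>h w))"

text \<open>\<open>F12_shifted A h F\<close> is \<open>F\<^sup>1\<^sup>2(\<lambda> + \<hbar> h\<^sup>(\<^sup>3\<^sup>))\<close>, the formal Taylor expansion.\<close>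

definition F12_shifted :: "'g::complex_lie_algebra uea hopf \<Rightarrow> ('n::finite \<Rightarrow> 'g) \<Rightarrow>
    ('n, 'g uea) mero2 \<Rightarrow> ('n, 'g uea) mero3"
  where "F12_shifted A h F = hseries (\<lambda>n. (1 / fact n) *\<^sub>C
    (\<Sum>is \<in> {is. length is = n}.
      mero2_tensor (foldr mero2_partial is F)
        (foldr (\<lambda>i. hmul A (h_elem (h i))) is (hone A))))"

definition F23 :: "'u::complex_vector hopf \<Rightarrow> ('n::finite, 'u) mero2 \<Rightarrow> ('n, 'u) mero3"
  where "F23 A F = (id \<boxtimes> (\<lambda>t. hone A \<otimes>\<^sub>h t)) F"

end

theory Submission
  imports Defs "HOL-Complex_Analysis.Complex_Analysis"
begin

text \<open>Write \<open>L\<^sub>x\<close> and \<open>R\<^sub>x\<close> for left and right multiplication by \<open>x\<close>, so that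
  \<open>\<F> = exp (\<hbar> R\<^sub>\<theta>) F\<close>. Since \<open>(\<Delta> \<otimes> id) \<theta> = \<theta>\<^sup>1\<^sup>3 + \<theta>\<^sup>2\<^sup>3\<close>, the left-hand side of the twistor equation is
  \<open>(\<Delta>\<^sub>0 \<otimes> id) F\<close> times \<open>exp (\<hbar> L\<^sub>\<kappa>) \<F>\<^sup>1\<^sup>2\<close> with \<open>\<kappa> = \<theta>\<^sup>1\<^sup>3 + \<theta>\<^sup>2\<^sup>3\<close>. Now \<open>L\<^sub>\<kappa>\<close> is the sum of the commuting
  operators \<open>R\<^sub>\<kappa>\<close> and \<open>L\<^sub>\<kappa> - R\<^sub>\<kappa>\<close>, and on functions of \<open>\<lambda>\<close> the latter is \<open>\<Sum>\<^sub>i \<partial>/\<partial>\<lambda>\<^sub>i \<otimes> h\<^sub>i\<^sup>(\<^sup>3\<^sup>)\<close>, whose exponential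
  is the dynamical shift. On the right-hand side, \<open>F\<^sup>2\<^sup>3\<close> commutes with \<open>\<theta>\<^sup>1\<^sup>2 + \<theta>\<^sup>1\<^sup>3\<close> because \<open>F\<close> has zero
  weight. Thus both sides are images of functions under \<open>exp (\<hbar> R)\<close> for the same element
  \<open>\<theta>\<^sup>1\<^sup>2 + \<theta>\<^sup>1\<^sup>3 + \<theta>\<^sup>2\<^sup>3\<close>; evaluating tridifferential operators at the constant function \<open>1\<close> removes this
  exponential and recovers the functions.

  All operations on \<open>H \<otimes>\<^sub>R H\<close> are defined through representatives. They do not depend on the choices
  because a bidifferential operator determines its class in the tensor product of \<open>\<D>\<close> with itself over
  the meromorphic functions. This in turn holds because the meromorphic functions form a field.\<close>

text \<open>The obstacle is that the products of H \<otimes> H and of its threefold analogue do not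
  descend to the tensor products over R, where the twistor equation lives. The balance relations are
  left multiplications by functions, so right multiplication by an arbitrary element respects them,
  while left multiplication in general does not. Therefore all exponentials are computed upstairs,
  in tensor products over \<complex>[[\<hbar>]] with the associative product \<open>HHH_mul\<close>,
  and \<open>to_HHH\<close> is applied last. Each side of the equation is treated as a pairing of a
  factor Q upstairs with an argument Z whose coproduct is taken. Right multiplication of Z by
  \<theta> is adjoint to left multiplication of Q by the coproduct of \<theta>, which replaces any
  rule for the coproduct of an exponential. Exponentials are attached to linear operators rather
  than to elements, so that their identities reduce to commutation of operators. Convergence needs
  no separate treatment, because maps linear over \<complex>[[\<hbar>]] commute with \<hbar>-adic
  sums.\<close>

section \<open>Linear maps on tensor products over the complex numbers\<close>

lemma clinearI:
  "(\<And>x y. f (x + y) = f x + f y) \<Longrightarrow> (\<And>c x. f (c *\<^sub>C x) = c *\<^sub>C f x) \<Longrightarrow> clinear f"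
  by (simp add: clinear_def)

lemma clinear_plus: "clinear f \<Longrightarrow> f (x + y) = f x + f y"
  and clinear_scaleC: "clinear f \<Longrightarrow> f (c *\<^sub>C x) = c *\<^sub>C f x"
  by (simp_all add: clinear_def)

lemma clinear_zero: "clinear f \<Longrightarrow> f 0 = 0"
  using clinear_plus[of f 0 0] by simp

lemma clinear_minus: "clinear f \<Longrightarrow> f (x - y) = f x - f y"
  using clinear_plus[of f "x - y" y] by (simp add: algebra_simps)

lemma clinear_sum: "clinear f \<Longrightarrow> f (\<Sum>i\<in>I. g i) = (\<Sum>i\<in>I. f (g i))"
  by (induction I rule: infinite_finite_induct) (simp_all add: clinear_zero clinear_plus)

lemma cbilinear_left: "cbilinear f \<Longrightarrow> clinear (\<lambda>x. f x y)"
  and cbilinear_right: "cbilinear f \<Longrightarrow> clinear (f x)"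
  by (simp_all add: cbilinear_def)

lemma cbilinearI: "(\<And>y. clinear (\<lambda>x. f x y)) \<Longrightarrow> (\<And>x. clinear (f x)) \<Longrightarrow> cbilinear f"
  by (simp add: cbilinear_def)

lemma cbilinear_tens: "cbilinear (\<otimes>)"
proof (intro cbilinearI clinearI)
  fix a a' :: 'a and b b' :: 'b and c
  show "(a + a') \<otimes> b = a \<otimes> b + a' \<otimes> b"
    by transfer (unfold tensor_null_def diff_diff_eq[symmetric], rule complex_vector.span_base, blast)
  show "a \<otimes> (b + b') = a \<otimes> b + a \<otimes> b'"
    by transfer (unfold tensor_null_def diff_diff_eq[symmetric], rule complex_vector.span_base, blast)
  show "(c *\<^sub>C a) \<otimes> b = c *\<^sub>C (a \<otimes> b)"
    by transfer (unfold tensor_null_def, rule complex_vector.span_base, blast)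
  show "a \<otimes> (c *\<^sub>C b) = c *\<^sub>C (a \<otimes> b)"
    by transfer (unfold tensor_null_def, rule complex_vector.span_base, blast)
qed

lemmas clinear_tens_left = cbilinear_left[OF cbilinear_tens]
  and clinear_tens_right = cbilinear_right[OF cbilinear_tens]

lemmas tens_add_right = clinear_plus[OF clinear_tens_right]
  and tens_scaleC_left = clinear_scaleC[OF clinear_tens_left]
  and tens_diff_left = clinear_minus[OF clinear_tens_left]
  and tens_diff_right = clinear_minus[OF clinear_tens_right]
  and tens_zero_left = clinear_zero[OF clinear_tens_left]
  and tens_zero_right = clinear_zero[OF clinear_tens_right]

lemma poly_mapping_free_sum:
  "p = (\<Sum>k\<in>Poly_Mapping.keys p. Poly_Mapping.lookup p k *\<^sub>C free_pair (fst k) (snd k))"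
proof (rule poly_mapping_eqI)
  fix j
  have "Poly_Mapping.lookup (\<Sum>k\<in>Poly_Mapping.keys p. Poly_Mapping.lookup p k *\<^sub>C free_pair (fst k) (snd k)) j
     = (\<Sum>k\<in>Poly_Mapping.keys p. Poly_Mapping.lookup p k * (1 when k = j))"
    by (simp add: lookup_sum lookup_scaleC free_pair_def lookup_single scaleC_complex_def)
  also have "\<dots> = Poly_Mapping.lookup p j"
    by (cases "j \<in> Poly_Mapping.keys p") (simp_all add: when_def in_keys_iff if_distrib sum.delta cong: if_cong)
  finally show "Poly_Mapping.lookup p j = Poly_Mapping.lookup
    (\<Sum>k\<in>Poly_Mapping.keys p. Poly_Mapping.lookup p k *\<^sub>C free_pair (fst k) (snd k)) j" ..
qed

text \<open>A scalar is absorbed into the left factor of a decomposable tensor, so sums of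
  decomposable tensors exhaust the tensor product and no case for scalar multiples arises.\<close>

lemma tensor_induct [case_names zero add tens]:
  assumes "P 0" "\<And>x y. P x \<Longrightarrow> P y \<Longrightarrow> P (x + y)" "\<And>a b. P (a \<otimes> b)"
  shows "P (t :: ('a::complex_vector, 'b::complex_vector) tensor)"
proof -
  obtain p where t: "t = abs_tensor p" by (metis Quotient_abs_rep[OF Quotient_tensor])
  have abs_sum: "abs_tensor (\<Sum>k\<in>K. f k) = (\<Sum>k\<in>K. abs_tensor (f k))"
    for K and f :: "'a \<times> 'b \<Rightarrow> ('a \<times> 'b) \<Rightarrow>\<^sub>0 complex"
    by (induction K rule: infinite_finite_induct)
      (simp_all add: zero_tensor.abs_eq flip: plus_tensor.abs_eq)
  have "t = (\<Sum>k\<in>Poly_Mapping.keys p. Poly_Mapping.lookup p k *\<^sub>C (fst k \<otimes> snd k))"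
    unfolding t by (subst poly_mapping_free_sum)
      (simp add: abs_sum scaleC_tensor.abs_eq tens.abs_eq)
  moreover have "P (\<Sum>k\<in>K. Poly_Mapping.lookup p k *\<^sub>C (fst k \<otimes> snd k))" for K
    by (induction K rule: infinite_finite_induct)
      (auto intro: assms simp flip: tens_scaleC_left)
  ultimately show ?thesis by simp
qed

lemma clinear_tensor_eq:
  assumes "clinear f" "clinear g" "\<And>a b. f (a \<otimes> b) = g (a \<otimes> b)"
  shows "f t = g t"
  by (induction t rule: tensor_induct) (simp_all add: assms clinear_zero clinear_plus)

text \<open>\<open>tlift\<close> evaluates a finite sum over one fixed representative, hence is
  linear in the function even when that function is not bilinear. This gives linearity of nested
  lifts in their parameters.\<close>

lemma tlift_fun_plus: "tlift (\<lambda>a b. f a b + g a b) t = tlift f t + tlift g t"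
  by (simp add: tlift_def free_lift_def scaleC_add_right sum.distrib)

lemma tlift_fun_scaleC: "tlift (\<lambda>a b. c *\<^sub>C f a b) t = c *\<^sub>C tlift f t"
  by (simp add: tlift_def free_lift_def complex_vector.scale_sum_right scaleC_scaleC mult.commute)

lemma clinear_comp: "clinear f \<Longrightarrow> clinear g \<Longrightarrow> clinear (\<lambda>x. f (g x))"
  by (simp add: clinear_def)

lemma clinear_tlift_fun:
  assumes "\<And>a b. clinear (\<lambda>s. f s a b)"
  shows "clinear (\<lambda>s. tlift (f s) t)"
proof (rule clinearI)
  fix x y c
  have "f (x + y) = (\<lambda>a b. f x a b + f y a b)" "f (c *\<^sub>C x) = (\<lambda>a b. c *\<^sub>C f x a b)"
    by (intro ext clinear_plus[OF assms] clinear_scaleC[OF assms])+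
  then show "tlift (f (x + y)) t = tlift (f x) t + tlift (f y) t"
    "tlift (f (c *\<^sub>C x)) t = c *\<^sub>C tlift (f x) t"
    by (simp_all add: tlift_fun_plus tlift_fun_scaleC)
qed

lemma clinear_id: "clinear (\<lambda>x. x)" "clinear id"
  by (simp_all add: clinear_def)

lemma clinear_tmap: "clinear f \<Longrightarrow> clinear g \<Longrightarrow> clinear (tmap f g)"
  and tmap_tens: "clinear f \<Longrightarrow> clinear g \<Longrightarrow> tmap f g (a \<otimes> b) = f a \<otimes> g b"
  unfolding tmap_def
  by (rule clinear_tlift tlift_tens; intro cbilinearI clinear_comp[OF clinear_tens_left]
      clinear_comp[OF clinear_tens_right]; assumption)+

lemma tassoc_aux: "cbilinear (\<lambda>t c. tlift (\<lambda>a b. a \<otimes> (b \<otimes> c)) t)"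
  by (intro cbilinearI clinear_tlift clinear_tlift_fun clinear_tens_left clinear_tens_right
      clinear_comp[OF clinear_tens_right])

lemma clinear_tassoc: "clinear tassoc"
  unfolding tassoc_def by (rule clinear_tlift[OF tassoc_aux])

lemma tassoc_tens: "tassoc ((a \<otimes> b) \<otimes> c) = a \<otimes> (b \<otimes> c)"
  unfolding tassoc_def
  by (subst tlift_tens[OF tassoc_aux], rule tlift_tens)
    (intro cbilinearI clinear_tens_left clinear_tens_right
      clinear_comp[OF clinear_tens_right clinear_tens_left])

lemma tinterchange_aux1: "cbilinear (\<lambda>c d. (a \<otimes> c) \<otimes> (b \<otimes> d))"
  and tinterchange_aux2: "cbilinear (\<lambda>a b. tlift (\<lambda>c d. (a \<otimes> c) \<otimes> (b \<otimes> d)) t)"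
  and tinterchange_aux3: "cbilinear (\<lambda>s t. tlift (\<lambda>a b. tlift (\<lambda>c d. (a \<otimes> c) \<otimes> (b \<otimes> d)) t) s)"
  by (intro cbilinearI clinear_tlift clinear_tlift_fun clinear_tens_left clinear_tens_right
      clinear_comp[OF clinear_tens_right clinear_tens_left]
      clinear_comp[OF clinear_tens_left clinear_tens_left]
      clinear_comp[OF clinear_tens_right clinear_tens_right]
      clinear_comp[OF clinear_tens_left clinear_tens_right])+

lemma clinear_tinterchange: "clinear tinterchange"
  unfolding tinterchange_def by (rule clinear_tlift[OF tinterchange_aux3])

lemma tinterchange_tens:
  "tinterchange ((a \<otimes> b) \<otimes> (c \<otimes> d)) = (a \<otimes> c) \<otimes> (b \<otimes> d)"
  by (simp add: tinterchange_def tlift_tens tinterchange_aux1 tinterchange_aux2 tinterchange_aux3)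

section \<open>Linear maps between topologically free modules\<close>

text \<open>Both sides run over the triples of natural numbers with sum N; this is associativity of
  the Cauchy product in index form.\<close>

lemma sum_triangle_assoc:
  fixes g :: "nat \<Rightarrow> nat \<Rightarrow> nat \<Rightarrow> 'a::comm_monoid_add"
  shows "(\<Sum>n\<le>N. \<Sum>k\<le>n. g k (n - k) (N - n)) = (\<Sum>k\<le>N. \<Sum>j\<le>N - k. g k j (N - k - j))"
  unfolding sum.Sigma[OF finite_atMost ballI[OF finite_atMost]]
  by (rule sum.reindex_bij_witness[where i = "\<lambda>(k, j). (k + j, k)" and j = "\<lambda>(n, k). (k, n - k)"])
    auto

lemma sum_triangle_swap:
  fixes g :: "nat \<Rightarrow> nat \<Rightarrow> 'a::comm_monoid_add"
  shows "(\<Sum>n\<le>N. \<Sum>k\<le>N - n. g n k) = (\<Sum>k\<le>N. \<Sum>n\<le>N - k. g n k)"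
  unfolding sum.Sigma[OF finite_atMost ballI[OF finite_atMost]]
  by (rule sum.reindex_bij_witness[where i = "\<lambda>(k, j). (j, k)" and j = "\<lambda>(k, j). (j, k)"]) auto

lemma hseries_nth: "fps_nth (hseries s) N = (\<Sum>n\<le>N. fps_nth (s n) (N - n))"
  by (simp add: hseries_def)

lemma hcauchy_nth: "fps_nth (hcauchy f x y) N = (\<Sum>n\<le>N. f (fps_nth x n) (fps_nth y (N - n)))"
  by (simp add: hcauchy_def)

lemma hscale_nth: "fps_nth (hscale c x) N = (\<Sum>n\<le>N. fps_nth c n *\<^sub>C fps_nth x (N - n))"
  by (simp add: hscale_def hcauchy_nth)

lemma hmap_nth: "fps_nth (hmap f x) N = f (fps_nth x N)"
  by (simp add: hmap_def)

lemma scaleC_fps_nth: "fps_nth (c *\<^sub>C x) N = c *\<^sub>C fps_nth x N"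
  by (simp add: scaleC_fps_def)

lemma hscale_add_right: "hscale c (x + y) = hscale c x + hscale c y"
  by (simp add: fps_eq_iff hscale_nth scaleC_add_right sum.distrib)

lemma hscale_add_left: "hscale (c + d) x = hscale c x + hscale d x"
  by (simp add: fps_eq_iff hscale_nth scaleC_add_left sum.distrib)

lemma fps_mult_nth_atMost: "fps_nth (c * d) N = (\<Sum>n\<le>N. fps_nth c n * fps_nth d (N - n))"
  by (simp add: fps_mult_nth atMost_atLeast0)

lemma hscale_hscale: "hscale c (hscale d x) = hscale (c * d) x"
proof (rule fps_ext)
  fix N
  show "fps_nth (hscale c (hscale d x)) N = fps_nth (hscale (c * d) x) N"
    using sum_triangle_assoc[of "\<lambda>i j k. fps_nth c i *\<^sub>C fps_nth d j *\<^sub>C fps_nth x k" N]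
    by (simp add: hscale_nth fps_mult_nth_atMost complex_vector.scale_sum_right
        complex_vector.scale_sum_left scaleC_scaleC)
qed

lemma hscale_fps_const: "hscale (fps_const c) x = c *\<^sub>C x"
proof (rule fps_ext)
  fix N
  have "fps_nth (hscale (fps_const c) x) N = (\<Sum>n\<le>N. if n = 0 then c *\<^sub>C fps_nth x N else 0)"
    unfolding hscale_nth by (rule sum.cong) auto
  then show "fps_nth (hscale (fps_const c) x) N = fps_nth (c *\<^sub>C x) N"
    by (simp add: scaleC_fps_nth)
qed

lemma hscale_one: "hscale 1 x = x"
  using hscale_fps_const[of 1 x] by (simp add: scaleC_one)

lemma hscale_X_power_nth:
  "fps_nth (hscale (fps_X ^ n) x) N = (if N < n then 0 else fps_nth x (N - n))"
proof -
  have "fps_nth (hscale (fps_X ^ n) x) N = (\<Sum>k\<le>N. if k = n then fps_nth x (N - n) else 0)"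
    unfolding hscale_nth by (rule sum.cong) (auto simp: fps_X_power_nth scaleC_one)
  then show ?thesis by auto
qed

named_theorems hlin

lemma hlinearI:
  "(\<And>x y. T (x + y) = T x + T y) \<Longrightarrow> (\<And>c x. T (hscale c x) = hscale c (T x)) \<Longrightarrow> hlinear T"
  by (simp add: hlinear_def)

lemma hlinear_plus: "hlinear T \<Longrightarrow> T (x + y) = T x + T y"
  and hlinear_hscale: "hlinear T \<Longrightarrow> T (hscale c x) = hscale c (T x)"
  by (simp_all add: hlinear_def)

lemma hlinear_scaleC: "hlinear T \<Longrightarrow> T (c *\<^sub>C x) = c *\<^sub>C T x"
  by (simp add: hlinear_hscale flip: hscale_fps_const)

lemma hlinear_zero: "hlinear T \<Longrightarrow> T 0 = 0"
  using hlinear_plus[of T 0 0] by simp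

lemma hlinear_minus: "hlinear T \<Longrightarrow> T (x - y) = T x - T y"
  using hlinear_plus[of T "x - y" y] by (simp add: algebra_simps)

lemma hlinear_sum: "hlinear T \<Longrightarrow> T (\<Sum>i\<in>I. g i) = (\<Sum>i\<in>I. T (g i))"
  by (induction I rule: infinite_finite_induct) (simp_all add: hlinear_zero hlinear_plus)

lemma hlinear_id [hlin]: "hlinear (\<lambda>x. x)" "hlinear id"
  by (simp_all add: hlinear_def)

lemma hlinear_comp: "hlinear f \<Longrightarrow> hlinear g \<Longrightarrow> hlinear (\<lambda>x. f (g x))"
  by (simp add: hlinear_def)

lemma hscale_zero: "hscale c 0 = 0"
  by (simp add: fps_eq_iff hscale_nth)

lemma hlinear_const_zero [hlin]: "hlinear (\<lambda>x. 0)"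
  by (simp add: hlinear_def hscale_zero)

lemma hlinear_hscale_const: "hlinear (hscale c)"
  by (rule hlinearI) (simp_all add: hscale_add_right hscale_hscale mult.commute)

lemma hlinear_fun_plus [hlin]: "hlinear f \<Longrightarrow> hlinear g \<Longrightarrow> hlinear (\<lambda>x. f x + g x)"
  by (rule hlinearI) (simp_all add: hlinear_plus hlinear_hscale hscale_add_right)

lemma hlinear_fun_minus [hlin]: "hlinear f \<Longrightarrow> hlinear g \<Longrightarrow> hlinear (\<lambda>x. f x - g x)"
  by (rule hlinearI)
    (simp_all add: hlinear_plus hlinear_hscale hlinear_minus[OF hlinear_hscale_const])

lemma hlinear_fun_sum [hlin]: "(\<And>i. hlinear (f i)) \<Longrightarrow> hlinear (\<lambda>x. \<Sum>i\<in>I. f i x)"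
  by (rule hlinearI)
    (simp_all add: hlinear_plus hlinear_hscale sum.distrib hlinear_sum[OF hlinear_hscale_const])

lemma hlinear_fun_hscale [hlin]: "hlinear f \<Longrightarrow> hlinear (\<lambda>x. hscale c (f x))"
  by (rule hlinear_comp[OF hlinear_hscale_const])

lemma hlinear_fun_scaleC [hlin]: "hlinear f \<Longrightarrow> hlinear (\<lambda>x. c *\<^sub>C f x)"
  using hlinear_fun_hscale[of f "fps_const c"] by (simp add: hscale_fps_const)

lemma hlinear_hmap: "clinear f \<Longrightarrow> hlinear (hmap f)"
  by (rule hlinearI)
    (simp_all add: fps_eq_iff hmap_nth hscale_nth clinear_plus clinear_sum clinear_scaleC)

lemma hbilinearI:
  "(\<And>y. hlinear (\<lambda>x. m x y)) \<Longrightarrow> (\<And>x. hlinear (m x)) \<Longrightarrow> hbilinear m"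
  by (simp add: hbilinear_def)

lemma hbilinear_left:
  assumes "hbilinear m" "hlinear f"
  shows "hlinear (\<lambda>x. m (f x) y)"
  using assms hlinear_comp[of "\<lambda>x. m x y" f] by (simp add: hbilinear_def)

lemma hbilinear_right:
  assumes "hbilinear m" "hlinear f"
  shows "hlinear (\<lambda>x. m y (f x))"
  using assms hlinear_comp[of "m y" f] by (simp add: hbilinear_def)

lemma hbilinear_hcauchy:
  assumes "cbilinear f"
  shows "hbilinear (hcauchy f)"
proof (intro hbilinearI hlinearI)
  note l = clinear_plus[OF cbilinear_left[OF assms]] clinear_plus[OF cbilinear_right[OF assms]]
    clinear_sum[OF cbilinear_left[OF assms]] clinear_sum[OF cbilinear_right[OF assms]]
    clinear_scaleC[OF cbilinear_left[OF assms]] clinear_scaleC[OF cbilinear_right[OF assms]]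
  fix x x' :: "'a fps" and y y' :: "'b fps" and c
  show "hcauchy f (x + x') y = hcauchy f x y + hcauchy f x' y"
    and "hcauchy f x (y + y') = hcauchy f x y + hcauchy f x y'"
    by (simp_all add: fps_eq_iff hcauchy_nth l sum.distrib)
  show "hcauchy f (hscale c x) y = hscale c (hcauchy f x y)"
  proof (rule fps_ext)
    fix N
    show "fps_nth (hcauchy f (hscale c x) y) N = fps_nth (hscale c (hcauchy f x y)) N"
      using sum_triangle_assoc[of "\<lambda>i j k. fps_nth c i *\<^sub>C f (fps_nth x j) (fps_nth y k)" N]
      by (simp add: hcauchy_nth hscale_nth l complex_vector.scale_sum_right)
  qed
  show "hcauchy f x (hscale c y) = hscale c (hcauchy f x y)"
  proof (rule fps_ext)
    fix N
    show "fps_nth (hcauchy f x (hscale c y)) N = fps_nth (hscale c (hcauchy f x y)) N"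
      using sum_triangle_swap[of "\<lambda>i j. fps_nth c j *\<^sub>C f (fps_nth x i) (fps_nth y (N - i - j))" N]
      by (simp add: hcauchy_nth hscale_nth l complex_vector.scale_sum_right add.commute)
  qed
qed

lemma hcauchy_fps_const:
  assumes "cbilinear f"
  shows "hcauchy f (fps_const a) (fps_const b) = fps_const (f a b)"
proof (rule fps_ext)
  fix N
  have "fps_nth (hcauchy f (fps_const a) (fps_const b)) N
      = (\<Sum>n\<le>N. if n = 0 then (if N = 0 then f a b else 0) else 0)"
    unfolding hcauchy_nth
    by (rule sum.cong) (auto simp: clinear_zero[OF cbilinear_left[OF assms]]
        clinear_zero[OF cbilinear_right[OF assms]])
  then show "fps_nth (hcauchy f (fps_const a) (fps_const b)) N = fps_nth (fps_const (f a b)) N"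
    by simp
qed

lemma hbilinear_htens: "hbilinear htens"
  unfolding htens_def by (rule hbilinear_hcauchy[OF cbilinear_tens])

lemmas hlinear_htens_left [hlin] = hbilinear_left[OF hbilinear_htens]
  and hlinear_htens_right [hlin] = hbilinear_right[OF hbilinear_htens]

lemma fps_const_tens: "fps_const (a \<otimes> b) = fps_const a \<otimes>\<^sub>h fps_const b"
  unfolding htens_def by (rule hcauchy_fps_const[OF cbilinear_tens, symmetric])

lemma hmap_fps_const: "clinear f \<Longrightarrow> hmap f (fps_const a) = fps_const (f a)"
  by (simp add: fps_eq_iff hmap_nth clinear_zero)

text \<open>Linear maps are \<open>\<hbar>\<close>-adically continuous, because they commute with multiplication by
  powers of \<open>\<hbar>\<close>.\<close>

lemma hseries_split:
  "hseries s = (\<Sum>n\<le>N. hscale (fps_X ^ n) (s n)) + hscale (fps_X ^ Suc N) (hseries (\<lambda>n. s (n + Suc N)))"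
proof (rule fps_ext)
  fix M
  have *: "fps_nth (\<Sum>n\<le>N. hscale (fps_X ^ n) (s n)) M
      = (\<Sum>n\<in>{..N} \<inter> {..M}. fps_nth (s n) (M - n))"
    unfolding fps_sum_nth hscale_X_power_nth by (rule sum.mono_neutral_cong_right) auto
  show "fps_nth (hseries s) M = fps_nth ((\<Sum>n\<le>N. hscale (fps_X ^ n) (s n)) +
    hscale (fps_X ^ Suc N) (hseries (\<lambda>n. s (n + Suc N)))) M"
  proof (cases "M \<le> N")
    case True
    then have "{..N} \<inter> {..M} = {..M}" by auto
    with True show ?thesis by (simp only: fps_add_nth *) (simp add: hseries_nth hscale_X_power_nth del: power_Suc)
  next
    case False
    then have "{..N} \<inter> {..M} = {..N}" by auto
    moreover have "(\<Sum>n\<le>M. fps_nth (s n) (M - n)) = (\<Sum>n\<le>N. fps_nth (s n) (M - n))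
      + (\<Sum>n\<in>{Suc N..M}. fps_nth (s n) (M - n))"
      using False by (subst sum.union_disjoint[symmetric]) (auto intro!: sum.cong)
    moreover have "(\<Sum>n\<in>{Suc N..M}. fps_nth (s n) (M - n))
      = (\<Sum>n\<le>M - Suc N. fps_nth (s (n + Suc N)) (M - Suc N - n))"
      using False
      by (intro sum.reindex_bij_witness[where i = "\<lambda>n. n + Suc N" and j = "\<lambda>n. n - Suc N"])
        (auto simp: algebra_simps)
    ultimately show ?thesis using False
      by (simp only: fps_add_nth *) (simp add: hseries_nth hscale_X_power_nth del: power_Suc)
  qed
qed

lemma hlinear_hseries:
  assumes T: "hlinear T"
  shows "T (hseries s) = hseries (\<lambda>n. T (s n))"
proof (rule fps_ext)
  fix N
  show "fps_nth (T (hseries s)) N = fps_nth (hseries (\<lambda>n. T (s n))) N"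
    \<comment> \<open>After the first N + 1 terms the remainder is a multiple of \<hbar>^(N+1), also
      after T is applied, and so is invisible in coefficient N.\<close>
    by (subst (1 2) hseries_split[of _ N], simp only: hlinear_plus[OF T] hlinear_sum[OF T]
        hlinear_hscale[OF T] fps_add_nth) (simp add: hscale_X_power_nth del: power_Suc)
qed

lemma hseries_fps_const: "hseries (\<lambda>n. fps_const (fps_nth x n)) = x"
proof (rule fps_ext)
  fix N
  have "fps_nth (hseries (\<lambda>n. fps_const (fps_nth x n))) N
    = (\<Sum>n\<le>N. if n = N then fps_nth x N else 0)"
    unfolding hseries_nth by (rule sum.cong) auto
  then show "fps_nth (hseries (\<lambda>n. fps_const (fps_nth x n))) N = fps_nth x N" by simp
qed

text \<open>Every series is the \<hbar>-adic sum of its constant coefficients, so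
  \<open>hlinear_hseries\<close> leaves only constants to check. Most identities between maps below
  are proved in this way, one argument at a time.\<close>

lemma hlinear_eq_const:
  assumes "hlinear S" "hlinear T" "\<And>a. S (fps_const a) = T (fps_const a)"
  shows "S x = T x"
  using hlinear_hseries[OF assms(1), of "\<lambda>n. fps_const (fps_nth x n)"]
    hlinear_hseries[OF assms(2), of "\<lambda>n. fps_const (fps_nth x n)"]
  by (simp add: assms(3) hseries_fps_const)

lemma hmap_id: "hmap id x = x" "hmap (\<lambda>x. x) x = x"
  by (simp_all add: fps_eq_iff hmap_nth)

lemma clinear_fps_const: "clinear fps_const"
  by (rule clinearI) (simp_all add: fps_eq_iff scaleC_fps_nth)

lemma hlinear_imp_clinear: "hlinear T \<Longrightarrow> clinear T"
  by (rule clinearI) (simp_all add: hlinear_plus hlinear_scaleC)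

text \<open>The last premise speaks of series x and y instead of constants, so that the rules for
  \<open>htens\<close> of arbitrary series can be used to discharge it.\<close>

lemma hlinear_eq_tens:
  assumes "hlinear S" "hlinear T" "\<And>x y. S (x \<otimes>\<^sub>h y) = T (x \<otimes>\<^sub>h y)"
  shows "S z = T z"
proof (rule hlinear_eq_const[OF assms(1,2)])
  fix t :: "('a, 'b) tensor"
  show "S (fps_const t) = T (fps_const t)"
    by (rule clinear_tensor_eq[OF clinear_comp[OF hlinear_imp_clinear[OF assms(1)] clinear_fps_const]
          clinear_comp[OF hlinear_imp_clinear[OF assms(2)] clinear_fps_const]])
      (simp add: fps_const_tens assms(3))
qed

lemma hbilinear_eq_const:
  assumes S: "hbilinear S" and T: "hbilinear T"
    and eq: "\<And>a b. S (fps_const a) (fps_const b) = T (fps_const a) (fps_const b)"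
  shows "S x y = T x y"
proof -
  have "S (fps_const a) y = T (fps_const a) y" for a
    by (rule hlinear_eq_const[OF hbilinear_right[OF S hlinear_id(1)] hbilinear_right[OF T hlinear_id(1)] eq])
  then show ?thesis
    by (rule hlinear_eq_const[OF hbilinear_left[OF S hlinear_id(1)] hbilinear_left[OF T hlinear_id(1)]])
qed

lemma hbilinear_eq_tens:
  assumes S: "hbilinear S" and T: "hbilinear T"
    and eq: "\<And>x y z w. S (x \<otimes>\<^sub>h y) (z \<otimes>\<^sub>h w) = T (x \<otimes>\<^sub>h y) (z \<otimes>\<^sub>h w)"
  shows "S X Y = T X Y"
proof -
  have "S (x \<otimes>\<^sub>h y) Y = T (x \<otimes>\<^sub>h y) Y" for x y
    by (rule hlinear_eq_tens[OF hbilinear_right[OF S hlinear_id(1)] hbilinear_right[OF T hlinear_id(1)] eq])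
  then show ?thesis
    by (rule hlinear_eq_tens[OF hbilinear_left[OF S hlinear_id(1)] hbilinear_left[OF T hlinear_id(1)]])
qed

lemma hcauchy_assoc:
  assumes f: "cbilinear f" and assoc: "\<And>a b c. f (f a b) c = f a (f b c)"
  shows "hcauchy f (hcauchy f x y) z = hcauchy f x (hcauchy f y z)"
proof -
  note l = hlinear_id(1) hbilinear_left[OF hbilinear_hcauchy[OF f]] hbilinear_right[OF hbilinear_hcauchy[OF f]]
  have 1: "hcauchy f (hcauchy f (fps_const a) (fps_const b)) z
      = hcauchy f (fps_const a) (hcauchy f (fps_const b) z)" for a b
    by (rule hlinear_eq_const[where x = z], (intro l)+) (simp add: hcauchy_fps_const[OF f] assoc)
  show ?thesis
    by (rule hbilinear_eq_const[where x = x and y = y]) (intro hbilinearI l, intro hbilinearI l, rule 1)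
qed

text \<open>This is the extension of a complex linear map with values in series to a map linear over
  \<complex>[[\<hbar>]]: apply it to each coefficient and sum up again.\<close>

lemma hlinear_hseries_map:
  assumes "clinear \<phi>"
  shows "hlinear (\<lambda>X. hseries (\<lambda>n. \<phi> (fps_nth X n)))"
proof (rule hlinearI)
  fix X Y :: "'a fps" and c
  show "hseries (\<lambda>n. \<phi> (fps_nth (X + Y) n))
    = hseries (\<lambda>n. \<phi> (fps_nth X n)) + hseries (\<lambda>n. \<phi> (fps_nth Y n))"
    by (simp add: fps_eq_iff hseries_nth clinear_plus[OF assms] sum.distrib)
  show "hseries (\<lambda>n. \<phi> (fps_nth (hscale c X) n)) = hscale c (hseries (\<lambda>n. \<phi> (fps_nth X n)))"
  proof (rule fps_ext)
    fix N
    show "fps_nth (hseries (\<lambda>n. \<phi> (fps_nth (hscale c X) n))) N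
        = fps_nth (hscale c (hseries (\<lambda>n. \<phi> (fps_nth X n)))) N"
      using sum_triangle_assoc[of "\<lambda>i j k. fps_nth c i *\<^sub>C fps_nth (\<phi> (fps_nth X j)) k" N]
      by (simp add: hseries_nth hscale_nth clinear_sum[OF assms] clinear_scaleC[OF assms]
          scaleC_fps_nth fps_sum_nth complex_vector.scale_sum_right)
  qed
qed

lemma hlinear_hlift: "cbilinear b \<Longrightarrow> hlinear (hlift b)"
  unfolding hlift_def[abs_def] by (rule hlinear_hseries_map[OF clinear_tlift])

lemma hseries_nth_zero:
  assumes "\<And>n. n \<noteq> 0 \<Longrightarrow> s n = 0"
  shows "hseries s = s 0"
proof (rule fps_ext)
  fix N
  have "fps_nth (hseries s) N = (\<Sum>n\<le>N. if n = 0 then fps_nth (s 0) N else 0)"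
    unfolding hseries_nth by (rule sum.cong) (auto simp: assms)
  then show "fps_nth (hseries s) N = fps_nth (s 0) N" by simp
qed

lemma hlift_fps_const_tens:
  assumes "cbilinear b"
  shows "hlift b (fps_const (x \<otimes> y)) = b x y"
  unfolding hlift_def
  by (subst hseries_nth_zero)
    (simp_all add: clinear_zero[OF clinear_tlift[OF assms]] tlift_tens[OF assms])

lemma hbilinear_imp_cbilinear:
  assumes "hbilinear B"
  shows "cbilinear (\<lambda>a b. B (fps_const a) (fps_const b))"
  using hbilinear_left[OF assms hlinear_id(1)] hbilinear_right[OF assms hlinear_id(1)]
  by (intro cbilinearI clinear_comp[OF _ clinear_fps_const, of "B _"]
      clinear_comp[OF _ clinear_fps_const, of "\<lambda>x. B x _"] hlinear_imp_clinear)

lemma hlinear_hlift_hbilinear: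
  "hbilinear B \<Longrightarrow> hlinear (hlift (\<lambda>a b. B (fps_const a) (fps_const b)))"
  by (rule hlinear_hlift[OF hbilinear_imp_cbilinear])

text \<open>\<open>hlift\<close> sees B only on constants. Both sides are linear over
  \<complex>[[\<hbar>]] in each argument, so agreement on constants propagates to series; every map
  out of a completed tensor product is evaluated through this rule.\<close>

lemma hlift_htens:
  assumes B: "hbilinear B"
  shows "hlift (\<lambda>a b. B (fps_const a) (fps_const b)) (x \<otimes>\<^sub>h y) = B x y"
proof -
  note hl = hlinear_comp[OF hlinear_hlift_hbilinear[OF B]]
  have "hlift (\<lambda>a b. B (fps_const a) (fps_const b)) (fps_const a \<otimes>\<^sub>h fps_const b)
      = B (fps_const a) (fps_const b)" for a b
    by (simp add: hlift_fps_const_tens[OF hbilinear_imp_cbilinear[OF B]] flip: fps_const_tens)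
  then have "hlift (\<lambda>a b. B (fps_const a) (fps_const b)) (fps_const a \<otimes>\<^sub>h y) = B (fps_const a) y" for a
    using hbilinear_right[OF B hlinear_id(1), of "fps_const a"]
    by (intro hlinear_eq_const[of "\<lambda>y. hlift _ (fps_const a \<otimes>\<^sub>h y)" "B (fps_const a)" y] hl hlin)
  then show ?thesis
    by (intro hlinear_eq_const[of "\<lambda>x. hlift _ (x \<otimes>\<^sub>h y)" "\<lambda>x. B x y" x] hl hlin
        hbilinear_left[OF B])
qed

lemma hlift_fun_plus:
  "hlift (\<lambda>a b. f a b + g a b) X = hlift f X + hlift g X"
  by (simp add: hlift_def fps_eq_iff hseries_nth tlift_fun_plus sum.distrib)

lemma tlift_hscale: "tlift (\<lambda>a b. hscale c (f a b)) t = hscale c (tlift f t)"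
  by (simp add: tlift_def free_lift_def hlinear_sum[OF hlinear_hscale_const]
      hlinear_scaleC[OF hlinear_hscale_const])

lemma hlift_fun_hscale:
  "hlift (\<lambda>a b. hscale c (f a b)) X = hscale c (hlift f X)"
  unfolding hlift_def tlift_hscale by (simp add: hlinear_hseries[OF hlinear_hscale_const])

lemma hlinear_hlift_fun:
  assumes "\<And>a b. hlinear (\<lambda>s. f s a b)"
  shows "hlinear (\<lambda>s. hlift (f s) X)"
proof (rule hlinearI)
  fix x y c
  have "f (x + y) = (\<lambda>a b. f x a b + f y a b)" "f (hscale c x) = (\<lambda>a b. hscale c (f x a b))"
    by (intro ext hlinear_plus[OF assms] hlinear_hscale[OF assms])+
  then show "hlift (f (x + y)) X = hlift (f x) X + hlift (f y) X"
    "hlift (f (hscale c x)) X = hscale c (hlift (f x) X)"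
    by (simp_all add: hlift_fun_plus hlift_fun_hscale)
qed

lemma htensor_map_aux:
  "hlinear f \<Longrightarrow> hlinear g \<Longrightarrow> hbilinear (\<lambda>x y. f x \<otimes>\<^sub>h g y)"
  by (intro hbilinearI hlinear_htens_left hlinear_htens_right)

lemma hlinear_htensor_map: "hlinear f \<Longrightarrow> hlinear g \<Longrightarrow> hlinear (f \<boxtimes> g)"
  unfolding htensor_map_def[abs_def] by (rule hlinear_hlift_hbilinear[OF htensor_map_aux])

lemma htensor_map_htens: "hlinear f \<Longrightarrow> hlinear g \<Longrightarrow> (f \<boxtimes> g) (x \<otimes>\<^sub>h y) = f x \<otimes>\<^sub>h g y"
  unfolding htensor_map_def by (rule hlift_htens[OF htensor_map_aux])

lemma htensor_mult_aux1:
  assumes "hbilinear m" "hbilinear m'"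
  shows "hbilinear (\<lambda>z w. m a z \<otimes>\<^sub>h m' b w)"
  by (intro hbilinearI hlin hbilinear_right[OF assms(1)] hbilinear_right[OF assms(2)])

lemma htensor_mult_aux2:
  assumes "hbilinear m" "hbilinear m'"
  shows "hbilinear (\<lambda>x y. hlift (\<lambda>c d. m x (fps_const c) \<otimes>\<^sub>h m' y (fps_const d)) Y)"
  by (intro hbilinearI hlinear_hlift_fun hlin hbilinear_left[OF assms(1)] hbilinear_left[OF assms(2)])

lemma hbilinear_htensor_mult:
  assumes "hbilinear m" "hbilinear m'"
  shows "hbilinear (m \<boxtimes>\<^sub>m m')"
  unfolding htensor_mult_def[abs_def]
  using hlinear_hlift_hbilinear[OF htensor_mult_aux2[OF assms]]
    hlinear_hlift_hbilinear[OF htensor_mult_aux1[OF assms]]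
  by (intro hbilinearI hlinear_hlift_fun)

lemma htensor_mult_htens:
  assumes "hbilinear m" "hbilinear m'"
  shows "(m \<boxtimes>\<^sub>m m') (x \<otimes>\<^sub>h y) (z \<otimes>\<^sub>h w) = m x z \<otimes>\<^sub>h m' y w"
proof -
  have "(m \<boxtimes>\<^sub>m m') (x \<otimes>\<^sub>h y) (z \<otimes>\<^sub>h w)
      = hlift (\<lambda>c d. m x (fps_const c) \<otimes>\<^sub>h m' y (fps_const d)) (z \<otimes>\<^sub>h w)"
    unfolding htensor_mult_def by (rule hlift_htens[OF htensor_mult_aux2[OF assms]])
  also have "\<dots> = m x z \<otimes>\<^sub>h m' y w"
    by (rule hlift_htens[OF htensor_mult_aux1[OF assms]])
  finally show ?thesis .
qed

lemma htensor_mult_assoc: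
  assumes b: "hbilinear m" "hbilinear m'"
    and a: "\<And>x y z. m (m x y) z = m x (m y z)" "\<And>x y z. m' (m' x y) z = m' x (m' y z)"
  shows "(m \<boxtimes>\<^sub>m m') ((m \<boxtimes>\<^sub>m m') X Y) Z = (m \<boxtimes>\<^sub>m m') X ((m \<boxtimes>\<^sub>m m') Y Z)"
proof -
  note l = hlin hbilinear_left[OF hbilinear_htensor_mult[OF b]]
    hbilinear_right[OF hbilinear_htensor_mult[OF b]]
  have 1: "(m \<boxtimes>\<^sub>m m') ((m \<boxtimes>\<^sub>m m') (x \<otimes>\<^sub>h y) (x' \<otimes>\<^sub>h y')) Z
      = (m \<boxtimes>\<^sub>m m') (x \<otimes>\<^sub>h y) ((m \<boxtimes>\<^sub>m m') (x' \<otimes>\<^sub>h y') Z)" for x x' y y'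
    by (rule hlinear_eq_tens[where z = Z], (intro l)+) (simp add: htensor_mult_htens[OF b] a)
  show ?thesis
    by (rule hbilinear_eq_tens[where X = X and Y = Y]) (intro hbilinearI l, intro hbilinearI l, rule 1)
qed

lemma htensor_mult_one_left:
  assumes b: "hbilinear m" "hbilinear m'" and "\<And>x. m e x = x" "\<And>x. m' e' x = x"
  shows "(m \<boxtimes>\<^sub>m m') (e \<otimes>\<^sub>h e') X = X"
  by (rule hlinear_eq_tens[OF hbilinear_right[OF hbilinear_htensor_mult[OF b] hlinear_id(1)] hlinear_id(1)])
    (simp add: htensor_mult_htens[OF b] assms)

lemma htensor_mult_one_right:
  assumes b: "hbilinear m" "hbilinear m'" and "\<And>x. m x e = x" "\<And>x. m' x e' = x"
  shows "(m \<boxtimes>\<^sub>m m') X (e \<otimes>\<^sub>h e') = X"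
  by (rule hlinear_eq_tens[OF hbilinear_left[OF hbilinear_htensor_mult[OF b] hlinear_id(1)] hlinear_id(1)])
    (simp add: htensor_mult_htens[OF b] assms)

lemma hassoc_htens:
  fixes x :: "'a::complex_vector fps" and y :: "'b::complex_vector fps" and z :: "'c::complex_vector fps"
  shows "hassoc ((x \<otimes>\<^sub>h y) \<otimes>\<^sub>h z) = x \<otimes>\<^sub>h (y \<otimes>\<^sub>h z)"
proof -
  note [hlin] = hlinear_comp[OF hlinear_hmap[OF clinear_tassoc]]
  have 1: "hassoc ((fps_const a \<otimes>\<^sub>h fps_const b) \<otimes>\<^sub>h z) = fps_const a \<otimes>\<^sub>h (fps_const b \<otimes>\<^sub>h z)"
    for a :: 'a and b :: 'b
    by (rule hlinear_eq_const[where x = z], (intro hlin)+)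
      (simp add: hmap_fps_const clinear_tassoc tassoc_tens flip: fps_const_tens)
  show ?thesis
    by (rule hbilinear_eq_const[where x = x and y = y], (intro hbilinearI hlin)+, rule 1)
qed

lemmas hlinear_hassoc [hlin] = hlinear_comp[OF hlinear_hmap[OF clinear_tassoc]]
  and hlinear_hinterchange [hlin] = hlinear_comp[OF hlinear_hmap[OF clinear_tinterchange]]

lemma hinterchange_htens:
  fixes x :: "'a::complex_vector fps" and y :: "'b::complex_vector fps"
    and z :: "'c::complex_vector fps" and w :: "'d::complex_vector fps"
  shows "hmap tinterchange ((x \<otimes>\<^sub>h y) \<otimes>\<^sub>h (z \<otimes>\<^sub>h w)) = (x \<otimes>\<^sub>h z) \<otimes>\<^sub>h (y \<otimes>\<^sub>h w)"
proof -
  have 1: "hmap tinterchange ((fps_const a \<otimes>\<^sub>h fps_const b) \<otimes>\<^sub>h (z \<otimes>\<^sub>h w))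
      = (fps_const a \<otimes>\<^sub>h z) \<otimes>\<^sub>h (fps_const b \<otimes>\<^sub>h w)" for a :: 'a and b :: 'b
    by (rule hbilinear_eq_const[where x = z and y = w], (intro hbilinearI hlin)+)
      (simp add: hmap_fps_const clinear_tinterchange tinterchange_tens flip: fps_const_tens)
  show ?thesis
    by (rule hbilinear_eq_const[where x = x and y = y], (intro hbilinearI hlin)+, rule 1)
qed

section \<open>Exponentials of operators\<close>

definition hExp :: "('a::complex_vector fps \<Rightarrow> 'a fps) \<Rightarrow> 'a fps \<Rightarrow> 'a fps"
  where "hExp T z = hseries (\<lambda>n. (1 / fact n) *\<^sub>C (T ^^ n) z)"

text \<open>Exponentials in an algebra become exponentials of left multiplication operators. The
  factor \<hbar> in the exponent is supplied by \<open>hseries\<close>, which makes the series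
  converge for every operator.\<close>

lemma hexp_eq_hExp: "hexp m e x = hExp (m x) e"
  by (simp add: hexp_def hExp_def)

lemma hlinear_funpow: "hlinear (T :: 'a::complex_vector fps \<Rightarrow> 'a fps) \<Longrightarrow> hlinear (T ^^ n)"
  by (induction n) (auto simp: hlinear_def)

lemma hlinear_fun_hseries:
  assumes "\<And>n. hlinear (f n)"
  shows "hlinear (\<lambda>x. hseries (\<lambda>n. f n x))"
proof (rule hlinearI)
  fix x y c
  show "hseries (\<lambda>n. f n (x + y)) = hseries (\<lambda>n. f n x) + hseries (\<lambda>n. f n y)"
    by (simp add: hlinear_plus[OF assms] fps_eq_iff hseries_nth sum.distrib)
  show "hseries (\<lambda>n. f n (hscale c x)) = hscale c (hseries (\<lambda>n. f n x))"
    by (simp add: hlinear_hscale[OF assms] hlinear_hseries[OF hlinear_hscale_const])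
qed

lemma hlinear_hExp: "hlinear T \<Longrightarrow> hlinear (hExp T)"
  unfolding hExp_def[abs_def] by (intro hlinear_fun_hseries hlinear_fun_scaleC hlinear_funpow)

text \<open>The set C allows for operators that are intertwined only on a part of the space: it has
  to contain the starting point and be stable under S. It will be a centralizer in the applications
  that do not take the whole space.\<close>

lemma hExp_intertwine:
  assumes \<Phi>: "hlinear \<Phi>" and C: "\<And>z. z \<in> C \<Longrightarrow> S z \<in> C" "\<And>z. z \<in> C \<Longrightarrow> \<Phi> (S z) = T (\<Phi> z)"
    and z: "z \<in> C"
  shows "\<Phi> (hExp S z) = hExp T (\<Phi> z)"
proof -
  have "(S ^^ n) z \<in> C \<and> \<Phi> ((S ^^ n) z) = (T ^^ n) (\<Phi> z)" for n
    by (induction n) (auto simp: C z)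
  then show ?thesis
    by (simp add: hExp_def hlinear_hseries[OF \<Phi>] hlinear_scaleC[OF \<Phi>])
qed

lemma hExp_commute:
  "hlinear \<Phi> \<Longrightarrow> (\<And>z. \<Phi> (S z) = T (\<Phi> z)) \<Longrightarrow> \<Phi> (hExp S z) = hExp T (\<Phi> z)"
  by (rule hExp_intertwine[where C = UNIV]) auto

lemma hExp_fixed:
  assumes "hlinear T" "T z = 0"
  shows "hExp T z = z"
proof -
  have "(T ^^ n) z = 0" if "n \<noteq> 0" for n
    using that
  proof (induction n)
    case (Suc n)
    then show ?case by (cases "n = 0") (simp_all add: assms hlinear_zero)
  qed simp
  then have "hExp T z = (1 / fact 0) *\<^sub>C (T ^^ 0) z"
    unfolding hExp_def by (intro hseries_nth_zero) simp
  then show ?thesis by simp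
qed

lemma hseries_hseries:
  "hseries (\<lambda>n. hseries (a n)) = hseries (\<lambda>N. \<Sum>n\<le>N. a n (N - n))"
  by (rule fps_ext) (simp add: hseries_nth fps_sum_nth
      sum_triangle_assoc[where g = "\<lambda>k j r. fps_nth (a k j) r"])

text \<open>The binomial theorem for commuting operators, arranged through the divided powers S^n
  T^m / (n! m!): the N-th divided power of the sum is the sum of these over n + m = N.\<close>

lemma hExp_plus:
  assumes S: "hlinear S" and T: "hlinear T" and comm: "\<And>z. S (T z) = T (S z)"
  shows "hExp (\<lambda>z. S z + T z) z = hExp S (hExp T z)"
proof -
  define a where "a n m = (1 / (fact n * fact m)) *\<^sub>C (S ^^ n) ((T ^^ m) z)" for n m
  have SnT: "T ((S ^^ n) x) = (S ^^ n) (T x)" for n x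
    by (induction n) (simp_all add: comm[symmetric])
  have Sa: "S (a n m) = of_nat (Suc n) *\<^sub>C a (Suc n) m" for n m
    by (simp add: a_def hlinear_scaleC[OF S] scaleC_scaleC del: of_nat_Suc)
  have Ta: "T (a n m) = of_nat (Suc m) *\<^sub>C a n (Suc m)" for n m
    by (simp add: a_def hlinear_scaleC[OF T] SnT scaleC_scaleC del: of_nat_Suc)
  \<comment> \<open>Applying S or T raises one divided power. The term with index n on the right
    receives the coefficient n from S and N + 1 - n from T.\<close>
  have step: "(\<lambda>z. S z + T z) (\<Sum>n\<le>N. a n (N - n)) = of_nat (Suc N) *\<^sub>C (\<Sum>n\<le>Suc N. a n (Suc N - n))"
    for N
  proof -
    have "S (\<Sum>n\<le>N. a n (N - n)) = (\<Sum>n\<le>Suc N. of_nat n *\<^sub>C a n (Suc N - n))"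
      by (simp add: hlinear_sum[OF S] Sa sum.atMost_Suc_shift del: sum.atMost_Suc)
    moreover have "T (\<Sum>n\<le>N. a n (N - n)) = (\<Sum>n\<le>Suc N. of_nat (Suc N - n) *\<^sub>C a n (Suc N - n))"
      by (simp add: hlinear_sum[OF T] Ta Suc_diff_le del: of_nat_Suc of_nat_diff)
    moreover have "of_nat n *\<^sub>C x + of_nat (Suc N - n) *\<^sub>C x = of_nat (Suc N) *\<^sub>C x"
      if "n \<le> Suc N" for n and x :: "'a fps"
      using that by (simp flip: scaleC_add_left of_nat_add)
    ultimately show ?thesis
      by (simp add: complex_vector.scale_sum_right del: sum.atMost_Suc of_nat_Suc flip: sum.distrib)
  qed
  have pow: "((\<lambda>z. S z + T z) ^^ N) z = fact N *\<^sub>C (\<Sum>n\<le>N. a n (N - n))" for N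
  proof (induction N)
    case 0
    then show ?case by (simp add: a_def scaleC_one)
  next
    case (Suc N)
    then have "((\<lambda>z. S z + T z) ^^ Suc N) z = fact N *\<^sub>C (\<lambda>z. S z + T z) (\<Sum>n\<le>N. a n (N - n))"
      by (simp add: hlinear_scaleC[OF S] hlinear_scaleC[OF T] scaleC_add_right)
    then show ?case
      unfolding step by (simp add: scaleC_scaleC algebra_simps del: sum.atMost_Suc of_nat_Suc)
  qed
  have "hExp S (hExp T z) = hseries (\<lambda>n. hseries (a n))"
    unfolding hExp_def
    by (simp add: hlinear_hseries[OF hlinear_fun_scaleC[OF hlinear_funpow[OF S]]] a_def[abs_def]
        hlinear_scaleC[OF hlinear_funpow[OF S]] scaleC_scaleC)
  also have "\<dots> = hExp (\<lambda>z. S z + T z) z"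
    unfolding hseries_hseries hExp_def pow by (simp add: scaleC_scaleC scaleC_one)
  finally show ?thesis ..
qed

section \<open>Partial derivatives of meromorphic functions\<close>

text \<open>The derivative along the complex line through z in direction v. For v =
  \<open>axis i 1\<close> this is the expression under \<open>abs_mero\<close> in
  \<open>mero_partial\<close>.\<close>

definition dird :: "complex ^ 'n \<Rightarrow> (complex ^ 'n \<Rightarrow> complex) \<Rightarrow> complex ^ 'n \<Rightarrow> complex"
  where "dird v f z = deriv (\<lambda>t. f (z + t *s v)) 0"

lemma norm_vector_smult: "norm (t *s v) = norm t * norm (v :: complex ^ 'n)"
  by (simp add: norm_vec_def L2_set_def norm_mult power_mult_distrib real_sqrt_mult
      flip: sum_distrib_left)

lemma bounded_linear_smult: "bounded_linear (\<lambda>t. t *s (v :: complex ^ 'n))"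
  by (rule bounded_linear_intro[where K = "norm v"])
    (simp_all add: vec_eq_iff algebra_simps norm_vector_smult)

lemma has_derivative_line:
  "((\<lambda>t. z + t *s (v :: complex ^ 'n)) has_derivative (\<lambda>t. t *s v)) (at t)"
  by (auto intro!: derivative_eq_intros bounded_linear.has_derivative[OF bounded_linear_smult])

lemma holomorphic_vec_line_aux:
  assumes "(f has_derivative L) (at (z + t *s v))" "\<forall>c v. L (c *s v) = c * L v"
  shows "((\<lambda>t. f (z + t *s (v :: complex ^ 'n))) has_field_derivative L v) (at t)"
  using has_derivative_compose[OF has_derivative_line assms(1)] assms(2)
  by (simp add: has_field_derivative_def mult_commute_abs)

lemma holomorphic_vec_dird:
  assumes "holomorphic_vec f U" "z \<in> U"
  shows "(f has_derivative (\<lambda>v. dird v f z)) (at z)" "dird (c *s v) f z = c * dird v f z"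
proof -
  obtain L where L: "(f has_derivative L) (at z)" "\<forall>c v. L (c *s v) = c * L v"
    using assms unfolding holomorphic_vec_def by blast
  have "dird v f z = L v" for v
    unfolding dird_def
    by (rule DERIV_imp_deriv) (use holomorphic_vec_line_aux[of f L z 0 v] L in simp)
  with L show "(f has_derivative (\<lambda>v. dird v f z)) (at z)" "dird (c *s v) f z = c * dird v f z"
    by simp_all
qed

lemma holomorphic_vec_line:
  assumes "holomorphic_vec f U" "z + t *s v \<in> U"
  shows "((\<lambda>t. f (z + t *s v)) has_field_derivative dird v f (z + t *s v)) (at t)"
  using holomorphic_vec_line_aux[OF holomorphic_vec_dird(1)[OF assms]] holomorphic_vec_dird(2)[OF assms]
  by blast

text \<open>Cauchy's estimate on circles of radius R / 4 bounds the second derivative on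
  \<open>cball 0 (R / 2)\<close> by 2 * B / (R / 4)^2 = 32 * B / R^2, and Taylor's formula of order
  one turns this into the claim. The constant depends on the function only through B, which is the
  source of uniformity later on.\<close>

lemma difference_quotient_bound:
  assumes hol: "\<psi> holomorphic_on ball 0 R" and B: "\<And>t. t \<in> ball 0 R \<Longrightarrow> norm (\<psi> t) \<le> B"
    and s: "s \<noteq> 0" "norm s \<le> R / 2"
  shows "norm ((\<psi> s - \<psi> 0) / s - deriv \<psi> 0) \<le> 32 * B / R\<^sup>2 * norm s"
proof -
  have R: "R > 0" using s by (smt (verit) norm_ge_zero zero_less_norm_iff half_gt_zero_iff)
  let ?f = "\<lambda>i. (deriv ^^ i) \<psi>"
  have "norm (?f 0 s - (\<Sum>i\<le>1. ?f i 0 * (s - 0) ^ i / fact i))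
      \<le> 32 * B / R\<^sup>2 * norm (s - 0) ^ Suc 1 / fact 1"
  proof (rule complex_Taylor[where S = "cball 0 (R / 2)"])
    show "(?f i has_field_derivative ?f (Suc i) x) (at x within cball 0 (R / 2))"
      if "x \<in> cball 0 (R / 2)" for i x
    proof -
      have "?f i holomorphic_on ball 0 R"
        by (rule holomorphic_higher_deriv[OF hol]) simp
      then have "(?f i has_field_derivative deriv (?f i) x) (at x)"
        using that R by (intro holomorphic_derivI[of _ "ball 0 R"]) auto
      then show ?thesis by (simp add: has_field_derivative_at_within)
    qed
    show "norm (?f (Suc 1) x) \<le> 32 * B / R\<^sup>2" if x: "x \<in> cball 0 (R / 2)" for x
    proof -
      have sub: "cball x (R / 4) \<subseteq> ball 0 R"
      proof
        fix y assume "y \<in> cball x (R / 4)"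
        then have "norm y \<le> R / 2 + R / 4"
          using x norm_triangle_ineq[of x "y - x"] by (simp add: dist_norm norm_minus_commute)
        then show "y \<in> ball 0 R" using R by simp
      qed
      have "norm (?f 2 x) \<le> fact 2 * B / (R / 4) ^ 2"
      proof (rule Cauchy_inequality)
        show "\<psi> holomorphic_on ball x (R / 4)"
          using hol sub by (meson ball_subset_cball holomorphic_on_subset order_trans)
        show "continuous_on (cball x (R / 4)) \<psi>"
          using hol sub by (meson holomorphic_on_imp_continuous_on continuous_on_subset)
        show "norm (\<psi> y) \<le> B" if "norm (x - y) = R / 4" for y
          using that sub by (intro B) (auto simp: dist_norm)
      qed (use R in simp)
      then show ?thesis by (simp add: numeral_2_eq_2 power2_eq_square divide_simps)
    qed
  qed (use s R in auto)
  then have *: "norm (\<psi> s - \<psi> 0 - deriv \<psi> 0 * s) \<le> 32 * B / R\<^sup>2 * (norm s)\<^sup>2"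
    by (simp add: algebra_simps power2_eq_square)
  have "(\<psi> s - \<psi> 0) / s - deriv \<psi> 0 = (\<psi> s - \<psi> 0 - deriv \<psi> 0 * s) / s"
    using s by (simp add: field_simps)
  then have "norm ((\<psi> s - \<psi> 0) / s - deriv \<psi> 0) \<le> 32 * B / R\<^sup>2 * (norm s)\<^sup>2 / norm s"
    using divide_right_mono[OF *, of "norm s"] by (simp only: norm_divide * norm_ge_zero)
  then show ?thesis using s by (simp add: power2_eq_square)
qed

text \<open>The difference quotients of \<open>f\<close> in direction \<open>e\<close> converge locally uniformly, hence so do
  their derivatives, by the Cauchy estimates. This also yields the symmetry of second derivatives.\<close>

lemma dird_has_derivative:
  fixes f :: "complex ^ 'n \<Rightarrow> complex"
  assumes U: "open U" and hol: "holomorphic_vec f U" and p: "p \<in> U"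
  obtains G s where "(dird e f has_derivative G) (at p)" "\<And>c v. G (c *s v) = c * G v"
    "s \<longlonglongrightarrow> 0" "\<And>n. s n \<noteq> 0"
    "\<And>v. (\<lambda>n. (dird v f (p + s n *s e) - dird v f p) / s n) \<longlonglongrightarrow> G v"
proof -
  obtain r where r: "r > 0" "cball p r \<subseteq> U"
    using U p by (meson open_contains_cball)
  have "continuous_on (cball p r) f"
    using r holomorphic_vec_dird(1)[OF hol]
    by (meson continuous_at_imp_continuous_on has_derivative_continuous subsetD)
  then have "compact (f ` cball p r)"
    by (rule compact_continuous_image) simp
  then obtain B where "\<forall>x\<in>f ` cball p r. norm x \<le> B"
    using compact_imp_bounded bounded_iff by blast
  then have B: "norm (f z) \<le> B" if "z \<in> cball p r" for z
    using that by blast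
  have "B \<ge> 0" using order_trans[OF norm_ge_zero B[of p]] r by simp
  \<comment> \<open>A step of size at most R in direction e moves a point by at most r / 2, hence
    from \<open>ball p (r / 2)\<close> to a point of \<open>cball p r\<close>. The summand 1 covers
    the case e = 0.\<close>
  define R where "R = r / (2 * (norm e + 1))"
  have ne: "norm e + 1 > 0" by (smt (verit) norm_ge_zero)
  then have R: "R > 0" using r by (simp add: R_def)
  have Re: "R * norm e \<le> r / 2"
    using r ne unfolding R_def by (simp add: divide_simps mult_left_mono)
  define K where "K = 32 * B / R\<^sup>2"
  have "K \<ge> 0" using \<open>B \<ge> 0\<close> by (simp add: K_def)
  define s :: "nat \<Rightarrow> complex" where "s n = of_real (R / 2 * inverse (real (Suc n)))" for n
  have s0: "s n \<noteq> 0" for n unfolding s_def of_real_eq_0_iff using R by simp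
  have ns: "norm (s n) = R / 2 * inverse (real (Suc n))" for n
    using R unfolding s_def norm_of_real by simp
  have sR: "norm (s n) \<le> R / 2" for n
    unfolding ns using R by (simp add: field_simps)
  have "(\<lambda>n. R / 2 * inverse (real (Suc n))) \<longlonglongrightarrow> R / 2 * 0"
    by (intro tendsto_mult tendsto_const LIMSEQ_inverse_real_of_nat)
  then have "(\<lambda>n. norm (s n)) \<longlonglongrightarrow> R / 2 * 0" by (simp only: ns)
  then have ns0: "(\<lambda>n. norm (s n)) \<longlonglongrightarrow> 0" by simp
  then have sl: "s \<longlonglongrightarrow> 0" by (rule tendsto_norm_zero_cancel)
  have inner: "z + t *s e \<in> cball p r" if "z \<in> ball p (r / 2)" "norm t \<le> R" for z t
  proof -
    have "norm (t *s e) \<le> r / 2"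
      unfolding norm_vector_smult using that Re by (smt (verit) mult_right_mono norm_ge_zero)
    moreover have "dist p (z + t *s e) \<le> dist p z + norm (t *s e)"
      by (metis add_diff_cancel_left' dist_norm dist_triangle norm_minus_commute)
    ultimately show ?thesis using that by simp
  qed
  define g where "g n z = (f (z + s n *s e) - f z) / s n" for n z
  have g_approx: "norm (g n z - dird e f z) \<le> K * norm (s n)" if z: "z \<in> ball p (r / 2)" for n z
  proof -
    let ?\<psi> = "\<lambda>t. f (z + t *s e)"
    have "?\<psi> holomorphic_on ball 0 R"
      unfolding holomorphic_on_def field_differentiable_def
    proof
      fix t :: complex assume "t \<in> ball 0 R"
      then have "z + t *s e \<in> U" using inner[OF z, of t] r by auto
      from holomorphic_vec_line[OF hol this]
      show "\<exists>f'. (?\<psi> has_field_derivative f') (at t within ball 0 R)"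
        by (blast intro: has_field_derivative_at_within)
    qed
    moreover have "norm (?\<psi> t) \<le> B" if "t \<in> ball 0 R" for t
      using that inner[OF z, of t] by (intro B) simp
    ultimately show ?thesis
      using difference_quotient_bound[of ?\<psi> R B "s n"] s0 sR
      by (simp add: g_def dird_def K_def)
  qed
  have g_deriv: "(g n has_derivative (\<lambda>v. (dird v f (z + s n *s e) - dird v f z) / s n)) (at z)"
    if "z \<in> ball p (r / 2)" for n z
  proof -
    have "z + s n *s e \<in> U" using inner[OF that, of "s n"] sR[of n] R r by auto
    moreover have "z \<in> U" using inner[OF that, of 0] r R by auto
    ultimately have *: "(f has_derivative (\<lambda>v. dird v f (z + s n *s e))) (at (z + s n *s e))"
        "(f has_derivative (\<lambda>v. dird v f z)) (at z)"
      using holomorphic_vec_dird(1)[OF hol] by blast+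
    have "((\<lambda>z. z + s n *s e) has_derivative (\<lambda>v. v)) (at z)"
      by (auto intro!: derivative_eq_intros)
    from has_derivative_compose[OF this *(1)] *(2)
    show ?thesis unfolding g_def[abs_def]
      by (intro derivative_eq_intros) (auto simp: s0 divide_simps)
  qed
  define G' where "G' n z v = (dird v f (z + s n *s e) - dird v f z) / s n" for n z v
  have U': "z \<in> U" "z + s n *s e \<in> U" if "z \<in> ball p (r / 2)" for n z
    using inner[OF that, of "s n"] inner[OF that, of 0] sR[of n] R r by auto
  have G'_scale: "G' n z (c *s v) = c * G' n z v" if "z \<in> ball p (r / 2)" for n z c v
    using holomorphic_vec_dird(2)[OF hol U'(1)[OF that]] holomorphic_vec_dird(2)[OF hol U'(2)[OF that]]
    by (simp add: G'_def algebra_simps)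
  \<comment> \<open>Cauchy's estimate for the first derivative along z + t v, on the circle of
    radius r / (8 |v|). There each of the two difference quotients is within K |s| of
    \<open>dird e f\<close>, and the inverse of the radius produces the factor 8 |v| / r.\<close>
  have G'_diff: "norm (G' n z v - G' m z v) \<le> 8 * K / r * (norm (s n) + norm (s m)) * norm v"
    if z: "z \<in> ball p (r / 4)" for n m z v
  proof (cases "v = 0")
    case True
    then show ?thesis using G'_scale[of z _ 0 v] z r by simp
  next
    case False
    let ?\<rho> = "r / (8 * norm v)"
    let ?\<psi> = "\<lambda>t. g n (z + t *s v) - g m (z + t *s v)"
    have \<rho>: "?\<rho> > 0" using r False by simp
    have zt: "z + t *s v \<in> ball p (r / 2)" if "norm t < 2 * ?\<rho>" for t
    proof -
      have "norm (t *s v) < r / 4"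
        unfolding norm_vector_smult using that False by (simp add: divide_simps)
      moreover have "dist p (z + t *s v) \<le> dist p z + norm (t *s v)"
        by (metis add_diff_cancel_left' dist_norm dist_triangle norm_minus_commute)
      ultimately show ?thesis using z by simp
    qed
    have der: "(?\<psi> has_field_derivative G' n (z + t *s v) v - G' m (z + t *s v) v) (at t)"
      if "norm t < 2 * ?\<rho>" for t
      by (intro derivative_intros holomorphic_vec_line_aux)
        (use g_deriv[OF zt[OF that]] G'_scale[OF zt[OF that]] in \<open>auto simp: G'_def[abs_def]\<close>)
    have sub: "norm t < 2 * ?\<rho>" if "t \<in> cball 0 ?\<rho>" for t :: complex
      using that \<rho> by simp
    have holp: "?\<psi> holomorphic_on cball 0 ?\<rho>"
      unfolding holomorphic_on_def field_differentiable_def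
      using der[OF sub] has_field_derivative_at_within by blast
    have "norm ((deriv ^^ 1) ?\<psi> 0) \<le> fact 1 * (K * norm (s n) + K * norm (s m)) / ?\<rho> ^ 1"
    proof (rule Cauchy_inequality)
      show "?\<psi> holomorphic_on ball 0 ?\<rho>"
        using holp by (rule holomorphic_on_subset) auto
      show "continuous_on (cball 0 ?\<rho>) ?\<psi>"
        by (rule holomorphic_on_imp_continuous_on[OF holp])
      show "norm (?\<psi> t) \<le> K * norm (s n) + K * norm (s m)" if "norm (0 - t) = ?\<rho>" for t
      proof -
        have "z + t *s v \<in> ball p (r / 2)" using that \<rho> by (intro zt) simp
        from g_approx[OF this, of n] g_approx[OF this, of m] show ?thesis
          using norm_triangle_ineq4[of "g n (z + t *s v) - dird e f (z + t *s v)"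
              "g m (z + t *s v) - dird e f (z + t *s v)"] by simp
      qed
    qed (rule \<rho>)
    moreover have "deriv ?\<psi> 0 = G' n z v - G' m z v"
      using der[of 0] \<rho> by (simp add: DERIV_imp_deriv)
    ultimately show ?thesis using r False by (simp add: field_simps)
  qed
  define G where "G z v = lim (\<lambda>n. G' n z v)" for z v
  have G'_lim: "(\<lambda>n. G' n z v) \<longlonglongrightarrow> G z v" if z: "z \<in> ball p (r / 4)" for z v
  proof -
    have "Cauchy (\<lambda>n. G' n z v)"
    proof (rule CauchyI)
      fix \<epsilon> :: real assume "\<epsilon> > 0"
      have "(\<lambda>n. 8 * K / r * norm (s n) * norm v) \<longlonglongrightarrow> 0"
        by (rule tendsto_eq_intros ns0 | simp)+
      then have "\<forall>\<^sub>F n in sequentially. 8 * K / r * norm (s n) * norm v < \<epsilon> / 2"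
        using \<open>\<epsilon> > 0\<close> by (intro order_tendstoD(2)) auto
      then obtain N where N: "\<And>n. n \<ge> N \<Longrightarrow> 8 * K / r * norm (s n) * norm v < \<epsilon> / 2"
        by (auto simp: eventually_sequentially)
      have "norm (G' m z v - G' n z v) < \<epsilon>" if "m \<ge> N" "n \<ge> N" for m n
        using G'_diff[OF z, of m v n] N[OF that(1)] N[OF that(2)]
        unfolding distrib_left distrib_right by linarith
      then show "\<exists>M. \<forall>m\<ge>M. \<forall>n\<ge>M. norm (G' m z v - G' n z v) < \<epsilon>" by blast
    qed
    then show ?thesis
      unfolding G_def using Cauchy_convergent convergent_LIMSEQ_iff by blast
  qed
  have G'_bound: "norm (G' n z v - G z v) \<le> 8 * K / r * norm (s n) * norm v"
    if z: "z \<in> ball p (r / 4)" for n z v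
  proof (rule tendsto_le[OF _ _ _ always_eventually])
    show "(\<lambda>m. norm (G' n z v - G' m z v)) \<longlonglongrightarrow> norm (G' n z v - G z v)"
      by (intro tendsto_intros G'_lim z)
    show "(\<lambda>m. 8 * K / r * (norm (s n) + norm (s m)) * norm v) \<longlonglongrightarrow> 8 * K / r * norm (s n) * norm v"
      by (rule tendsto_eq_intros ns0 | simp)+
  qed (use G'_diff[OF z] in auto)
  \<comment> \<open>The derivatives of the difference quotients converge uniformly to G, so the
    limit of the quotients is differentiable with derivative G. That limit is then recognized as
    \<open>dird e f\<close>.\<close>
  have "\<exists>g'. \<forall>z\<in>ball p (r / 4). (\<lambda>n. g n z) \<longlonglongrightarrow> g' z \<and>
      (g' has_derivative G z) (at z within ball p (r / 4))"
  proof (rule has_derivative_sequence)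
    show "(g n has_derivative G' n z) (at z within ball p (r / 4))" if "z \<in> ball p (r / 4)" for n z
      using g_deriv[of z n] that r by (auto simp: G'_def[abs_def] intro: has_derivative_at_withinI)
    show "\<forall>\<^sub>F n in sequentially. \<forall>x\<in>ball p (r / 4). \<forall>h. norm (G' n x h - G x h) \<le> \<epsilon> * norm h"
      if "\<epsilon> > 0" for \<epsilon>
    proof -
      have "(\<lambda>n. 8 * K / r * norm (s n)) \<longlonglongrightarrow> 0"
        by (rule tendsto_eq_intros ns0 | simp)+
      then have "\<forall>\<^sub>F n in sequentially. 8 * K / r * norm (s n) < \<epsilon>"
        using \<open>\<epsilon> > 0\<close> by (intro order_tendstoD(2)) auto
      then show ?thesis
        by eventually_elim
          (use G'_bound in \<open>smt (verit, best) mult_right_mono norm_ge_zero\<close>)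
    qed
    show "p \<in> ball p (r / 4)" using r by simp
    have "(\<lambda>n. norm (g n p - dird e f p)) \<longlonglongrightarrow> 0"
    proof (rule tendsto_sandwich[OF _ _ tendsto_const])
      show "(\<lambda>n. K * norm (s n)) \<longlonglongrightarrow> 0" by (rule tendsto_eq_intros ns0 | simp)+
    qed (use g_approx[of p] r in auto)
    then show "(\<lambda>n. g n p) \<longlonglongrightarrow> dird e f p" by (rule LIM_zero_cancel[OF tendsto_norm_zero_cancel])
  qed simp
  then obtain g' where g': "\<And>z. z \<in> ball p (r / 4) \<Longrightarrow> (\<lambda>n. g n z) \<longlonglongrightarrow> g' z"
    "\<And>z. z \<in> ball p (r / 4) \<Longrightarrow> (g' has_derivative G z) (at z within ball p (r / 4))" by blast
  have "g' z = dird e f z" if z: "z \<in> ball p (r / 4)" for z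
  proof -
    have z': "z \<in> ball p (r / 2)" using z r by simp
    have "(\<lambda>n. norm (g n z - dird e f z)) \<longlonglongrightarrow> 0"
    proof (rule tendsto_sandwich[OF _ _ tendsto_const])
      show "(\<lambda>n. K * norm (s n)) \<longlonglongrightarrow> 0" by (rule tendsto_eq_intros ns0 | simp)+
    qed (use g_approx[OF z'] in auto)
    then have "(\<lambda>n. g n z) \<longlonglongrightarrow> dird e f z" by (rule LIM_zero_cancel[OF tendsto_norm_zero_cancel])
    with g'(1)[OF z] show ?thesis by (rule LIMSEQ_unique)
  qed
  moreover have "(g' has_derivative G p) (at p)"
    using g'(2)[of p] r by (simp add: at_within_open[of p "ball p (r / 4)"])
  ultimately have d: "(dird e f has_derivative G p) (at p)"
    using r by (elim has_derivative_transform_within_open[where s = "ball p (r / 4)"]) auto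
  show thesis
  proof (rule that[OF d _ sl s0])
    fix c v
    have "(\<lambda>n. G' n p (c *s v)) \<longlonglongrightarrow> c * G p v"
      using r G'_scale[of p] by (auto intro!: tendsto_intros G'_lim)
    then show "G p (c *s v) = c * G p v"
      using G'_lim[of p "c *s v"] r LIMSEQ_unique by fastforce
    show "(\<lambda>n. (dird v f (p + s n *s e) - dird v f p) / s n) \<longlonglongrightarrow> G p v"
      using G'_lim[of p v] r by (simp add: G'_def)
  qed
qed

lemma holomorphic_vec_dird_holomorphic:
  assumes "open U" "holomorphic_vec f U"
  shows "holomorphic_vec (dird e f) U"
  unfolding holomorphic_vec_def using dird_has_derivative[OF assms] by metis

text \<open>The linear map G supplied by \<open>dird_has_derivative\<close> has two descriptions: it
  is the derivative of \<open>dird e f\<close>, and its value at v is the limit along s of the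
  difference quotients of \<open>dird v f\<close> in direction e.\<close>

lemma dird_commute:
  assumes "open U" "holomorphic_vec f U" "p \<in> U"
  shows "dird v (dird e f) p = dird e (dird v f) p"
proof -
  obtain G s where G: "(dird e f has_derivative G) (at p)" "\<And>c v. G (c *s v) = c * G v"
    "s \<longlonglongrightarrow> 0" "\<And>n. s n \<noteq> 0"
    "\<And>v. (\<lambda>n. (dird v f (p + s n *s e) - dird v f p) / s n) \<longlonglongrightarrow> G v"
    by (rule dird_has_derivative[OF assms, where e = e]) (rule that)
  have "(dird e f has_derivative (\<lambda>v. dird v (dird e f) p)) (at p)"
    by (rule holomorphic_vec_dird(1)[OF holomorphic_vec_dird_holomorphic[OF assms(1,2)] assms(3)])
  then have "dird v (dird e f) p = G v"
    using has_derivative_unique[OF G(1)] by metis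
  moreover have "((\<lambda>t. dird v f (p + t *s e)) has_field_derivative dird e (dird v f) p) (at 0)"
    using holomorphic_vec_line[OF holomorphic_vec_dird_holomorphic[OF assms(1,2)], of p 0 e v] assms(3)
    by simp
  then have "((\<lambda>t. (dird v f (p + t *s e) - dird v f p) / t) \<longlongrightarrow> dird e (dird v f) p) (at 0)"
    by (simp add: has_field_derivative_iff)
  then have "(\<lambda>n. (dird v f (p + s n *s e) - dird v f p) / s n) \<longlonglongrightarrow> dird e (dird v f) p"
    by (rule filterlim_compose) (use G(3,4) in \<open>auto simp: filterlim_at\<close>)
  with G(5) have "G v = dird e (dird v f) p" by (rule LIMSEQ_unique)
  ultimately show ?thesis by simp
qed

section \<open>Regular points and the derivatives of meromorphic functions\<close>

lemma dird_cong:
  assumes "open V" "z \<in> V" "\<And>w. w \<in> V \<Longrightarrow> \<phi> w = \<psi> w"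
  shows "dird e \<phi> z = dird e \<psi> z"
proof -
  have "isCont (\<lambda>t. z + t *s e) 0"
    using has_derivative_continuous[OF has_derivative_line] .
  then have "((\<lambda>t. z + t *s e) \<longlongrightarrow> z + 0 *s e) (nhds 0)"
    unfolding isCont_def by (simp only: tendsto_at_iff_tendsto_nhds[of "\<lambda>t. z + t *s e"])
  then have "((\<lambda>t. z + t *s e) \<longlongrightarrow> z) (nhds 0)" by simp
  then have "\<forall>\<^sub>F t in nhds 0. z + t *s e \<in> V"
    using assms topological_tendstoD by blast
  then have "\<forall>\<^sub>F t in nhds 0. \<phi> (z + t *s e) = \<psi> (z + t *s e)"
    by eventually_elim (rule assms)
  then show ?thesis
    unfolding dird_def by (intro deriv_cong_ev) auto
qed

text \<open>The largest open set on which this particular representative is holomorphic. Values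
  elsewhere may be arbitrary, so identities are verified here and pass to classes because the set is
  dense.\<close>

definition regular_set :: "(complex ^ 'n \<Rightarrow> complex) \<Rightarrow> (complex ^ 'n) set"
  where "regular_set \<phi> = \<Union>{V. open V \<and> holomorphic_vec \<phi> V}"

lemma open_regular_set: "open (regular_set \<phi>)"
  by (auto simp: regular_set_def)

lemma holomorphic_vec_regular_set: "holomorphic_vec \<phi> (regular_set \<phi>)"
  by (auto simp: regular_set_def holomorphic_vec_def)

lemma holomorphic_vec_cong:
  assumes "open V" "holomorphic_vec \<psi> V" "\<And>w. w \<in> V \<Longrightarrow> \<phi> w = \<psi> w"
  shows "holomorphic_vec \<phi> V"
  unfolding holomorphic_vec_def
proof
  fix z assume z: "z \<in> V"
  then obtain L where "(\<psi> has_derivative L) (at z)" "\<forall>c v. L (c *s v) = c * L v"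
    using assms(2) unfolding holomorphic_vec_def by blast
  then show "\<exists>L. (\<phi> has_derivative L) (at z) \<and> (\<forall>c v. L (c *s v) = c * L v)"
    using has_derivative_transform_within_open[OF _ assms(1) z] assms(3) by metis
qed

lemma holomorphic_vec_divide:
  assumes "holomorphic_vec g V" "holomorphic_vec h V" "\<And>z. z \<in> V \<Longrightarrow> h z \<noteq> 0"
  shows "holomorphic_vec (\<lambda>z. g z / h z) V"
  unfolding holomorphic_vec_def
proof
  fix z assume z: "z \<in> V"
  then obtain L M where "(g has_derivative L) (at z)" "\<forall>c v. L (c *s v) = c * L v"
    "(h has_derivative M) (at z)" "\<forall>c v. M (c *s v) = c * M v"
    using assms unfolding holomorphic_vec_def by meson
  moreover have "((\<lambda>z. g z / h z) has_derivative
      (\<lambda>v. - g z * (inverse (h z) * M v * inverse (h z)) + L v / h z)) (at z)"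
    by (intro has_derivative_divide calculation assms(3) z)
  ultimately show "\<exists>L. ((\<lambda>z. g z / h z) has_derivative L) (at z) \<and> (\<forall>c v. L (c *s v) = c * L v)"
    using \<open>\<forall>c v. L (c *s v) = c * L v\<close> \<open>\<forall>c v. M (c *s v) = c * M v\<close>
    by (intro exI[of _ "\<lambda>v. - g z * (inverse (h z) * M v * inverse (h z)) + L v / h z"] conjI)
      (simp_all add: algebra_simps)
qed

lemma meromorphic_vecE:
  assumes "meromorphic_vec \<phi>"
  obtains U g h where "open U" "p \<in> U" "holomorphic_vec g U" "holomorphic_vec h U"
    "\<And>V. open V \<Longrightarrow> V \<noteq> {} \<Longrightarrow> V \<subseteq> U \<Longrightarrow> \<exists>z\<in>V. h z \<noteq> 0"
    "\<And>z. z \<in> U \<Longrightarrow> h z \<noteq> 0 \<Longrightarrow> \<phi> z = g z / h z"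
  using assms unfolding meromorphic_vec_def by (metis (full_types))

lemma dense_iff:
  "closure S = (UNIV :: 'a::topological_space set) \<longleftrightarrow> (\<forall>V. open V \<longrightarrow> V \<noteq> {} \<longrightarrow> S \<inter> V \<noteq> {})"
proof
  assume *: "closure S = UNIV"
  then show "\<forall>V. open V \<longrightarrow> V \<noteq> {} \<longrightarrow> S \<inter> V \<noteq> {}"
    using open_Int_closure_eq_empty[of _ S] by (metis inf_commute inf_top.right_neutral)
next
  assume "\<forall>V. open V \<longrightarrow> V \<noteq> {} \<longrightarrow> S \<inter> V \<noteq> {}"
  then have "- closure S = {}"
    using closure_subset[of S] by (metis Compl_disjoint2 disjoint_eq_subset_Compl inf_commute
        closed_closure open_Compl compl_le_compl_iff)
  then show "closure S = UNIV" by blast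
qed

text \<open>Where a local denominator does not vanish the function agrees with a quotient of
  holomorphic functions. This happens on an open set, and by definition of meromorphy it meets every
  nonempty open subset of the local domain.\<close>

lemma dense_regular_set:
  assumes "meromorphic_vec \<phi>"
  shows "closure (regular_set \<phi>) = UNIV"
  unfolding dense_iff
proof (intro allI impI)
  fix V :: "(complex ^ 'a) set" assume V: "open V" "V \<noteq> {}"
  then obtain p where p: "p \<in> V" by blast
  obtain U g h where U: "open U" "p \<in> U" "holomorphic_vec g U" "holomorphic_vec h U"
    "\<And>V. open V \<Longrightarrow> V \<noteq> {} \<Longrightarrow> V \<subseteq> U \<Longrightarrow> \<exists>z\<in>V. h z \<noteq> 0"
    "\<And>z. z \<in> U \<Longrightarrow> h z \<noteq> 0 \<Longrightarrow> \<phi> z = g z / h z"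
    by (rule meromorphic_vecE[OF assms, of p]) (rule that)
  define W where "W = {z \<in> U. h z \<noteq> 0}"
  have oW: "open W" unfolding W_def by (rule holomorphic_vec_open_nonzero[OF U(4,1)])
  have "holomorphic_vec (\<lambda>z. g z / h z) W"
    by (rule holomorphic_vec_divide)
      (use U(3,4) in \<open>auto simp: W_def intro: holomorphic_vec_subset\<close>)
  then have "holomorphic_vec \<phi> W"
    by (rule holomorphic_vec_cong[OF oW]) (use U(6) in \<open>auto simp: W_def\<close>)
  then have "W \<subseteq> regular_set \<phi>" using oW by (auto simp: regular_set_def)
  moreover have "\<exists>z\<in>U \<inter> V. h z \<noteq> 0"
    using U(1,2) V(1) p by (intro U(5)) auto
  ultimately show "regular_set \<phi> \<inter> V \<noteq> {}" by (auto simp: W_def)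
qed

text \<open>The quotient rule with denominator h * h. At a point where h does not vanish, the
  equality with g / h holds in a whole neighbourhood, which is all that a derivative sees.\<close>

lemma meromorphic_vec_dird:
  assumes "meromorphic_vec \<phi>"
  shows "meromorphic_vec (dird e \<phi>)"
  unfolding meromorphic_vec_def
proof
  fix p
  obtain U g h where U: "open U" "p \<in> U" "holomorphic_vec g U" "holomorphic_vec h U"
    "\<And>V. open V \<Longrightarrow> V \<noteq> {} \<Longrightarrow> V \<subseteq> U \<Longrightarrow> \<exists>z\<in>V. h z \<noteq> 0"
    "\<And>z. z \<in> U \<Longrightarrow> h z \<noteq> 0 \<Longrightarrow> \<phi> z = g z / h z"
    by (rule meromorphic_vecE[OF assms, of p]) (rule that)
  note hd = holomorphic_vec_dird_holomorphic[OF U(1)]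
  show "\<exists>U g h. open U \<and> p \<in> U \<and> holomorphic_vec g U \<and> holomorphic_vec h U \<and>
      (\<forall>V. open V \<and> V \<noteq> {} \<and> V \<subseteq> U \<longrightarrow> (\<exists>z\<in>V. h z \<noteq> 0)) \<and>
      (\<forall>z\<in>U. h z \<noteq> 0 \<longrightarrow> dird e \<phi> z = g z / h z)"
  proof (intro exI conjI allI impI ballI)
    show "open U" "p \<in> U" by fact+
    show "holomorphic_vec (\<lambda>z. dird e g z * h z + (- 1) * (g z * dird e h z)) U"
      by (intro holomorphic_vec_add holomorphic_vec_mult holomorphic_vec_const hd U(3,4))
    show "holomorphic_vec (\<lambda>z. h z * h z) U"
      by (intro holomorphic_vec_mult U(4))
    show "\<exists>z\<in>V. h z * h z \<noteq> 0" if "open V \<and> V \<noteq> {} \<and> V \<subseteq> U" for V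
      using U(5)[of V] that by auto
    fix z assume z: "z \<in> U" "h z * h z \<noteq> 0"
    define W where "W = {z \<in> U. h z \<noteq> 0}"
    have oW: "open W" unfolding W_def by (rule holomorphic_vec_open_nonzero[OF U(4,1)])
    have zW: "z \<in> W" using z by (simp add: W_def)
    have "dird e \<phi> z = dird e (\<lambda>z. g z / h z) z"
      by (rule dird_cong[OF oW zW]) (simp add: W_def U(6))
    also have "\<dots> = (dird e g z * h z - g z * dird e h z) / (h z * h z)"
      unfolding dird_def[of e "\<lambda>z. g z / h z"]
      using DERIV_divide[OF holomorphic_vec_line[OF U(3), of z 0 e] holomorphic_vec_line[OF U(4), of z 0 e]] z
      by (intro DERIV_imp_deriv) auto
    finally show "dird e \<phi> z = (dird e g z * h z + (- 1) * (g z * dird e h z)) / (h z * h z)"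
      by simp
  qed
qed

lemma mero_eqI:
  assumes "meromorphic_vec \<phi>" "meromorphic_vec \<psi>" "open S" "closure S = UNIV"
    "\<And>z. z \<in> S \<Longrightarrow> \<phi> z = \<psi> z"
  shows "mero_eq \<phi> \<psi>"
  using assms unfolding mero_eq_def by blast

text \<open>\<open>mero_partial\<close> differentiates a chosen representative. The lifted operator
  shows that the class of the result does not depend on the choice, and makes proofs by transfer
  possible.\<close>

lift_definition mero_dird :: "'n::finite \<Rightarrow> 'n mero \<Rightarrow> 'n mero" is "\<lambda>i. dird (axis i 1)"
proof -
  fix i :: 'n and \<phi> \<psi> :: "complex ^ 'n \<Rightarrow> complex"
  assume "mero_eq \<phi> \<psi>"
  then obtain S where S: "open S" "closure S = UNIV" "\<forall>z\<in>S. \<phi> z = \<psi> z"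
    and m: "meromorphic_vec \<phi>" "meromorphic_vec \<psi>"
    unfolding mero_eq_def by blast
  show "mero_eq (dird (axis i 1) \<phi>) (dird (axis i 1) \<psi>)"
    by (rule mero_eqI[OF _ _ S(1,2)]) (use m S in \<open>auto intro: meromorphic_vec_dird dird_cong\<close>)
qed

lemma mero_partial_eq: "mero_partial = mero_dird"
proof (intro ext)
  fix i and f :: "'a mero"
  have "mero_dird i f = mero_dird i (abs_mero (rep_mero f))"
    by (simp add: Quotient_abs_rep[OF Quotient_mero])
  also have "\<dots> = abs_mero (dird (axis i 1) (rep_mero f))"
    by (rule mero_dird.abs_eq) (rule Quotient_rep_reflp[OF Quotient_mero])
  finally show "mero_partial i f = mero_dird i f"
    by (simp add: mero_partial_def dird_def[abs_def])
qed

lemma mero_partial_add: "mero_partial i (f + g) = mero_partial i f + mero_partial i g"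
  unfolding mero_partial_eq
proof transfer
  fix i and f g :: "complex ^ 'a \<Rightarrow> complex"
  assume "mero_eq f f" "mero_eq g g"
  then have m: "meromorphic_vec f" "meromorphic_vec g" by (auto dest: mero_eq_D)
  let ?S = "regular_set f \<inter> regular_set g"
  have S: "open ?S" "closure ?S = UNIV"
    using dense_open_Int[OF open_regular_set dense_regular_set[OF m(1)] open_regular_set
        dense_regular_set[OF m(2)]] by auto
  show "mero_eq (dird (axis i 1) (\<lambda>z. f z + g z)) (\<lambda>z. dird (axis i 1) f z + dird (axis i 1) g z)"
  proof (rule mero_eqI[OF _ _ S])
    fix z assume "z \<in> ?S"
    then show "dird (axis i 1) (\<lambda>z. f z + g z) z = dird (axis i 1) f z + dird (axis i 1) g z"
      unfolding dird_def[of _ "\<lambda>z. f z + g z"]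
      using DERIV_add[OF holomorphic_vec_line[OF holomorphic_vec_regular_set, of z 0 "axis i 1" f]
          holomorphic_vec_line[OF holomorphic_vec_regular_set, of z 0 "axis i 1" g]]
      by (intro DERIV_imp_deriv) auto
  qed (intro meromorphic_vec_add meromorphic_vec_dird m)+
qed

lemma mero_partial_mult:
  "mero_partial i (f * g) = mero_partial i f * g + f * mero_partial i g"
  unfolding mero_partial_eq
proof transfer
  fix i and f g :: "complex ^ 'a \<Rightarrow> complex"
  assume "mero_eq f f" "mero_eq g g"
  then have m: "meromorphic_vec f" "meromorphic_vec g" by (auto dest: mero_eq_D)
  let ?S = "regular_set f \<inter> regular_set g"
  have S: "open ?S" "closure ?S = UNIV"
    using dense_open_Int[OF open_regular_set dense_regular_set[OF m(1)] open_regular_set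
        dense_regular_set[OF m(2)]] by auto
  show "mero_eq (dird (axis i 1) (\<lambda>z. f z * g z))
      (\<lambda>z. dird (axis i 1) f z * g z + f z * dird (axis i 1) g z)"
  proof (rule mero_eqI[OF _ _ S])
    fix z assume "z \<in> ?S"
    then show "dird (axis i 1) (\<lambda>z. f z * g z) z
        = dird (axis i 1) f z * g z + f z * dird (axis i 1) g z"
      unfolding dird_def[of _ "\<lambda>z. f z * g z"]
      using DERIV_mult[OF holomorphic_vec_line[OF holomorphic_vec_regular_set, of z 0 "axis i 1" f]
          holomorphic_vec_line[OF holomorphic_vec_regular_set, of z 0 "axis i 1" g]]
      by (intro DERIV_imp_deriv) (auto simp: algebra_simps)
  qed (intro meromorphic_vec_add meromorphic_vec_mult meromorphic_vec_dird m)+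
qed

lemma mero_partial_const: "mero_partial i (c *\<^sub>C 1) = 0"
  unfolding mero_partial_eq
  by transfer (auto simp: dird_def[abs_def] intro!: mero_eq_refl meromorphic_vec_const)

lemma clinear_mero_partial: "clinear (mero_partial i)"
  by (rule clinearI, rule mero_partial_add)
    (subst (1 2) scaleC_mero_conv, simp add: mero_partial_mult mero_partial_const)

lemma mero_partial_one: "mero_partial i 1 = 0"
  using mero_partial_const[of i 1] by (simp add: scaleC_one)

lemma mero_partial_commute: "mero_partial i (mero_partial j f) = mero_partial j (mero_partial i f)"
  unfolding mero_partial_eq
proof transfer
  fix i j and f :: "complex ^ 'a \<Rightarrow> complex"
  assume "mero_eq f f"
  then have m: "meromorphic_vec f" by (auto dest: mero_eq_D)
  show "mero_eq (dird (axis i 1) (dird (axis j 1) f)) (dird (axis j 1) (dird (axis i 1) f))"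
    by (rule mero_eqI[OF _ _ open_regular_set dense_regular_set[OF m]])
      (auto intro: meromorphic_vec_dird m dird_commute open_regular_set holomorphic_vec_regular_set)
qed

text \<open>The meromorphic functions form a field: by the identity theorem, the closure of the
  interior of the zero set is open and closed.\<close>

lemma holomorphic_vec_identity:
  assumes hol: "holomorphic_vec g (ball p r)" and V: "open V" "V \<noteq> {}" "V \<subseteq> ball p r"
    and g0: "\<And>z. z \<in> V \<Longrightarrow> g z = 0" and z: "z \<in> ball p r"
  shows "g z = 0"
proof -
  obtain q where q: "q \<in> V" using V by blast
  \<comment> \<open>The complex line through q and z reduces the claim to the identity theorem in
    one variable. Its domain T is convex, being the affine preimage of a ball, and hence
    connected.\<close>
  let ?l = "\<lambda>t. q + t *s (z - q)"
  define T where "T = ?l -` ball p r"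
  have cont: "continuous_on A ?l" for A
    using has_derivative_continuous[OF has_derivative_line] continuous_at_imp_continuous_on by blast
  have oT: "open T" unfolding T_def by (rule open_vimage[OF _ cont]) simp
  have "convex T" unfolding convex_def
  proof (intro ballI allI impI)
    fix a b :: complex and u v :: real
    assume ab: "a \<in> T" "b \<in> T" and uv: "0 \<le> u" "0 \<le> v" "u + v = 1"
    have v: "complex_of_real v = 1 - complex_of_real u"
    proof -
      have "v = 1 - u" using uv by simp
      then show ?thesis by simp
    qed
    have "?l (u *\<^sub>R a + v *\<^sub>R b) = u *\<^sub>R ?l a + v *\<^sub>R ?l b"
      by (simp add: vec_eq_iff scaleR_conv_of_real[where 'a = complex] v)
        (simp add: algebra_simps)
    moreover have "u *\<^sub>R ?l a + v *\<^sub>R ?l b \<in> ball p r"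
      using ab uv convex_ball[of p r] unfolding T_def convex_def by auto
    ultimately show "u *\<^sub>R a + v *\<^sub>R b \<in> T" by (simp add: T_def)
  qed
  then have "connected T" by (rule convex_connected)
  moreover have "open (T \<inter> ?l -` V)"
    using oT open_vimage[OF V(1) cont] by blast
  moreover have "0 \<in> T \<inter> ?l -` V" using q V by (auto simp: T_def)
  moreover have "(\<lambda>t. g (?l t)) holomorphic_on T"
    unfolding holomorphic_on_def field_differentiable_def
  proof
    fix t assume "t \<in> T"
    then have "?l t \<in> ball p r" by (simp add: T_def)
    from holomorphic_vec_line[OF hol this]
    show "\<exists>f'. ((\<lambda>t. g (?l t)) has_field_derivative f') (at t within T)"
      by (blast intro: has_field_derivative_at_within)
  qed
  moreover have "1 \<in> T" using z by (simp add: T_def)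
  ultimately have "g (?l 1) = 0"
    using oT g0
    by (intro analytic_continuation_open[of "T \<inter> ?l -` V" T "\<lambda>t. g (?l t)" "\<lambda>t. 0" 1]) auto
  then show ?thesis by simp
qed

lemma mero_zero_or_nowhere_zero:
  fixes \<phi> :: "complex ^ 'n \<Rightarrow> complex"
  assumes "meromorphic_vec \<phi>"
  shows "closure (interior {z. \<phi> z = 0}) = UNIV \<or> interior {z. \<phi> z = 0} = {}"
proof -
  let ?N = "interior {z. \<phi> z = 0}"
  have "open (closure ?N)"
  proof (subst open_subopen, intro ballI)
    fix p assume p: "p \<in> closure ?N"
    obtain U g h where U: "open U" "p \<in> U" "holomorphic_vec g U" "holomorphic_vec h U"
      "\<And>V. open V \<Longrightarrow> V \<noteq> {} \<Longrightarrow> V \<subseteq> U \<Longrightarrow> \<exists>z\<in>V. h z \<noteq> 0"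
      "\<And>z. z \<in> U \<Longrightarrow> h z \<noteq> 0 \<Longrightarrow> \<phi> z = g z / h z"
      by (rule meromorphic_vecE[OF assms, of p]) (rule that)
    obtain r where r: "r > 0" "ball p r \<subseteq> U" using U(1,2) open_contains_ball by blast
    let ?B = "ball p r"
    \<comment> \<open>On this open set the numerator g vanishes, hence on the whole ball. The
      function is then zero wherever h is not, which is a dense open part of the ball, so the ball
      lies in the closure.\<close>
    let ?V = "{z \<in> ?B \<inter> ?N. h z \<noteq> 0}"
    have oV: "open ?V"
      by (rule holomorphic_vec_open_nonzero[OF holomorphic_vec_subset[OF U(4)]]) (use r in auto)
    have "?B \<inter> ?N \<noteq> {}"
      using p r open_Int_closure_eq_empty[of ?B ?N] by (metis IntI centre_in_ball empty_iff open_ball)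
    then have "\<exists>z\<in>?B \<inter> ?N. h z \<noteq> 0" using r by (intro U(5)) auto
    then have neV: "?V \<noteq> {}" by auto
    have "g z = 0" if "z \<in> ?V" for z
    proof -
      have "\<phi> z = 0" "z \<in> U" "h z \<noteq> 0"
        using that r interior_subset[of "{z. \<phi> z = 0}"] by auto
      with U(6)[of z] show ?thesis by simp
    qed
    then have g0: "g z = 0" if "z \<in> ?B" for z
      using holomorphic_vec_identity[OF holomorphic_vec_subset[OF U(3) r(2)] oV neV _ _ that] by blast
    let ?W = "{z \<in> ?B. h z \<noteq> 0}"
    have "open ?W"
      by (rule holomorphic_vec_open_nonzero[OF holomorphic_vec_subset[OF U(4)]]) (use r in auto)
    then have "?W \<subseteq> ?N"
      by (rule interior_maximal[rotated]) (use U(6) g0 r in auto)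
    moreover have "?B \<subseteq> closure ?W"
    proof
      fix z assume z: "z \<in> ?B"
      show "z \<in> closure ?W"
      proof (rule ccontr)
        assume "z \<notin> closure ?W"
        then have "\<exists>w\<in>?B - closure ?W. h w \<noteq> 0"
          using z r by (intro U(5)) auto
        then show False using closure_subset[of ?W] by auto
      qed
    qed
    ultimately have "?B \<subseteq> closure ?N" using closure_mono[of ?W ?N] by blast
    then show "\<exists>T. open T \<and> p \<in> T \<and> T \<subseteq> closure ?N" using r by (intro exI[of _ ?B]) auto
  qed
  then have "closure ?N = {} \<or> closure ?N = UNIV"
    using clopen[of "closure ?N"] by auto
  then show ?thesis by auto
qed

lemma mero_inverse:
  fixes f :: "'n::finite mero"
  assumes "f \<noteq> 0"
  obtains g where "f * g = 1"
proof -
  let ?\<phi> = "rep_mero f"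
  have f: "f = abs_mero ?\<phi>" by (simp add: Quotient_abs_rep[OF Quotient_mero])
  have r: "mero_eq ?\<phi> ?\<phi>" by (rule Quotient_rep_reflp[OF Quotient_mero])
  then have m: "meromorphic_vec ?\<phi>" by (rule mero_eq_D)
  \<comment> \<open>Otherwise the function would vanish on a dense open set, and its class would be
    zero.\<close>
  have nz: "interior {z. ?\<phi> z = 0} = {}"
  proof (rule ccontr)
    assume "interior {z. ?\<phi> z = 0} \<noteq> {}"
    then have "closure (interior {z. ?\<phi> z = 0}) = UNIV"
      using mero_zero_or_nowhere_zero[OF m] by blast
    then have "mero_eq ?\<phi> (\<lambda>_. 0)"
      by (intro mero_eqI[OF m meromorphic_vec_const open_interior])
        (use interior_subset[of "{z. ?\<phi> z = 0}"] in auto)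
    then have "abs_mero ?\<phi> = abs_mero (\<lambda>_. 0)" by (rule Quotient_rel_abs[OF Quotient_mero])
    with assms f show False by (simp add: zero_mero_def)
  qed
  have m': "meromorphic_vec (\<lambda>z. 1 / ?\<phi> z)"
    unfolding meromorphic_vec_def
  proof
    fix p
    obtain U g h where U: "open U" "p \<in> U" "holomorphic_vec g U" "holomorphic_vec h U"
      "\<And>V. open V \<Longrightarrow> V \<noteq> {} \<Longrightarrow> V \<subseteq> U \<Longrightarrow> \<exists>z\<in>V. h z \<noteq> 0"
      "\<And>z. z \<in> U \<Longrightarrow> h z \<noteq> 0 \<Longrightarrow> ?\<phi> z = g z / h z"
      by (rule meromorphic_vecE[OF m, of p]) (rule that)
    have nzV: "\<exists>z\<in>V. g z * h z \<noteq> 0" if V: "open V" "V \<noteq> {}" "V \<subseteq> U" for V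
    proof (rule ccontr)
      assume "\<not> ?thesis"
      then have gh: "g z = 0 \<or> h z = 0" if "z \<in> V" for z using that by auto
      let ?W = "{z \<in> V. h z \<noteq> 0}"
      have "open ?W"
        by (rule holomorphic_vec_open_nonzero[OF holomorphic_vec_subset[OF U(4) V(3)] V(1)])
      moreover have "?\<phi> z = 0" if "z \<in> ?W" for z
        using U(6)[of z] gh[of z] V(3) that by auto
      ultimately have "?W \<subseteq> interior {z. ?\<phi> z = 0}"
        by (intro interior_maximal) auto
      moreover have "?W \<noteq> {}" using U(5)[OF V] by auto
      ultimately show False using nz by simp
    qed
    show "\<exists>U g h. open U \<and> p \<in> U \<and> holomorphic_vec g U \<and> holomorphic_vec h U \<and>
        (\<forall>V. open V \<and> V \<noteq> {} \<and> V \<subseteq> U \<longrightarrow> (\<exists>z\<in>V. h z \<noteq> 0)) \<and>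
        (\<forall>z\<in>U. h z \<noteq> 0 \<longrightarrow> 1 / ?\<phi> z = g z / h z)"
      \<comment> \<open>The reciprocal is written as h * h / (g * h) rather than h / g: at a zero of
        h the value of the representative is arbitrary, and the denominator g * h excludes such
        points from the required equality.\<close>
      by (rule exI[of _ U], rule exI[of _ "\<lambda>z. h z * h z"], rule exI[of _ "\<lambda>z. g z * h z"])
        (use U nzV in \<open>auto intro!: holomorphic_vec_mult\<close>)
  qed
  have S: "open (regular_set ?\<phi> \<inter> - {z. ?\<phi> z = 0})"
    using holomorphic_vec_open_nonzero[OF holomorphic_vec_regular_set[of ?\<phi>] open_regular_set]
    by (simp add: Int_def)
  have "mero_eq (\<lambda>z. ?\<phi> z * (1 / ?\<phi> z)) (\<lambda>_. 1)"
  proof (rule mero_eqI[OF meromorphic_vec_mult[OF m m'] meromorphic_vec_const S])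
    show "closure (regular_set ?\<phi> \<inter> - {z. ?\<phi> z = 0}) = UNIV"
      unfolding dense_iff
    proof (intro allI impI)
      fix V :: "(complex ^ 'n) set" assume V: "open V" "V \<noteq> {}"
      let ?V = "regular_set ?\<phi> \<inter> V"
      have "?V \<noteq> {}" using dense_regular_set[OF m] V unfolding dense_iff by blast
      moreover have "open ?V" using V open_regular_set by blast
      ultimately have "\<not> ?V \<subseteq> {z. ?\<phi> z = 0}" using nz interior_maximal by blast
      then show "regular_set ?\<phi> \<inter> - {z. ?\<phi> z = 0} \<inter> V \<noteq> {}" by blast
    qed
  qed auto
  then have "abs_mero ?\<phi> * abs_mero (\<lambda>z. 1 / ?\<phi> z) = 1"
    using times_mero.abs_eq[OF r mero_eq_refl[OF m']] Quotient_rel_abs[OF Quotient_mero]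
    by (simp add: one_mero_def)
  then show thesis using that f by metis
qed

named_theorems clin

lemmas [clin] = clinear_id(1)

lemma clinear_fun_plus [clin]: "clinear f \<Longrightarrow> clinear g \<Longrightarrow> clinear (\<lambda>x. f x + g x)"
  by (simp add: clinear_def scaleC_add_right algebra_simps)

lemma clinear_fun_tens_left [clin]: "clinear f \<Longrightarrow> clinear (\<lambda>x. f x \<otimes> y)"
  by (rule clinear_comp[OF clinear_tens_left])

lemma clinear_fun_tens_right [clin]: "clinear f \<Longrightarrow> clinear (\<lambda>x. y \<otimes> f x)"
  by (rule clinear_comp[OF clinear_tens_right])

lemma mero_scaleC_mult: "(c *\<^sub>C f) * g = c *\<^sub>C (f * g)" "f * (c *\<^sub>C g) = c *\<^sub>C (f * (g :: 'n::finite mero))"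
  by (simp_all only: scaleC_mero_conv[of c f] scaleC_mero_conv[of c g] scaleC_mero_conv[of c "f * g"]
      mult.assoc mult.left_commute)

lemma clinear_mult_left [clin]: "clinear f \<Longrightarrow> clinear (\<lambda>x. f x * (g :: 'n::finite mero))"
  and clinear_mult_right [clin]: "clinear f \<Longrightarrow> clinear (\<lambda>x. (g :: 'n::finite mero) * f x)"
  by (simp_all add: clinear_def algebra_simps mero_scaleC_mult)

lemma cbilinear_mult_mero: "cbilinear ((*) :: 'n::finite mero \<Rightarrow> _)"
  by (intro cbilinearI clin)

section \<open>Differential operators\<close>

lemma clinear_diffops: "D \<in> diffops \<Longrightarrow> clinear D"
proof (induction rule: diffops.induct)
  case (comp D E)
  show ?case unfolding o_def by (rule clinear_comp[OF comp.IH])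
qed (intro clin clinear_mero_partial; assumption)+

lemma clinear_diffop_apply: "clinear (diffop_apply D)"
  by (rule clinear_diffops[OF diffop_apply])

lemmas [clin] = clinear_comp[OF clinear_diffop_apply]

lemma clinear_diffop_apply_op [clin]: "clinear f \<Longrightarrow> clinear (\<lambda>x. diffop_apply (f x) g)"
  by (simp add: clinear_def plus_diffop.rep_eq scaleC_diffop.rep_eq)

lemma diffop_eqI: "(\<And>g. diffop_apply D g = diffop_apply E g) \<Longrightarrow> D = E"
  by (metis diffop_apply_inject ext)

lemma diffop_apply_fun [simp]: "diffop_apply (diffop_fun f) g = f * g"
  by (simp add: diffop_fun_def Diffop_inverse diffops.mult)

lemma diffop_apply_partial [simp]: "diffop_apply (diffop_partial i) g = mero_partial i g"
  by (simp add: diffop_partial_def Diffop_inverse diffops.partial)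

lemma diffop_apply_comp [simp]: "diffop_apply (diffop_comp D E) g = diffop_apply D (diffop_apply E g)"
  by (simp add: diffop_comp.rep_eq)

lemmas diffop_apply_simps = plus_diffop.rep_eq minus_diffop.rep_eq zero_diffop.rep_eq
  scaleC_diffop.rep_eq

lemma cbilinear_diffop_comp: "cbilinear diffop_comp"
  by (intro cbilinearI clinearI diffop_eqI)
    (simp_all add: diffop_apply_simps clinear_plus[OF clinear_diffop_apply]
      clinear_scaleC[OF clinear_diffop_apply])

lemmas clinear_diffop_comp [clin] = clinear_comp[OF cbilinear_left[OF cbilinear_diffop_comp]]
  clinear_comp[OF cbilinear_right[OF cbilinear_diffop_comp]]

lemma diffop_comp_assoc: "diffop_comp (diffop_comp D E) G = diffop_comp D (diffop_comp E G)"
  by (rule diffop_eqI) simp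

lemma diffop_comp_one [simp]:
  "diffop_comp (diffop_fun 1) D = D" "diffop_comp D (diffop_fun 1) = D"
  by (rule diffop_eqI, simp)+

lemma diffop_comp_fun: "diffop_comp (diffop_fun f) (diffop_fun g) = diffop_fun (f * g)"
  by (rule diffop_eqI) (simp add: mult.assoc)

lemma diffop_partial_commute:
  "diffop_comp (diffop_partial i) (diffop_partial j) = diffop_comp (diffop_partial j) (diffop_partial i)"
  by (rule diffop_eqI) (simp add: mero_partial_commute)

lemma diffop_partial_fun:
  "diffop_comp (diffop_partial i) (diffop_fun f)
    = diffop_comp (diffop_fun f) (diffop_partial i) + diffop_fun (mero_partial i f)"
  by (rule diffop_eqI) (simp add: diffop_apply_simps mero_partial_mult add.commute)

lemma clinear_diffop_fun: "clinear diffop_fun"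
  by (intro clinearI diffop_eqI) (simp_all add: diffop_apply_simps algebra_simps mero_scaleC_mult)

lemmas [clin] = clinear_comp[OF clinear_diffop_fun]

section \<open>Bidifferential operators and the tensor square over the meromorphic functions\<close>

lemma bidiff_aux: "cbilinear (\<lambda>D E. diffop_apply D f * diffop_apply E g)"
  by (intro cbilinearI clin)

lemma bidiff_tens: "bidiff (D \<otimes> E) f g = diffop_apply D f * diffop_apply E g"
  by (simp add: bidiff_def tlift_tens[OF bidiff_aux])

lemma clinear_bidiff: "clinear (\<lambda>T. bidiff T f g)"
  unfolding bidiff_def by (rule clinear_tlift[OF bidiff_aux])

lemmas [clin] = clinear_comp[OF clinear_bidiff]

text \<open>The relations of the tensor product over the meromorphic functions, acting from the left
  on both factors; the counterpart of \<open>balance2\<close> for differential operators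
  alone.\<close>

definition diffop_balance :: "('n::finite diffop \<otimes> 'n diffop) set"
  where "diffop_balance = complex_vector.span
    {diffop_comp (diffop_fun f) D \<otimes> E - D \<otimes> diffop_comp (diffop_fun f) E | f D E. True}"

lemma diffop_balance_gen:
  "diffop_comp (diffop_fun f) D \<otimes> E - D \<otimes> diffop_comp (diffop_fun f) E \<in> diffop_balance"
  unfolding diffop_balance_def by (rule complex_vector.span_base) blast

lemma tensor_sum_list:
  obtains xs where "t = (\<Sum>(a, b)\<leftarrow>xs. a \<otimes> b)"
proof -
  have "\<exists>xs. t = (\<Sum>(a, b)\<leftarrow>xs. a \<otimes> b)"
  proof (induction t rule: tensor_induct)
    case zero
    show ?case by (rule exI[of _ "[]"]) simp
  next
    case (add x y)
    then obtain xs ys where "x = (\<Sum>(a, b)\<leftarrow>xs. a \<otimes> b)" "y = (\<Sum>(a, b)\<leftarrow>ys. a \<otimes> b)" by blast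
    then show ?case by (intro exI[of _ "xs @ ys"]) simp
  next
    case (tens a b)
    show ?case by (rule exI[of _ "[(a, b)]"]) simp
  qed
  with that show thesis by blast
qed

text \<open>Solving for one of the right-hand factors by means of a nonvanishing value of the
  corresponding left-hand factor shortens a vanishing sum of decomposable tensors.\<close>

lemma bidiff_sum_list_zero:
  fixes xs :: "('n::finite diffop \<times> 'n diffop) list"
  assumes "\<And>f g. bidiff (\<Sum>(D, E)\<leftarrow>xs. D \<otimes> E) f g = 0"
  shows "(\<Sum>(D, E)\<leftarrow>xs. D \<otimes> E) \<in> diffop_balance"
  using assms
proof (induction "length xs" arbitrary: xs)
  case 0
  then show ?case by (simp add: diffop_balance_def complex_vector.span_zero)
next
  case (Suc n)
  then obtain D0 E0 ys where xs: "xs = (D0, E0) # ys" "length ys = n"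
    by (cases xs) auto
  show ?case
  proof (cases "D0 = 0")
    case True
    then show ?thesis using Suc.hyps(1)[of ys] Suc.prems xs by (simp add: tens_zero_left)
  next
    case False
    then obtain f0 where "diffop_apply D0 f0 \<noteq> 0"
      using diffop_eqI[of D0 0] by (auto simp: zero_diffop.rep_eq)
    then obtain c where c: "diffop_apply D0 f0 * c = 1" by (rule mero_inverse)
    \<comment> \<open>Evaluating the vanishing bidifferential operator at f0 in the first argument
      and dividing by D0 f0 expresses E0 through the remaining right-hand factors;
      \<open>a D\<close> is the function that multiplies the factor belonging to D, up to
      sign.\<close>
    define a where "a D = diffop_fun (c * diffop_apply D f0)" for D
    have bid: "bidiff (\<Sum>(D, E)\<leftarrow>zs. D \<otimes> E) f g = (\<Sum>(D, E)\<leftarrow>zs. diffop_apply D f * diffop_apply E g)"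
      for zs :: "('n diffop \<times> 'n diffop) list" and f g
      by (induction zs)
        (auto simp: clinear_zero[OF clinear_bidiff] clinear_plus[OF clinear_bidiff] bidiff_tens)
    have E0: "E0 = - (\<Sum>(D, E)\<leftarrow>ys. diffop_comp (a D) E)"
    proof (rule diffop_eqI)
      fix g
      have "diffop_apply D0 f0 * diffop_apply E0 g
          = - (\<Sum>(D, E)\<leftarrow>ys. diffop_apply D f0 * diffop_apply E g)"
        using Suc.prems[of f0 g] bid[of ys f0 g]
        by (simp add: xs clinear_plus[OF clinear_bidiff] bidiff_tens add_eq_0_iff2)
      then have "c * (diffop_apply D0 f0 * diffop_apply E0 g)
          = - (c * (\<Sum>(D, E)\<leftarrow>ys. diffop_apply D f0 * diffop_apply E g))"
        by simp
      moreover have "c * (diffop_apply D0 f0 * diffop_apply E0 g) = diffop_apply E0 g"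
        using c by (metis mult.assoc mult.commute mult_1)
      moreover have "c * (\<Sum>(D, E)\<leftarrow>zs. diffop_apply D f0 * diffop_apply E g)
          = diffop_apply (\<Sum>(D, E)\<leftarrow>zs. diffop_comp (a D) E) g" for zs
        by (induction zs) (auto simp: diffop_apply_simps a_def algebra_simps)
      ultimately show "diffop_apply E0 g = diffop_apply (- (\<Sum>(D, E)\<leftarrow>ys. diffop_comp (a D) E)) g"
        by (simp add: uminus_diffop.rep_eq)
    qed
    \<comment> \<open>Inserting the expression for E0 and moving the functions \<open>a D\<close> to
      the left-hand factors absorbs D0 into the other terms. The result has one term less.\<close>
    define zs where "zs = map (\<lambda>(D, E). (D - diffop_comp (a D) D0, E)) ys"
    have "(\<Sum>(D, E)\<leftarrow>ys. diffop_comp (a D) D0 \<otimes> E) - D0 \<otimes> (\<Sum>(D, E)\<leftarrow>ys. diffop_comp (a D) E)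
        \<in> diffop_balance"
    proof (induction ys)
      case Nil
      then show ?case by (simp add: diffop_balance_def complex_vector.span_zero tens_zero_right)
    next
      case (Cons x ys)
      obtain D E where x: "x = (D, E)" by (cases x)
      have "(diffop_comp (a D) D0 \<otimes> E - D0 \<otimes> diffop_comp (a D) E) +
        ((\<Sum>(D, E)\<leftarrow>ys. diffop_comp (a D) D0 \<otimes> E) - D0 \<otimes> (\<Sum>(D, E)\<leftarrow>ys. diffop_comp (a D) E))
        \<in> diffop_balance"
        using Cons diffop_balance_gen[of "c * diffop_apply D f0" D0 E] unfolding diffop_balance_def a_def
        by (intro complex_vector.span_add)
      then show ?case by (simp add: x tens_add_right algebra_simps)
    qed
    moreover have "(\<Sum>(D, E)\<leftarrow>zs. D \<otimes> E)
        = (\<Sum>(D, E)\<leftarrow>ys. D \<otimes> E) - (\<Sum>(D, E)\<leftarrow>ys. diffop_comp (a D) D0 \<otimes> E)"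
      unfolding zs_def by (induction ys) (auto simp: tens_diff_left algebra_simps)
    moreover have "D0 \<otimes> E0 = - (D0 \<otimes> (\<Sum>(D, E)\<leftarrow>ys. diffop_comp (a D) E))"
      unfolding E0 using tens_diff_right[of D0 0] by (simp add: tens_zero_right)
    then have "(\<Sum>(D, E)\<leftarrow>xs. D \<otimes> E) - (\<Sum>(D, E)\<leftarrow>zs. D \<otimes> E)
        = (\<Sum>(D, E)\<leftarrow>ys. diffop_comp (a D) D0 \<otimes> E) - D0 \<otimes> (\<Sum>(D, E)\<leftarrow>ys. diffop_comp (a D) E)"
      unfolding calculation(2) by (simp add: xs)
    with calculation(1)
    have diff: "(\<Sum>(D, E)\<leftarrow>xs. D \<otimes> E) - (\<Sum>(D, E)\<leftarrow>zs. D \<otimes> E) \<in> diffop_balance"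
      by (simp only:)
    \<comment> \<open>The converse direction: balance relations induce the zero bidifferential
      operator, so the vanishing hypothesis passes from \<open>xs\<close> to the shorter list
      \<open>zs\<close>.\<close>
    have bal0: "bidiff t f g = 0" if "t \<in> diffop_balance" for t f g
      using that unfolding diffop_balance_def
    proof (induction rule: complex_vector.span_induct)
      case base
      then show ?case
        by (simp add: complex_vector.subspace_def clinear_zero[OF clinear_bidiff]
            clinear_plus[OF clinear_bidiff] clinear_scaleC[OF clinear_bidiff])
    next
      case (step x)
      then obtain k D E where x: "x = diffop_comp (diffop_fun k) D \<otimes> E - D \<otimes> diffop_comp (diffop_fun k) E"
        by blast
      show ?case unfolding x by (simp add: clinear_minus[OF clinear_bidiff] bidiff_tens algebra_simps)
    qed
    have "(\<Sum>(D, E)\<leftarrow>zs. D \<otimes> E) \<in> diffop_balance"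
    proof (rule Suc.hyps(1))
      show "n = length zs" by (simp add: zs_def xs)
      show "bidiff (\<Sum>(D, E)\<leftarrow>zs. D \<otimes> E) f g = 0" for f g
        using bal0[OF diff, of f g] Suc.prems[of f g] by (simp add: clinear_minus[OF clinear_bidiff])
    qed
    with diff show ?thesis
      unfolding diffop_balance_def using complex_vector.span_add by fastforce
  qed
qed

text \<open>As a consequence, any tensor that induces (f, g) \<mapsto> D (f * g) may replace the one
  picked in \<open>diffop_comul\<close>, up to the relations of the balanced tensor product.\<close>

lemma bidiff_eq_imp_balance:
  assumes "\<And>f g. bidiff S f g = bidiff T f g"
  shows "S - T \<in> diffop_balance"
proof -
  obtain xs where xs: "S - T = (\<Sum>(D, E)\<leftarrow>xs. D \<otimes> E)" by (rule tensor_sum_list)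
  show ?thesis
    unfolding xs
    by (rule bidiff_sum_list_zero) (simp add: assms clinear_minus[OF clinear_bidiff] flip: xs)
qed

definition diffop2_mul :: "('n::finite diffop \<otimes> 'n diffop) \<Rightarrow> ('n diffop \<otimes> 'n diffop) \<Rightarrow>
    ('n diffop \<otimes> 'n diffop)"
  where "diffop2_mul X Y =
    tlift (\<lambda>a b. tlift (\<lambda>c d. diffop_comp a c \<otimes> diffop_comp b d) Y) X"

lemma diffop2_mul_aux:
  "cbilinear (\<lambda>c d. diffop_comp a c \<otimes> diffop_comp b d)"
  "cbilinear (\<lambda>a b. tlift (\<lambda>c d. diffop_comp a c \<otimes> diffop_comp b d) Y)"
  by (intro cbilinearI clinear_tlift_fun clin)+

lemma cbilinear_diffop2_mul: "cbilinear diffop2_mul"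
  unfolding diffop2_mul_def[abs_def]
  using clinear_tlift[OF diffop2_mul_aux(1)] clinear_tlift[OF diffop2_mul_aux(2)]
  by (intro cbilinearI clinear_tlift_fun)

lemmas [clin] = clinear_comp[OF cbilinear_left[OF cbilinear_diffop2_mul]]
  clinear_comp[OF cbilinear_right[OF cbilinear_diffop2_mul]]

lemma diffop2_mul_tens: "diffop2_mul (a \<otimes> b) (c \<otimes> d) = diffop_comp a c \<otimes> diffop_comp b d"
  unfolding diffop2_mul_def
  by (subst tlift_tens[OF diffop2_mul_aux(2)]) (rule tlift_tens[OF diffop2_mul_aux(1)])

lemma bidiff_mul_tens:
  "bidiff (diffop2_mul X (c \<otimes> d)) f g = bidiff X (diffop_apply c f) (diffop_apply d g)"
  by (rule clinear_tensor_eq[where t = X], (intro clin)+) (simp add: diffop2_mul_tens bidiff_tens)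

text \<open>In the product the bidifferential operator of Y is applied first and D afterwards, so
  only the operator induced by Y matters. This is the reason why left multiplication by a coproduct
  descends to the balanced tensor product.\<close>

lemma bidiff_mul:
  assumes "\<And>f g. bidiff X f g = diffop_apply D (f * g)"
  shows "bidiff (diffop2_mul X Y) f g = diffop_apply D (bidiff Y f g)"
  by (rule clinear_tensor_eq[where t = Y], (intro clin)+) (simp add: bidiff_mul_tens bidiff_tens assms)

text \<open>Existence behind the choice in \<open>diffop_comul\<close>, by induction over the
  generation of \<open>diffops\<close>: the Leibniz rule handles partial derivatives, and
  \<open>bidiff_mul\<close> handles compositions.\<close>

lemma bidiff_diffop_comul: "bidiff (diffop_comul D) f g = diffop_apply D (f * g)"
proof -
  have "\<exists>T. \<forall>f g. bidiff T f g = D' (f * g)" if "D' \<in> diffops" for D' :: "'a mero \<Rightarrow> 'a mero"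
    using that
  proof (induction rule: diffops.induct)
    case (mult f)
    show ?case
      by (rule exI[of _ "diffop_fun f \<otimes> diffop_fun 1"]) (simp add: bidiff_tens mult.assoc)
  next
    case (partial i)
    show ?case
      by (rule exI[of _ "diffop_partial i \<otimes> diffop_fun 1 + diffop_fun 1 \<otimes> diffop_partial i"])
        (simp add: bidiff_tens clinear_plus[OF clinear_bidiff] mero_partial_mult)
  next
    case (add D E)
    then obtain S T where "\<forall>f g. bidiff S f g = D (f * g)" "\<forall>f g. bidiff T f g = E (f * g)" by blast
    then show ?case by (intro exI[of _ "S + T"]) (simp add: clinear_plus[OF clinear_bidiff])
  next
    case (comp D E)
    then obtain S T where "\<forall>f g. bidiff S f g = D (f * g)" "\<forall>f g. bidiff T f g = E (f * g)" by blast
    then show ?case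
      using bidiff_mul[of S "Diffop D" T] comp.hyps
      by (intro exI[of _ "diffop2_mul S T"]) (simp add: Diffop_inverse)
  qed
  then have "\<exists>T. \<forall>f g. bidiff T f g = diffop_apply D (f * g)"
    using diffop_apply by blast
  then show ?thesis unfolding diffop_comul_def by (rule someI2_ex) simp
qed

section \<open>The Hopf algebroid\<close>

lemma hlinear_kernel:
  assumes "hlinear T" "\<And>n. T (fps_const (fps_nth Z n)) = 0"
  shows "T Z = 0"
  using hlinear_hseries[OF assms(1), of "\<lambda>n. fps_const (fps_nth Z n)"]
  by (simp add: hseries_fps_const assms(2) fps_eq_iff hseries_nth)

text \<open>The mixed form suits elements D \<otimes> u of H: operators D enter as constants, while
  products in the quantum algebra force u to be a series.\<close>

lemma hlinear_eq_const_tens: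
  assumes "hlinear S" "hlinear T" "\<And>a y. S (fps_const a \<otimes>\<^sub>h y) = T (fps_const a \<otimes>\<^sub>h y)"
  shows "S z = T z"
proof (rule hlinear_eq_tens[OF assms(1,2)])
  fix x y
  show "S (x \<otimes>\<^sub>h y) = T (x \<otimes>\<^sub>h y)"
    by (rule hlinear_eq_const[where x = x], (intro hlin hlinear_comp[OF assms(1)] hlinear_comp[OF assms(2)])+,
        rule assms(3))
qed

lemma hlinear_htensor_map_comp [hlin]:
  "hlinear f \<Longrightarrow> hlinear g \<Longrightarrow> hlinear k \<Longrightarrow> hlinear (\<lambda>x. (f \<boxtimes> g) (k x))"
  by (rule hlinear_comp[OF hlinear_htensor_map])

lemma clinear_abs_hh: "clinear abs_hh"
  by (rule clinearI) (simp_all add: plus_hh.abs_eq scaleC_hh.abs_eq)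

lemma clinear_abs_hhh: "clinear abs_hhh"
  by (rule clinearI) (simp_all add: plus_hhh.abs_eq scaleC_hhh.abs_eq)

lemmas [hlin] = hlinear_comp[OF hlinear_hmap[OF clinear_abs_hh]]
  hlinear_comp[OF hlinear_hmap[OF clinear_abs_hhh]]

lemma to_HH_rep: "to_HH (HH_rep Z) = Z"
  by (simp add: fps_eq_iff hmap_nth Quotient_abs_rep[OF Quotient_hh])

lemma hbilinear_diffop: "hbilinear (hcauchy diffop_comp)"
  by (rule hbilinear_hcauchy[OF cbilinear_diffop_comp])

lemmas diffop_fps_const = hcauchy_fps_const[OF cbilinear_diffop_comp]

lemmas hlinear_diffop [hlin] = hbilinear_left[OF hbilinear_diffop] hbilinear_right[OF hbilinear_diffop]

lemma hcauchy_diffop_assoc: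
  "hcauchy diffop_comp (hcauchy diffop_comp x y) z = hcauchy diffop_comp x (hcauchy diffop_comp y z)"
  by (rule hcauchy_assoc[OF cbilinear_diffop_comp diffop_comp_assoc])

lemma hcauchy_diffop_one [simp]:
  "hcauchy diffop_comp (fps_const (diffop_fun 1)) x = x"
  "hcauchy diffop_comp x (fps_const (diffop_fun 1)) = x"
  by (rule hlinear_eq_const[where x = x], (intro hlin)+, simp add: diffop_fps_const)+

definition HHH_mul :: "'u::complex_vector hopf \<Rightarrow>
    (('n::finite, 'u) hd \<otimes> ('n, 'u) hd \<otimes> ('n, 'u) hd) fps \<Rightarrow>
    (('n, 'u) hd \<otimes> ('n, 'u) hd \<otimes> ('n, 'u) hd) fps \<Rightarrow> (('n, 'u) hd \<otimes> ('n, 'u) hd \<otimes> ('n, 'u) hd) fps"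
  where "HHH_mul A = H_mul A \<boxtimes>\<^sub>m HH_mul A"

definition H_fun :: "'u::complex_vector hopf \<Rightarrow> 'n::finite mero fps \<Rightarrow> ('n, 'u) hd fps"
  where "H_fun A \<phi> = hmap diffop_fun \<phi> \<otimes>\<^sub>h hone A"

definition H_partial :: "'u::complex_vector hopf \<Rightarrow> 'n::finite \<Rightarrow> ('n, 'u) hd fps"
  where "H_partial A i = fps_const (diffop_partial i) \<otimes>\<^sub>h hone A"

definition H_in :: "'u::complex_vector fps \<Rightarrow> ('n::finite, 'u) hd fps"
  where "H_in u = fps_const (diffop_fun 1) \<otimes>\<^sub>h u"

lemmas [hlin] = hlinear_comp[OF hlinear_hmap[OF clinear_diffop_fun]]

lemma hlinear_H_fun [hlin]: "hlinear f \<Longrightarrow> hlinear (\<lambda>x. H_fun A (f x))"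
  unfolding H_fun_def by (intro hlin)

lemma hlinear_H_in [hlin]: "hlinear f \<Longrightarrow> hlinear (\<lambda>x. H_in (f x))"
  unfolding H_in_def by (intro hlin)

lemma H_in_one: "H_in (hone A) = H_one A"
  by (simp add: H_in_def H_one_def)

lemma hmap_diffop_fun_const: "hmap diffop_fun (fps_const f) = fps_const (diffop_fun f)"
  by (rule hmap_fps_const[OF clinear_diffop_fun])

lemma H_fun_one: "H_fun A 1 = H_one A"
  by (simp add: H_fun_def H_one_def hmap_diffop_fun_const flip: fps_const_1_eq_1)

text \<open>The element \<open>\<Sum> (D\<^sub>i \<otimes> u\<^sub>j) \<otimes> (E\<^sub>i \<otimes> v\<^sub>j)\<close> for \<open>T = \<Sum> D\<^sub>i \<otimes> E\<^sub>i\<close> and \<open>t = \<Sum> u\<^sub>j \<otimes> v\<^sub>j\<close>.\<close>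

definition HH_mix :: "('n::finite diffop \<otimes> 'n diffop) \<Rightarrow> ('u::complex_vector \<otimes> 'u) fps \<Rightarrow>
    (('n, 'u) hd \<otimes> ('n, 'u) hd) fps"
  where "HH_mix T t = hmap tinterchange (fps_const T \<otimes>\<^sub>h t)"

lemma hlinear_HH_mix [hlin]: "hlinear f \<Longrightarrow> hlinear (\<lambda>x. HH_mix T (f x))"
  unfolding HH_mix_def by (intro hlin)

lemma clinear_HH_mix: "clinear (\<lambda>T. HH_mix T t)"
  unfolding HH_mix_def by (rule clinear_comp[OF hlinear_imp_clinear clinear_fps_const]) (intro hlin)

lemma HH_mix_tens: "HH_mix (D \<otimes> E) (u \<otimes>\<^sub>h v) = (fps_const D \<otimes>\<^sub>h u) \<otimes>\<^sub>h (fps_const E \<otimes>\<^sub>h v)"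
  by (simp add: HH_mix_def fps_const_tens hinterchange_htens)

locale hopf_ops =
  fixes A :: "'u::complex_vector hopf"
  assumes hopf: "topological_hopf_algebra A"
begin

lemma hbilinear_hmul: "hbilinear (hmul A)"
  and hmul_assoc: "hmul A (hmul A x y) z = hmul A x (hmul A y z)"
  and hmul_one [simp]: "hmul A (hone A) x = x" "hmul A x (hone A) = x"
  and hlinear_comul: "hlinear (hcomul A)"
  and hlinear_counit: "hlinear (hcounit A)"
  and counit_id_comul: "counit_id A (hcomul A x) = x"
  and comul_mult: "hcomul A (hmul A x y) = hmul2 A (hcomul A x) (hcomul A y)"
  and comul_one: "hcomul A (hone A) = hone A \<otimes>\<^sub>h hone A"
  and counit_mult: "hcounit A (hmul A x y) = hcounit A x * hcounit A y"
  and counit_one: "hcounit A (hone A) = 1"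
  using hopf unfolding topological_hopf_algebra_def by blast+

lemmas hlinear_hmul [hlin] = hbilinear_left[OF hbilinear_hmul] hbilinear_right[OF hbilinear_hmul]
lemmas hlinear_comul_comp [hlin] = hlinear_comp[OF hlinear_comul]
lemmas hlinear_counit_comp [hlin] = hlinear_comp[OF hlinear_counit]

lemma hbilinear_hmul2: "hbilinear (hmul2 A)"
  and hbilinear_hmul3: "hbilinear (hmul3 A)"
  and hbilinear_H_mul: "hbilinear (H_mul A)"
  and hbilinear_HH_mul: "hbilinear (HH_mul A)"
  and hbilinear_HHH_mul: "hbilinear (HHH_mul A)"
  unfolding HHH_mul_def HH_mul_def H_mul_def
  by (intro hbilinear_htensor_mult hbilinear_hmul hbilinear_diffop)+

lemmas hlinear_hmul2 [hlin] = hbilinear_left[OF hbilinear_hmul2] hbilinear_right[OF hbilinear_hmul2]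
lemmas hlinear_hmul3 [hlin] = hbilinear_left[OF hbilinear_hmul3] hbilinear_right[OF hbilinear_hmul3]
lemmas hlinear_H_mul [hlin] = hbilinear_left[OF hbilinear_H_mul] hbilinear_right[OF hbilinear_H_mul]
lemmas hlinear_HH_mul [hlin] = hbilinear_left[OF hbilinear_HH_mul] hbilinear_right[OF hbilinear_HH_mul]
lemmas hlinear_HHH_mul [hlin] = hbilinear_left[OF hbilinear_HHH_mul] hbilinear_right[OF hbilinear_HHH_mul]

lemma hmul2_tens: "hmul2 A (x \<otimes>\<^sub>h y) (z \<otimes>\<^sub>h w) = hmul A x z \<otimes>\<^sub>h hmul A y w"
  by (rule htensor_mult_htens[OF hbilinear_hmul hbilinear_hmul])

lemma hmul3_tens: "hmul3 A (x \<otimes>\<^sub>h y) (z \<otimes>\<^sub>h w) = hmul A x z \<otimes>\<^sub>h hmul2 A y w"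
  by (rule htensor_mult_htens[OF hbilinear_hmul hbilinear_hmul2])

lemma H_mul_tens: "H_mul A (x \<otimes>\<^sub>h y) (z \<otimes>\<^sub>h w) = hcauchy diffop_comp x z \<otimes>\<^sub>h hmul A y w"
  unfolding H_mul_def by (rule htensor_mult_htens[OF hbilinear_diffop hbilinear_hmul])

lemma HH_mul_tens: "HH_mul A (x \<otimes>\<^sub>h y) (z \<otimes>\<^sub>h w) = H_mul A x z \<otimes>\<^sub>h H_mul A y w"
  unfolding HH_mul_def by (rule htensor_mult_htens[OF hbilinear_H_mul hbilinear_H_mul])

lemma HHH_mul_tens: "HHH_mul A (x \<otimes>\<^sub>h y) (z \<otimes>\<^sub>h w) = H_mul A x z \<otimes>\<^sub>h HH_mul A y w"
  unfolding HHH_mul_def by (rule htensor_mult_htens[OF hbilinear_H_mul hbilinear_HH_mul])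

lemmas mul_tens = hmul2_tens hmul3_tens H_mul_tens HH_mul_tens HHH_mul_tens

lemma hmul2_assoc: "hmul2 A (hmul2 A x y) z = hmul2 A x (hmul2 A y z)"
  by (rule htensor_mult_assoc[OF hbilinear_hmul hbilinear_hmul hmul_assoc hmul_assoc])

lemma hmul3_assoc: "hmul3 A (hmul3 A x y) z = hmul3 A x (hmul3 A y z)"
  by (rule htensor_mult_assoc[OF hbilinear_hmul hbilinear_hmul2 hmul_assoc hmul2_assoc])

lemma H_mul_assoc: "H_mul A (H_mul A x y) z = H_mul A x (H_mul A y z)"
  unfolding H_mul_def
  by (rule htensor_mult_assoc[OF hbilinear_diffop hbilinear_hmul hcauchy_diffop_assoc hmul_assoc])

lemma HH_mul_assoc: "HH_mul A (HH_mul A x y) z = HH_mul A x (HH_mul A y z)"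
  unfolding HH_mul_def
  by (rule htensor_mult_assoc[OF hbilinear_H_mul hbilinear_H_mul H_mul_assoc H_mul_assoc])

lemma HHH_mul_assoc: "HHH_mul A (HHH_mul A x y) z = HHH_mul A x (HHH_mul A y z)"
  unfolding HHH_mul_def
  by (rule htensor_mult_assoc[OF hbilinear_H_mul hbilinear_HH_mul H_mul_assoc HH_mul_assoc])

lemma hmul2_one [simp]: "hmul2 A (hone A \<otimes>\<^sub>h hone A) x = x" "hmul2 A x (hone A \<otimes>\<^sub>h hone A) = x"
  by (rule htensor_mult_one_left[OF hbilinear_hmul hbilinear_hmul]
      htensor_mult_one_right[OF hbilinear_hmul hbilinear_hmul]; simp)+

lemma H_mul_one [simp]: "H_mul A (H_one A) x = x" "H_mul A x (H_one A) = x"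
  unfolding H_mul_def H_one_def
  by (rule htensor_mult_one_left[OF hbilinear_diffop hbilinear_hmul]
      htensor_mult_one_right[OF hbilinear_diffop hbilinear_hmul]; simp)+

lemma HH_mul_one [simp]: "HH_mul A (H_one A \<otimes>\<^sub>h H_one A) x = x" "HH_mul A x (H_one A \<otimes>\<^sub>h H_one A) = x"
  unfolding HH_mul_def
  by (rule htensor_mult_one_left[OF hbilinear_H_mul hbilinear_H_mul]
      htensor_mult_one_right[OF hbilinear_H_mul hbilinear_H_mul]; simp)+

lemma HHH_mul_hassoc:
  "HHH_mul A (hassoc (X \<otimes>\<^sub>h y)) (hassoc (Z \<otimes>\<^sub>h w)) = hassoc (HH_mul A X Z \<otimes>\<^sub>h H_mul A y w)"
  by (rule hbilinear_eq_tens[where X = X and Y = Z], (intro hbilinearI hlin)+)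
    (simp add: hassoc_htens mul_tens)

lemma H_fun_mul: "H_mul A (H_fun A (fps_const f)) (fps_const D \<otimes>\<^sub>h u) = fps_const (diffop_comp (diffop_fun f) D) \<otimes>\<^sub>h u"
  by (simp add: H_fun_def hmap_diffop_fun_const mul_tens diffop_fps_const)

lemma hd_act_eq: "fps_const (hd_act f a) = H_mul A (H_fun A (fps_const f)) (fps_const a)"
proof (rule clinear_tensor_eq[where t = a])
  have c: "clinear (diffop_comp (diffop_fun f))" by (rule cbilinear_right[OF cbilinear_diffop_comp])
  show "clinear (\<lambda>a. fps_const (hd_act f a))"
    unfolding hd_act_def by (rule clinear_comp[OF clinear_fps_const clinear_tmap[OF c clinear_id(2)]])
  show "clinear (\<lambda>a. H_mul A (H_fun A (fps_const f)) (fps_const a))"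
    by (rule clinear_comp[OF hlinear_imp_clinear clinear_fps_const]) (intro hlin)
  show "fps_const (hd_act f (D \<otimes> u)) = H_mul A (H_fun A (fps_const f)) (fps_const (D \<otimes> u))" for D u
    by (simp add: hd_act_def tmap_tens[OF c clinear_id(2)] fps_const_tens H_fun_mul)
qed

lemma to_HH_balance:
  "to_HH (H_mul A (H_fun A \<phi>) x \<otimes>\<^sub>h y) = to_HH (x \<otimes>\<^sub>h H_mul A (H_fun A \<phi>) y)"
proof -
  have 1: "to_HH (H_mul A (H_fun A (fps_const f)) (fps_const a) \<otimes>\<^sub>h fps_const b)
      = to_HH (fps_const a \<otimes>\<^sub>h H_mul A (H_fun A (fps_const f)) (fps_const b))" for f and a b :: "('a, 'u) hd"
  proof -
    have "hd_act f a \<otimes> b - a \<otimes> hd_act f b \<in> balance2"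
      unfolding balance2_def by (rule complex_vector.span_base) blast
    then have "abs_hh (hd_act f a \<otimes> b) = abs_hh (a \<otimes> hd_act f b)"
      by (simp add: hh.abs_eq_iff)
    then show ?thesis
      by (simp add: hmap_fps_const clinear_abs_hh flip: hd_act_eq fps_const_tens)
  qed
  have 2: "to_HH (H_mul A (H_fun A (fps_const f)) x \<otimes>\<^sub>h y)
      = to_HH (x \<otimes>\<^sub>h H_mul A (H_fun A (fps_const f)) y)" for f
    by (rule hbilinear_eq_const[where x = x and y = y], (intro hbilinearI hlin)+, rule 1)
  show ?thesis by (rule hlinear_eq_const[where x = \<phi>], (intro hlin)+, rule 2)
qed

lemma to_HHH_balance:
  "to_HHH (H_mul A (H_fun A \<phi>) x \<otimes>\<^sub>h y \<otimes>\<^sub>h z) = to_HHH (x \<otimes>\<^sub>h H_mul A (H_fun A \<phi>) y \<otimes>\<^sub>h z)" (is ?L)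
  "to_HHH (x \<otimes>\<^sub>h H_mul A (H_fun A \<phi>) y \<otimes>\<^sub>h z) = to_HHH (x \<otimes>\<^sub>h y \<otimes>\<^sub>h H_mul A (H_fun A \<phi>) z)" (is ?R)
proof -
  have 1: "to_HHH (H_mul A (H_fun A (fps_const f)) (fps_const a) \<otimes>\<^sub>h fps_const b \<otimes>\<^sub>h fps_const c)
      = to_HHH (fps_const a \<otimes>\<^sub>h H_mul A (H_fun A (fps_const f)) (fps_const b) \<otimes>\<^sub>h fps_const c)"
    "to_HHH (fps_const a \<otimes>\<^sub>h H_mul A (H_fun A (fps_const f)) (fps_const b) \<otimes>\<^sub>h fps_const c)
      = to_HHH (fps_const a \<otimes>\<^sub>h fps_const b \<otimes>\<^sub>h H_mul A (H_fun A (fps_const f)) (fps_const c))"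
    for f and a b c :: "('a, 'u) hd"
  proof -
    have "hd_act f a \<otimes> b \<otimes> c - a \<otimes> hd_act f b \<otimes> c \<in> balance3"
      "a \<otimes> hd_act f b \<otimes> c - a \<otimes> b \<otimes> hd_act f c \<in> balance3"
      unfolding balance3_def by (rule complex_vector.span_base; blast)+
    then have "abs_hhh (hd_act f a \<otimes> b \<otimes> c) = abs_hhh (a \<otimes> hd_act f b \<otimes> c)"
      "abs_hhh (a \<otimes> hd_act f b \<otimes> c) = abs_hhh (a \<otimes> b \<otimes> hd_act f c)"
      by (simp_all add: hhh.abs_eq_iff)
    then show "to_HHH (H_mul A (H_fun A (fps_const f)) (fps_const a) \<otimes>\<^sub>h fps_const b \<otimes>\<^sub>h fps_const c)
      = to_HHH (fps_const a \<otimes>\<^sub>h H_mul A (H_fun A (fps_const f)) (fps_const b) \<otimes>\<^sub>h fps_const c)"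
    "to_HHH (fps_const a \<otimes>\<^sub>h H_mul A (H_fun A (fps_const f)) (fps_const b) \<otimes>\<^sub>h fps_const c)
      = to_HHH (fps_const a \<otimes>\<^sub>h fps_const b \<otimes>\<^sub>h H_mul A (H_fun A (fps_const f)) (fps_const c))"
      by (simp_all add: hmap_fps_const clinear_abs_hhh flip: hd_act_eq fps_const_tens)
  qed
  have 2: "to_HHH (H_mul A (H_fun A (fps_const f)) (fps_const a) \<otimes>\<^sub>h y \<otimes>\<^sub>h z)
      = to_HHH (fps_const a \<otimes>\<^sub>h H_mul A (H_fun A (fps_const f)) y \<otimes>\<^sub>h z)"
    "to_HHH (fps_const a \<otimes>\<^sub>h H_mul A (H_fun A (fps_const f)) y \<otimes>\<^sub>h z)
      = to_HHH (fps_const a \<otimes>\<^sub>h y \<otimes>\<^sub>h H_mul A (H_fun A (fps_const f)) z)"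
    for f and a :: "('a, 'u) hd"
    by (rule hbilinear_eq_const[where x = y and y = z], (intro hbilinearI hlin)+, rule 1)+
  have 3: "to_HHH (H_mul A (H_fun A \<phi>) (fps_const a) \<otimes>\<^sub>h y \<otimes>\<^sub>h z)
      = to_HHH (fps_const a \<otimes>\<^sub>h H_mul A (H_fun A \<phi>) y \<otimes>\<^sub>h z)"
    "to_HHH (fps_const a \<otimes>\<^sub>h H_mul A (H_fun A \<phi>) y \<otimes>\<^sub>h z)
      = to_HHH (fps_const a \<otimes>\<^sub>h y \<otimes>\<^sub>h H_mul A (H_fun A \<phi>) z)" for a :: "('a, 'u) hd"
    by (rule hlinear_eq_const[where x = \<phi>], (intro hlin)+, rule 2)+
  show ?L ?R by (rule hlinear_eq_const[where x = x], (intro hlin)+, rule 3)+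
qed

text \<open>A function may change its tensor factor as long as it stands leftmost, whatever Y is. In
  this form the relations are visibly compatible with right multiplication.\<close>

lemma to_HH_fun_mul:
  "to_HH (HH_mul A (H_fun A \<phi> \<otimes>\<^sub>h H_one A) Y) = to_HH (HH_mul A (H_one A \<otimes>\<^sub>h H_fun A \<phi>) Y)"
  by (rule hlinear_eq_tens[where z = Y], (intro hlin)+, simp add: mul_tens to_HH_balance)

lemma to_HHH_fun_mul:
  "to_HHH (HHH_mul A (H_fun A \<phi> \<otimes>\<^sub>h H_one A \<otimes>\<^sub>h H_one A) Y)
    = to_HHH (HHH_mul A (H_one A \<otimes>\<^sub>h H_fun A \<phi> \<otimes>\<^sub>h H_one A) Y)" (is ?L)
  "to_HHH (HHH_mul A (H_one A \<otimes>\<^sub>h H_fun A \<phi> \<otimes>\<^sub>h H_one A) Y)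
    = to_HHH (HHH_mul A (H_one A \<otimes>\<^sub>h H_one A \<otimes>\<^sub>h H_fun A \<phi>) Y)" (is ?R)
proof -
  have *: "to_HHH (HHH_mul A (H_fun A \<phi> \<otimes>\<^sub>h H_one A \<otimes>\<^sub>h H_one A) (x \<otimes>\<^sub>h Z))
    = to_HHH (HHH_mul A (H_one A \<otimes>\<^sub>h H_fun A \<phi> \<otimes>\<^sub>h H_one A) (x \<otimes>\<^sub>h Z))"
    "to_HHH (HHH_mul A (H_one A \<otimes>\<^sub>h H_fun A \<phi> \<otimes>\<^sub>h H_one A) (x \<otimes>\<^sub>h Z))
    = to_HHH (HHH_mul A (H_one A \<otimes>\<^sub>h H_one A \<otimes>\<^sub>h H_fun A \<phi>) (x \<otimes>\<^sub>h Z))" for x and Z :: "(('a, 'u) hd \<otimes> ('a, 'u) hd) fps"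
    by (rule hlinear_eq_tens[where z = Z], (intro hlin)+, simp add: mul_tens to_HHH_balance)+
  show ?L ?R by (rule hlinear_eq_tens[where z = Y], (intro hlin)+, rule *)+
qed

text \<open>The universal property of the balanced tensor product: the kernel of
  \<open>to_HH\<close> is spanned, coefficient by coefficient, by the balance relations, and T kills
  these.\<close>

lemma to_HH_cong:
  assumes T: "hlinear T" and bal: "\<And>f x y. T (H_mul A (H_fun A (fps_const f)) x \<otimes>\<^sub>h y)
      = T (x \<otimes>\<^sub>h H_mul A (H_fun A (fps_const f)) y)"
    and eq: "to_HH X = to_HH Y"
  shows "T X = T Y"
proof -
  have c: "clinear (\<lambda>a. T (fps_const a))"
    by (rule clinear_comp[OF hlinear_imp_clinear[OF T] clinear_fps_const])
  have zero: "T (fps_const b) = 0" if "b \<in> balance2" for b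
    using that unfolding balance2_def
  proof (induction rule: complex_vector.span_induct)
    case base
    show ?case
      using clinear_plus[OF c] clinear_scaleC[OF c] clinear_zero[OF c]
      by (simp add: complex_vector.subspace_def)
  next
    case (step b)
    then obtain f x y where b: "b = hd_act f x \<otimes> y - x \<otimes> hd_act f y" by blast
    show ?case unfolding b clinear_minus[OF c] by (simp add: fps_const_tens hd_act_eq bal)
  qed
  have "T (X - Y) = 0"
  proof (rule hlinear_kernel[OF T])
    fix n
    have "abs_hh (fps_nth X n) = abs_hh (fps_nth Y n)" using eq by (simp add: fps_eq_iff hmap_nth)
    then show "T (fps_const (fps_nth (X - Y) n)) = 0" by (intro zero) (simp add: hh.abs_eq_iff)
  qed
  then show ?thesis by (simp add: hlinear_minus[OF T])
qed

lemma to_HHH_cong: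
  assumes T: "hlinear T"
    and bal: "\<And>f x y z. T (H_mul A (H_fun A (fps_const f)) x \<otimes>\<^sub>h y \<otimes>\<^sub>h z)
      = T (x \<otimes>\<^sub>h H_mul A (H_fun A (fps_const f)) y \<otimes>\<^sub>h z)"
      "\<And>f x y z. T (x \<otimes>\<^sub>h H_mul A (H_fun A (fps_const f)) y \<otimes>\<^sub>h z)
      = T (x \<otimes>\<^sub>h y \<otimes>\<^sub>h H_mul A (H_fun A (fps_const f)) z)"
    and eq: "to_HHH X = to_HHH Y"
  shows "T X = T Y"
proof -
  have c: "clinear (\<lambda>a. T (fps_const a))"
    by (rule clinear_comp[OF hlinear_imp_clinear[OF T] clinear_fps_const])
  have zero: "T (fps_const b) = 0" if "b \<in> balance3" for b
    using that unfolding balance3_def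
  proof (induction rule: complex_vector.span_induct)
    case base
    show ?case
      using clinear_plus[OF c] clinear_scaleC[OF c] clinear_zero[OF c]
      by (simp add: complex_vector.subspace_def)
  next
    case (step b)
    then consider f x y z where "b = hd_act f x \<otimes> y \<otimes> z - x \<otimes> hd_act f y \<otimes> z"
      | f x y z where "b = x \<otimes> hd_act f y \<otimes> z - x \<otimes> y \<otimes> hd_act f z" by blast
    then show ?case
    proof cases
      case 1
      show ?thesis unfolding 1 clinear_minus[OF c] by (simp add: fps_const_tens hd_act_eq bal(1))
    next
      case 2
      show ?thesis unfolding 2 clinear_minus[OF c] by (simp add: fps_const_tens hd_act_eq bal(2))
    qed
  qed
  have "T (X - Y) = 0"
  proof (rule hlinear_kernel[OF T])
    fix n
    have "abs_hhh (fps_nth X n) = abs_hhh (fps_nth Y n)" using eq by (simp add: fps_eq_iff hmap_nth)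
    then show "T (fps_const (fps_nth (X - Y) n)) = 0" by (intro zero) (simp add: hhh.abs_eq_iff)
  qed
  then show ?thesis by (simp add: hlinear_minus[OF T])
qed

lemma HH_rep_cong:
  assumes "hlinear T" "\<And>f x y. T (H_mul A (H_fun A (fps_const f)) x \<otimes>\<^sub>h y)
      = T (x \<otimes>\<^sub>h H_mul A (H_fun A (fps_const f)) y)"
  shows "T (HH_rep (to_HH X)) = T X"
  by (rule to_HH_cong[OF assms to_HH_rep])

text \<open>The choice \<open>rep_hh\<close> need not be additive, but a map T that respects the
  balance relations does not see which representative was chosen.\<close>

lemma hlinear_HH_rep:
  assumes T: "hlinear T" and bal: "\<And>f x y. T (H_mul A (H_fun A (fps_const f)) x \<otimes>\<^sub>h y)
      = T (x \<otimes>\<^sub>h H_mul A (H_fun A (fps_const f)) y)"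
    and f: "hlinear f"
  shows "hlinear (\<lambda>x. T (HH_rep (f x)))"
proof -
  have lin: "hlinear (\<lambda>X. to_HH X :: ('a, 'u) hh fps)" by (intro hlin)
  have "hlinear (\<lambda>Z. T (HH_rep Z))"
  proof (rule hlinearI)
    fix x y :: "('a, 'u) hh fps" and c
    show "T (HH_rep (x + y)) = T (HH_rep x) + T (HH_rep y)"
      by (subst hlinear_plus[OF T, symmetric], rule to_HH_cong[OF T bal])
        (simp add: hlinear_plus[OF lin] to_HH_rep)
    show "T (HH_rep (hscale c x)) = hscale c (T (HH_rep x))"
      by (subst hlinear_hscale[OF T, symmetric], rule to_HH_cong[OF T bal])
        (simp add: hlinear_hscale[OF lin] to_HH_rep)
  qed
  from hlinear_comp[OF this f] show ?thesis .
qed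

text \<open>Up to the order of the factors, H \<otimes> H is the tensor product of two algebras, the
  tensor squares of the differential operators and of the quantum algebra. Coproducts in H are of
  the mixed form, so this computes their products.\<close>

lemma HH_mix_mul: "HH_mul A (HH_mix S s) (HH_mix T t) = HH_mix (diffop2_mul S T) (hmul2 A s t)"
proof -
  have lin: "clinear (\<lambda>S. HH_mul A (HH_mix S s) (HH_mix T t))" "clinear (\<lambda>T. HH_mul A (HH_mix S s) (HH_mix T t))"
    "clinear (\<lambda>S. HH_mix (diffop2_mul S T) (hmul2 A s t))" "clinear (\<lambda>T. HH_mix (diffop2_mul S T) (hmul2 A s t))"
    for S T s t
    by (rule clinear_comp[OF hlinear_imp_clinear clinear_HH_mix] clinear_comp[OF clinear_HH_mix]; intro hlin clin)+
  have 1: "HH_mul A (HH_mix (a \<otimes> b) (x \<otimes>\<^sub>h y)) (HH_mix (c \<otimes> d) (z \<otimes>\<^sub>h w))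
      = HH_mix (diffop2_mul (a \<otimes> b) (c \<otimes> d)) (hmul2 A (x \<otimes>\<^sub>h y) (z \<otimes>\<^sub>h w))" for a b c d x y z w
    by (simp add: HH_mix_tens mul_tens diffop2_mul_tens diffop_fps_const)
  have 2: "HH_mul A (HH_mix (a \<otimes> b) (x \<otimes>\<^sub>h y)) (HH_mix (c \<otimes> d) t)
      = HH_mix (diffop2_mul (a \<otimes> b) (c \<otimes> d)) (hmul2 A (x \<otimes>\<^sub>h y) t)" for a b c d x y
    by (rule hlinear_eq_tens[where z = t], (intro hlin)+, rule 1)
  have 3: "HH_mul A (HH_mix (a \<otimes> b) s) (HH_mix (c \<otimes> d) t)
      = HH_mix (diffop2_mul (a \<otimes> b) (c \<otimes> d)) (hmul2 A s t)" for a b c d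
    by (rule hlinear_eq_tens[where z = s], (intro hlin)+, rule 2)
  have 4: "HH_mul A (HH_mix (a \<otimes> b) s) (HH_mix T t) = HH_mix (diffop2_mul (a \<otimes> b) T) (hmul2 A s t)" for a b
    by (rule clinear_tensor_eq[where t = T, OF lin(2,4)], rule 3)
  show ?thesis by (rule clinear_tensor_eq[where t = S, OF lin(1,3)], rule 4)
qed

text \<open>The link between operators and classes in H: by \<open>bidiff_eq_imp_balance\<close> the
  difference of S and T consists of balance relations, and these become balance relations of H when
  mixed with t.\<close>

lemma to_HH_mix_cong:
  assumes "\<And>f g. bidiff S f g = bidiff T f g"
  shows "to_HH (HH_mix S t) = to_HH (HH_mix T (t :: ('u \<otimes> 'u) fps))"
proof -
  have c: "clinear (\<lambda>T :: 'a diffop \<otimes> 'a diffop. to_HH (HH_mix T t))" for t :: "('u \<otimes> 'u) fps"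
    by (rule clinear_comp[OF hlinear_imp_clinear clinear_HH_mix]) (intro hlin)
  have gen: "to_HH (HH_mix (diffop_comp (diffop_fun f) D \<otimes> E) t)
      = to_HH (HH_mix (D \<otimes> diffop_comp (diffop_fun f) E) t)" for f and D E :: "'a diffop"
  proof (rule hlinear_eq_tens[where z = t], (intro hlin)+)
    fix u v :: "'u fps"
    have "HH_mix (diffop_comp (diffop_fun f) D \<otimes> E) (u \<otimes>\<^sub>h v)
        = H_mul A (H_fun A (fps_const f)) (fps_const D \<otimes>\<^sub>h u) \<otimes>\<^sub>h (fps_const E \<otimes>\<^sub>h v)"
      "HH_mix (D \<otimes> diffop_comp (diffop_fun f) E) (u \<otimes>\<^sub>h v)
        = (fps_const D \<otimes>\<^sub>h u) \<otimes>\<^sub>h H_mul A (H_fun A (fps_const f)) (fps_const E \<otimes>\<^sub>h v)"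
      by (simp_all add: HH_mix_tens H_fun_mul)
    then show "to_HH (HH_mix (diffop_comp (diffop_fun f) D \<otimes> E) (u \<otimes>\<^sub>h v))
        = to_HH (HH_mix (D \<otimes> diffop_comp (diffop_fun f) E) (u \<otimes>\<^sub>h v))"
      by (simp add: to_HH_balance)
  qed
  have "to_HH (HH_mix b t) = 0" if "b \<in> diffop_balance" for b :: "'a diffop \<otimes> 'a diffop"
    using that unfolding diffop_balance_def
  proof (induction rule: complex_vector.span_induct)
    case base
    show ?case
      using clinear_plus[OF c] clinear_scaleC[OF c] clinear_zero[OF c]
      by (simp add: complex_vector.subspace_def)
  next
    case (step b)
    then obtain f D E where b: "b = diffop_comp (diffop_fun f) D \<otimes> E - D \<otimes> diffop_comp (diffop_fun f) E"
      by blast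
    show ?case unfolding b clinear_minus[OF c] by (simp add: gen)
  qed
  from this[OF bidiff_eq_imp_balance[OF assms]] show ?thesis
    by (simp add: clinear_minus[OF c])
qed

text \<open>\<open>diffop_comul\<close> picks a tensor for each D separately and need not be linear.
  Linearity in D appears only after \<open>to_HH\<close>, where tensors with equal bidifferential
  operators coincide.\<close>

lemma H_comul_tens_aux:
  "cbilinear (\<lambda>(D :: 'n::finite diffop) u. to_HH (hmap tinterchange (fps_const (diffop_comul D) \<otimes>\<^sub>h hcomul A (fps_const u))))"
proof (rule cbilinearI)
  show "clinear (\<lambda>D :: 'n diffop. to_HH (hmap tinterchange (fps_const (diffop_comul D) \<otimes>\<^sub>h hcomul A (fps_const u))))"
    for u
  proof (rule clinearI, fold HH_mix_def)
    fix D E :: "'n diffop" and k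
    have c: "clinear (\<lambda>T :: 'n diffop \<otimes> 'n diffop. to_HH (HH_mix T (hcomul A (fps_const u))))"
      by (rule clinear_comp[OF hlinear_imp_clinear clinear_HH_mix]) (intro hlin)
    show "to_HH (HH_mix (diffop_comul (D + E)) (hcomul A (fps_const u)))
        = to_HH (HH_mix (diffop_comul D) (hcomul A (fps_const u)))
        + to_HH (HH_mix (diffop_comul E) (hcomul A (fps_const u)))"
      unfolding clinear_plus[OF c, symmetric]
      by (rule to_HH_mix_cong) (simp add: bidiff_diffop_comul clinear_plus[OF clinear_bidiff] diffop_apply_simps)
    show "to_HH (HH_mix (diffop_comul (k *\<^sub>C D)) (hcomul A (fps_const u)))
        = k *\<^sub>C to_HH (HH_mix (diffop_comul D) (hcomul A (fps_const u)))"
      unfolding clinear_scaleC[OF c, symmetric]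
      by (rule to_HH_mix_cong) (simp add: bidiff_diffop_comul clinear_scaleC[OF clinear_bidiff] diffop_apply_simps)
  qed
  show "clinear (\<lambda>u. to_HH (hmap tinterchange (fps_const (diffop_comul D) \<otimes>\<^sub>h hcomul A (fps_const u))))"
    for D :: "'n diffop"
    by (rule clinear_comp[OF hlinear_imp_clinear clinear_fps_const]) (intro hlin)
qed

lemma hlinear_H_comul: "hlinear (H_comul A)"
  unfolding H_comul_def by (rule hlinear_hlift[OF H_comul_tens_aux])

lemmas hlinear_H_comul_comp [hlin] = hlinear_comp[OF hlinear_H_comul]

lemma H_comul_tens:
  assumes "\<And>f g. bidiff T f g = diffop_apply D (f * g)"
  shows "H_comul A (fps_const D \<otimes>\<^sub>h u) = to_HH (HH_mix T (hcomul A u))"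
proof -
  have "H_comul A (fps_const D \<otimes>\<^sub>h fps_const a) = to_HH (HH_mix (diffop_comul D) (hcomul A (fps_const a)))" for a
    unfolding H_comul_def HH_mix_def
    using hlift_fps_const_tens[OF H_comul_tens_aux] by (simp add: fps_const_tens)
  then have 1: "H_comul A (fps_const D \<otimes>\<^sub>h fps_const a) = to_HH (HH_mix T (hcomul A (fps_const a)))" for a
    by (metis to_HH_mix_cong assms bidiff_diffop_comul)
  show ?thesis by (rule hlinear_eq_const[where x = u], (intro hlin)+, rule 1)
qed

lemma HH_mul_right_balance:
  "to_HH (HH_mul A (H_mul A (H_fun A (fps_const f)) x \<otimes>\<^sub>h y) Z)
    = to_HH (HH_mul A (x \<otimes>\<^sub>h H_mul A (H_fun A (fps_const f)) y) Z)"
proof -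
  have "HH_mul A (H_mul A (H_fun A (fps_const f)) x \<otimes>\<^sub>h y) Z
      = HH_mul A (H_fun A (fps_const f) \<otimes>\<^sub>h H_one A) (HH_mul A (x \<otimes>\<^sub>h y) Z)"
    by (simp add: mul_tens flip: HH_mul_assoc)
  moreover have "HH_mul A (x \<otimes>\<^sub>h H_mul A (H_fun A (fps_const f)) y) Z
      = HH_mul A (H_one A \<otimes>\<^sub>h H_fun A (fps_const f)) (HH_mul A (x \<otimes>\<^sub>h y) Z)"
    by (simp add: mul_tens flip: HH_mul_assoc)
  ultimately show ?thesis by (simp add: to_HH_fun_mul)
qed

lemma HH_mul_rep: "to_HH (HH_mul A (HH_rep (to_HH X)) Z) = to_HH (HH_mul A X Z)"
  by (rule HH_rep_cong[where T = "\<lambda>X. to_HH (HH_mul A X Z)"], (intro hlin)+, rule HH_mul_right_balance)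

lemma hlinear_HH_mul_rep [hlin]: "hlinear f \<Longrightarrow> hlinear (\<lambda>x. to_HH (HH_mul A (HH_rep (f x)) Z))"
  by (rule hlinear_HH_rep[where T = "\<lambda>X. to_HH (HH_mul A X Z)"], (intro hlin)+, rule HH_mul_right_balance)

text \<open>This makes \<Delta> x \<cdot> Z meaningful for a class Z. By \<open>bidiff_mul\<close>
  the product involves Z only through its bidifferential operator, and that does not register which
  factor carries the function f.\<close>

lemma H_comul_mul_balance:
  "to_HH (HH_mul A (HH_rep (H_comul A x)) (H_mul A (H_fun A (fps_const f)) y \<otimes>\<^sub>h z))
    = to_HH (HH_mul A (HH_rep (H_comul A x)) (y \<otimes>\<^sub>h H_mul A (H_fun A (fps_const f)) z))"
proof -
  have 1: "to_HH (HH_mul A (HH_rep (H_comul A (fps_const D \<otimes>\<^sub>h u)))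
        (H_mul A (H_fun A (fps_const f)) (fps_const D' \<otimes>\<^sub>h u') \<otimes>\<^sub>h (fps_const D'' \<otimes>\<^sub>h u'')))
      = to_HH (HH_mul A (HH_rep (H_comul A (fps_const D \<otimes>\<^sub>h u)))
        ((fps_const D' \<otimes>\<^sub>h u') \<otimes>\<^sub>h H_mul A (H_fun A (fps_const f)) (fps_const D'' \<otimes>\<^sub>h u'')))"
    for D D' D'' :: "'a diffop" and u u' u''
    unfolding H_comul_tens[OF bidiff_diffop_comul] HH_mul_rep H_fun_mul HH_mix_tens[symmetric] HH_mix_mul
    by (rule to_HH_mix_cong) (simp add: bidiff_mul[OF bidiff_diffop_comul] bidiff_tens algebra_simps)
  have 2: "to_HH (HH_mul A (HH_rep (H_comul A (fps_const D \<otimes>\<^sub>h u)))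
        (H_mul A (H_fun A (fps_const f)) (fps_const D' \<otimes>\<^sub>h u') \<otimes>\<^sub>h z))
      = to_HH (HH_mul A (HH_rep (H_comul A (fps_const D \<otimes>\<^sub>h u)))
        ((fps_const D' \<otimes>\<^sub>h u') \<otimes>\<^sub>h H_mul A (H_fun A (fps_const f)) z))"
    for D D' :: "'a diffop" and u u'
    by (rule hlinear_eq_const_tens[where z = z], (intro hlin)+, rule 1)
  have 3: "to_HH (HH_mul A (HH_rep (H_comul A (fps_const D \<otimes>\<^sub>h u))) (H_mul A (H_fun A (fps_const f)) y \<otimes>\<^sub>h z))
      = to_HH (HH_mul A (HH_rep (H_comul A (fps_const D \<otimes>\<^sub>h u))) (y \<otimes>\<^sub>h H_mul A (H_fun A (fps_const f)) z))"
    for D :: "'a diffop" and u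
    by (rule hlinear_eq_const_tens[where z = y], (intro hlin)+, rule 2)
  show ?thesis by (rule hlinear_eq_const_tens[where z = x], (intro hlin)+, rule 3)
qed

lemma H_comul_mul_rep:
  "to_HH (HH_mul A (HH_rep (H_comul A x)) (HH_rep (to_HH Y))) = to_HH (HH_mul A (HH_rep (H_comul A x)) Y)"
  by (rule HH_rep_cong[where T = "\<lambda>Y. to_HH (HH_mul A (HH_rep (H_comul A x)) Y)"], (intro hlin)+,
      rule H_comul_mul_balance)

lemma H_fun_mul_H_fun: "H_mul A (H_fun A \<phi>) (H_fun A \<psi>) = H_fun A (hcauchy (*) \<phi> \<psi>)"
proof -
  note [hlin] = hbilinear_left[OF hbilinear_hcauchy[OF cbilinear_mult_mero]]
    hbilinear_right[OF hbilinear_hcauchy[OF cbilinear_mult_mero]]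
  show ?thesis
    by (rule hbilinear_eq_const[where x = \<phi> and y = \<psi>], (intro hbilinearI hlin)+)
      (simp add: H_fun_def hmap_diffop_fun_const mul_tens diffop_fps_const diffop_comp_fun
        hcauchy_fps_const[OF cbilinear_mult_mero])
qed

text \<open>Multiplicativity of the coproduct, with an explicit tensor T in place of the chosen one
  for the right factor. It is applied with partial derivatives and with elements of \<eta>, where T
  is written down by hand.\<close>

lemma H_comul_mul:
  assumes T: "\<And>f g. bidiff T f g = diffop_apply D (f * g)"
  shows "H_comul A (H_mul A x (fps_const D \<otimes>\<^sub>h u))
    = to_HH (HH_mul A (HH_rep (H_comul A x)) (HH_mix T (hcomul A u)))"
proof (rule hlinear_eq_const_tens[where z = x])
  show "hlinear (\<lambda>x. to_HH (HH_mul A (HH_rep (H_comul A x)) (HH_mix T (hcomul A u))))"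
    by (rule hlinear_HH_mul_rep[OF hlinear_H_comul])
  show "hlinear (\<lambda>x. H_comul A (H_mul A x (fps_const D \<otimes>\<^sub>h u)))" by (intro hlin)
  fix E v
  have "H_comul A (fps_const (diffop_comp E D) \<otimes>\<^sub>h hmul A v u)
      = to_HH (HH_mix (diffop2_mul (diffop_comul E) T) (hcomul A (hmul A v u)))"
    by (rule H_comul_tens) (simp add: bidiff_mul[OF bidiff_diffop_comul] T)
  then show "H_comul A (H_mul A (fps_const E \<otimes>\<^sub>h v) (fps_const D \<otimes>\<^sub>h u))
      = to_HH (HH_mul A (HH_rep (H_comul A (fps_const E \<otimes>\<^sub>h v))) (HH_mix T (hcomul A u)))"
    by (simp add: mul_tens diffop_fps_const comul_mult H_comul_tens[OF bidiff_diffop_comul]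
        HH_mul_rep HH_mix_mul)
qed

text \<open>Linearity of the coproduct over the functions. Together with the freedom to move
  functions between factors it makes the two sides of the twistor equation independent of the
  representative whose coproduct is taken.\<close>

lemma H_comul_fun_mul:
  "H_comul A (H_mul A (H_fun A (fps_const f)) x)
    = to_HH (HH_mul A (H_fun A (fps_const f) \<otimes>\<^sub>h H_one A) (HH_rep (H_comul A x)))"
proof -
  have comm: "HH_mul A (H_fun A (fps_const f) \<otimes>\<^sub>h H_one A) (HH_mul A (H_fun A (fps_const g) \<otimes>\<^sub>h H_one A) Y)
      = HH_mul A (H_fun A (fps_const g) \<otimes>\<^sub>h H_one A) (HH_mul A (H_fun A (fps_const f) \<otimes>\<^sub>h H_one A) Y)"
    "HH_mul A (H_fun A (fps_const f) \<otimes>\<^sub>h H_one A) (HH_mul A (H_one A \<otimes>\<^sub>h H_fun A (fps_const g)) Y)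
      = HH_mul A (H_one A \<otimes>\<^sub>h H_fun A (fps_const g)) (HH_mul A (H_fun A (fps_const f) \<otimes>\<^sub>h H_one A) Y)"
    for g and Y :: "(('a, 'u) hd \<otimes> ('a, 'u) hd) fps"
    by (simp_all add: mul_tens H_fun_mul_H_fun hcauchy_fps_const[OF cbilinear_mult_mero] mult.commute
        flip: HH_mul_assoc)
  have bal: "to_HH (HH_mul A (H_fun A (fps_const f) \<otimes>\<^sub>h H_one A) (H_mul A (H_fun A (fps_const g)) y \<otimes>\<^sub>h z))
      = to_HH (HH_mul A (H_fun A (fps_const f) \<otimes>\<^sub>h H_one A) (y \<otimes>\<^sub>h H_mul A (H_fun A (fps_const g)) z))"
    for g and y z :: "('a, 'u) hd fps"
  proof -
    have e: "H_mul A (H_fun A (fps_const g)) y \<otimes>\<^sub>h z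
        = HH_mul A (H_fun A (fps_const g) \<otimes>\<^sub>h H_one A) (y \<otimes>\<^sub>h z)"
      "y \<otimes>\<^sub>h H_mul A (H_fun A (fps_const g)) z
        = HH_mul A (H_one A \<otimes>\<^sub>h H_fun A (fps_const g)) (y \<otimes>\<^sub>h z)"
      by (simp_all add: HH_mul_tens)
    show ?thesis unfolding e comm(2) by (subst comm(1)) (rule to_HH_fun_mul)
  qed
  have rep: "to_HH (HH_mul A (H_fun A (fps_const f) \<otimes>\<^sub>h H_one A) (HH_rep (to_HH X)))
      = to_HH (HH_mul A (H_fun A (fps_const f) \<otimes>\<^sub>h H_one A) X)" for X :: "(('a, 'u) hd \<otimes> ('a, 'u) hd) fps"
    by (rule HH_rep_cong[where T = "\<lambda>X. to_HH (HH_mul A (H_fun A (fps_const f) \<otimes>\<^sub>h H_one A) X)"])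
      (intro hlin, rule bal)
  show ?thesis
  proof (rule hlinear_eq_const_tens[where z = x])
    show "hlinear (\<lambda>x. to_HH (HH_mul A (H_fun A (fps_const f) \<otimes>\<^sub>h H_one A) (HH_rep (H_comul A x))))"
      by (rule hlinear_HH_rep[where T = "\<lambda>X. to_HH (HH_mul A (H_fun A (fps_const f) \<otimes>\<^sub>h H_one A) X)"])
        (intro hlin bal)+
    fix D u
    have "H_comul A (fps_const (diffop_comp (diffop_fun f) D) \<otimes>\<^sub>h u)
        = to_HH (HH_mix (diffop2_mul (diffop_fun f \<otimes> diffop_fun 1) (diffop_comul D)) (hcomul A u))"
      by (rule H_comul_tens) (subst bidiff_mul[where D = "diffop_fun f"],
          simp_all add: bidiff_tens bidiff_diffop_comul mult.assoc)
    moreover have "to_HH (HH_mul A (H_fun A (fps_const f) \<otimes>\<^sub>h H_one A) (HH_rep (H_comul A (fps_const D \<otimes>\<^sub>h u))))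
        = to_HH (HH_mul A (H_fun A (fps_const f) \<otimes>\<^sub>h H_one A) (HH_mix (diffop_comul D) (hcomul A u)))"
      unfolding H_comul_tens[OF bidiff_diffop_comul] by (rule rep)
    moreover have "H_fun A (fps_const f) \<otimes>\<^sub>h H_one A = HH_mix (diffop_fun f \<otimes> diffop_fun 1) (hone A \<otimes>\<^sub>h hone A)"
      by (simp add: HH_mix_tens H_fun_def H_one_def hmap_diffop_fun_const)
    ultimately show "H_comul A (H_mul A (H_fun A (fps_const f)) (fps_const D \<otimes>\<^sub>h u))
      = to_HH (HH_mul A (H_fun A (fps_const f) \<otimes>\<^sub>h H_one A) (HH_rep (H_comul A (fps_const D \<otimes>\<^sub>h u))))"
      by (simp add: H_fun_mul HH_mix_mul)
  qed (intro hlin)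
qed

end

section \<open>The two sides of the twistor equation as pairings\<close>

text \<open>For Z = \<Sum> x \<otimes> y this is the class of \<Sum> (\<Delta> x \<otimes> y) Q.
  Keeping Q in the unbalanced threefold tensor product makes the expression linear in Q and Z
  separately, so that the two occurrences of the twistor can be transformed independently.\<close>

definition comul_left :: "'u::complex_vector hopf \<Rightarrow> (('n::finite, 'u) hd \<otimes> ('n, 'u) hd \<otimes> ('n, 'u) hd) fps \<Rightarrow>
    (('n, 'u) hd \<otimes> ('n, 'u) hd) fps \<Rightarrow> ('n, 'u) hhh fps"
  where "comul_left A Q = hlift (\<lambda>x y. to_HHH (HHH_mul A
    (hassoc (HH_rep (H_comul A (fps_const x)) \<otimes>\<^sub>h fps_const y)) Q))"

definition comul_right :: "'u::complex_vector hopf \<Rightarrow> (('n::finite, 'u) hd \<otimes> ('n, 'u) hd \<otimes> ('n, 'u) hd) fps \<Rightarrow>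
    (('n, 'u) hd \<otimes> ('n, 'u) hd) fps \<Rightarrow> ('n, 'u) hhh fps"
  where "comul_right A Q = hlift (\<lambda>x y. to_HHH (HHH_mul A
    (fps_const x \<otimes>\<^sub>h HH_rep (H_comul A (fps_const y))) Q))"

definition H_in2 :: "('u::complex_vector \<otimes> 'u) fps \<Rightarrow> (('n::finite, 'u) hd \<otimes> ('n, 'u) hd) fps"
  where "H_in2 = H_in \<boxtimes> H_in"

definition H_in3 :: "('u::complex_vector \<otimes> 'u \<otimes> 'u) fps \<Rightarrow>
    (('n::finite, 'u) hd \<otimes> ('n, 'u) hd \<otimes> ('n, 'u) hd) fps"
  where "H_in3 = H_in \<boxtimes> H_in2"

definition mero3_to_H3 :: "'u::complex_vector hopf \<Rightarrow> ('n::finite, 'u) mero3 \<Rightarrow>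
    (('n, 'u) hd \<otimes> ('n, 'u) hd \<otimes> ('n, 'u) hd) fps"
  where "mero3_to_H3 A = hlift (\<lambda>f t. HHH_mul A
    (H_fun A (fps_const f) \<otimes>\<^sub>h H_one A \<otimes>\<^sub>h H_one A) (H_in3 (fps_const t)))"

lemma hlinear_H_in': "hlinear H_in"
  using hlinear_H_in[OF hlinear_id(1)] .

lemma hlinear_H_in2': "hlinear H_in2"
  unfolding H_in2_def by (intro hlinear_htensor_map hlinear_H_in')

lemma hlinear_H_in3': "hlinear H_in3"
  unfolding H_in3_def by (intro hlinear_htensor_map hlinear_H_in' hlinear_H_in2')

lemmas [hlin] = hlinear_comp[OF hlinear_H_in2'] hlinear_comp[OF hlinear_H_in3']

lemma H_in2_tens: "H_in2 (u \<otimes>\<^sub>h v) = H_in u \<otimes>\<^sub>h H_in v"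
  unfolding H_in2_def by (intro htensor_map_htens hlinear_H_in')

lemma H_in3_tens: "H_in3 (u \<otimes>\<^sub>h t) = H_in u \<otimes>\<^sub>h H_in2 t"
  unfolding H_in3_def by (intro htensor_map_htens hlinear_H_in' hlinear_H_in2')

lemma H_in3_hassoc: "H_in3 (hassoc (t \<otimes>\<^sub>h w)) = hassoc (H_in2 t \<otimes>\<^sub>h H_in w)"
  by (rule hlinear_eq_tens[where z = t], (intro hlin)+) (simp add: hassoc_htens H_in2_tens H_in3_tens)

lemma fps_const_one_fun: "hmap diffop_fun 1 = fps_const (diffop_fun 1)"
  using hmap_diffop_fun_const[of 1] by simp

lemma mero2_to_H2_aux:
  "cbilinear (\<lambda>u v. (diffop_fun f \<otimes> u) \<otimes> (diffop_fun 1 \<otimes> v))"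
  "cbilinear (\<lambda>f. tlift (\<lambda>u v. (diffop_fun f \<otimes> u) \<otimes> (diffop_fun 1 \<otimes> v)))"
proof -
  show 1: "cbilinear (\<lambda>u v. (diffop_fun f \<otimes> u) \<otimes> (diffop_fun 1 \<otimes> v))" for f
    by (intro cbilinearI clin)
  show "cbilinear (\<lambda>f. tlift (\<lambda>u v. (diffop_fun f \<otimes> u) \<otimes> (diffop_fun 1 \<otimes> v)))"
    by (intro cbilinearI clinear_tlift_fun clin clinear_tlift 1)
qed

lemma hlinear_mero2_to_H2: "hlinear mero2_to_H2"
  unfolding mero2_to_H2_def by (rule hlinear_hmap[OF clinear_tlift[OF mero2_to_H2_aux(2)]])

lemmas [hlin] = hlinear_comp[OF hlinear_mero2_to_H2]

lemma hbilinear_mero_mult: "hbilinear (hcauchy ((*) :: 'n::finite mero \<Rightarrow> _))"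
  by (rule hbilinear_hcauchy[OF cbilinear_mult_mero])

lemmas hlinear_mero_mult [hlin] = hbilinear_left[OF hbilinear_mero_mult] hbilinear_right[OF hbilinear_mero_mult]

lemma mero_mult_const: "hcauchy (*) (fps_const f) (fps_const g) = fps_const (f * (g :: 'n::finite mero))"
  by (rule hcauchy_fps_const[OF cbilinear_mult_mero])

lemma mero_mult_assoc:
  "hcauchy (*) (hcauchy (*) \<phi> \<psi>) \<omega> = hcauchy (*) \<phi> (hcauchy (*) \<psi> (\<omega> :: 'n::finite mero fps))"
  by (rule hcauchy_assoc[OF cbilinear_mult_mero mult.assoc])

lemma mero_mult_one [simp]:
  "hcauchy (*) 1 \<phi> = \<phi>" "hcauchy (*) \<phi> 1 = (\<phi> :: 'n::finite mero fps)"
  by (rule hlinear_eq_const[where x = \<phi>], (intro hlin)+, simp add: mero_mult_const flip: fps_const_1_eq_1)+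

lemma mero_mult_commute: "hcauchy (*) \<phi> \<psi> = hcauchy (*) \<psi> (\<phi> :: 'n::finite mero fps)"
  by (rule hbilinear_eq_const[where x = \<phi> and y = \<psi>], (intro hbilinearI hlin)+)
    (simp add: mero_mult_const mult.commute)

lemmas [hlin] = hlinear_comp[OF hlinear_hmap[OF clinear_mero_partial]]

lemma hmap_tmap_tens:
  assumes "clinear f" "clinear g"
  shows "hmap (tmap f g) (x \<otimes>\<^sub>h y) = hmap f x \<otimes>\<^sub>h hmap g y"
proof -
  note [hlin] = hlinear_comp[OF hlinear_hmap[OF clinear_tmap[OF assms]]]
    hlinear_comp[OF hlinear_hmap[OF assms(1)]] hlinear_comp[OF hlinear_hmap[OF assms(2)]]
  show ?thesis
    by (rule hbilinear_eq_const[where x = x and y = y], (intro hbilinearI hlin)+)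
      (simp add: hmap_fps_const assms clinear_tmap tmap_tens flip: fps_const_tens)
qed

lemma clinear_mero2_partial: "clinear (tmap (mero_partial i) id)"
  by (rule clinear_tmap[OF clinear_mero_partial clinear_id(2)])

lemmas [hlin] = hlinear_comp[OF hlinear_hmap[OF clinear_mero2_partial]]

lemma hmap_mero_partial_tens:
  "hmap (tmap (mero_partial i) id) (\<phi> \<otimes>\<^sub>h t) = hmap (mero_partial i) \<phi> \<otimes>\<^sub>h t"
  by (simp add: hmap_tmap_tens[OF clinear_mero_partial clinear_id(2)] hmap_id)

lemma mero2_tensor_tens: "mero2_tensor (\<phi> \<otimes>\<^sub>h t) w = \<phi> \<otimes>\<^sub>h hassoc (t \<otimes>\<^sub>h w)"
  by (simp add: mero2_tensor_def hassoc_htens htensor_map_htens hlinear_id hlinear_hmap clinear_tassoc)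

lemma hlinear_mero2_tensor [hlin]:
  "hlinear f \<Longrightarrow> hlinear (\<lambda>x. mero2_tensor (f x) w)"
  "hlinear g \<Longrightarrow> hlinear (\<lambda>x. mero2_tensor F (g x))"
  unfolding mero2_tensor_def by (intro hlin hlinear_hmap clinear_tassoc; assumption)+

context hopf_ops
begin

lemma HHH_mul_one [simp]:
  "HHH_mul A (H_one A \<otimes>\<^sub>h H_one A \<otimes>\<^sub>h H_one A) x = x" "HHH_mul A x (H_one A \<otimes>\<^sub>h H_one A \<otimes>\<^sub>h H_one A) = x"
  unfolding HHH_mul_def
  by (rule htensor_mult_one_left[OF hbilinear_H_mul hbilinear_HH_mul]
      htensor_mult_one_right[OF hbilinear_H_mul hbilinear_HH_mul]; simp)+

lemma HHH_mul_left_balance: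
  "to_HHH (HHH_mul A (hassoc ((H_mul A (H_fun A (fps_const f)) a \<otimes>\<^sub>h b) \<otimes>\<^sub>h y)) Q)
    = to_HHH (HHH_mul A (hassoc ((a \<otimes>\<^sub>h H_mul A (H_fun A (fps_const f)) b) \<otimes>\<^sub>h y)) Q)"
proof -
  have "H_mul A (H_fun A (fps_const f)) a \<otimes>\<^sub>h b \<otimes>\<^sub>h y
      = HHH_mul A (H_fun A (fps_const f) \<otimes>\<^sub>h H_one A \<otimes>\<^sub>h H_one A) (a \<otimes>\<^sub>h b \<otimes>\<^sub>h y)"
    "a \<otimes>\<^sub>h H_mul A (H_fun A (fps_const f)) b \<otimes>\<^sub>h y
      = HHH_mul A (H_one A \<otimes>\<^sub>h H_fun A (fps_const f) \<otimes>\<^sub>h H_one A) (a \<otimes>\<^sub>h b \<otimes>\<^sub>h y)"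
    by (simp_all add: mul_tens)
  then show ?thesis by (simp add: hassoc_htens HHH_mul_assoc to_HHH_fun_mul)
qed

lemma HHH_mul_right_balance:
  "to_HHH (HHH_mul A (x \<otimes>\<^sub>h H_mul A (H_fun A (fps_const f)) a \<otimes>\<^sub>h b) Q)
    = to_HHH (HHH_mul A (x \<otimes>\<^sub>h a \<otimes>\<^sub>h H_mul A (H_fun A (fps_const f)) b) Q)"
proof -
  have "x \<otimes>\<^sub>h H_mul A (H_fun A (fps_const f)) a \<otimes>\<^sub>h b
      = HHH_mul A (H_one A \<otimes>\<^sub>h H_fun A (fps_const f) \<otimes>\<^sub>h H_one A) (x \<otimes>\<^sub>h a \<otimes>\<^sub>h b)"
    "x \<otimes>\<^sub>h a \<otimes>\<^sub>h H_mul A (H_fun A (fps_const f)) b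
      = HHH_mul A (H_one A \<otimes>\<^sub>h H_one A \<otimes>\<^sub>h H_fun A (fps_const f)) (x \<otimes>\<^sub>h a \<otimes>\<^sub>h b)"
    by (simp_all add: mul_tens)
  then show ?thesis by (simp add: HHH_mul_assoc to_HHH_fun_mul)
qed

lemma HHH_mul_rep_left:
  "to_HHH (HHH_mul A (hassoc (HH_rep (to_HH X) \<otimes>\<^sub>h y)) Q) = to_HHH (HHH_mul A (hassoc (X \<otimes>\<^sub>h y)) Q)"
  by (rule HH_rep_cong[where T = "\<lambda>X. to_HHH (HHH_mul A (hassoc (X \<otimes>\<^sub>h y)) Q)"])
    (intro hlin, rule HHH_mul_left_balance)

lemma HHH_mul_rep_right:
  "to_HHH (HHH_mul A (x \<otimes>\<^sub>h HH_rep (to_HH X)) Q) = to_HHH (HHH_mul A (x \<otimes>\<^sub>h X) Q)"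
  by (rule HH_rep_cong[where T = "\<lambda>X. to_HHH (HHH_mul A (x \<otimes>\<^sub>h X) Q)"])
    (intro hlin, rule HHH_mul_right_balance)

lemma comul_left_aux:
  "hbilinear (\<lambda>x y. to_HHH (HHH_mul A (hassoc (HH_rep (H_comul A x) \<otimes>\<^sub>h y)) Q))"
proof (rule hbilinearI)
  show "hlinear (\<lambda>x. to_HHH (HHH_mul A (hassoc (HH_rep (H_comul A x) \<otimes>\<^sub>h y)) Q))" for y
    by (rule hlinear_HH_rep[where T = "\<lambda>X. to_HHH (HHH_mul A (hassoc (X \<otimes>\<^sub>h y)) Q)", OF _ _ hlinear_H_comul])
      (intro hlin, rule HHH_mul_left_balance)
qed (intro hlin)

lemma comul_right_aux:
  "hbilinear (\<lambda>x y. to_HHH (HHH_mul A (x \<otimes>\<^sub>h HH_rep (H_comul A y)) Q))"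
proof (rule hbilinearI)
  show "hlinear (\<lambda>y. to_HHH (HHH_mul A (x \<otimes>\<^sub>h HH_rep (H_comul A y)) Q))" for x
    by (rule hlinear_HH_rep[where T = "\<lambda>X. to_HHH (HHH_mul A (x \<otimes>\<^sub>h X) Q)", OF _ _ hlinear_H_comul])
      (intro hlin, rule HHH_mul_right_balance)
qed (intro hlin)

lemma comul_left_tens:
  "comul_left A Q (x \<otimes>\<^sub>h y) = to_HHH (HHH_mul A (hassoc (HH_rep (H_comul A x) \<otimes>\<^sub>h y)) Q)"
  unfolding comul_left_def by (rule hlift_htens[OF comul_left_aux])

lemma comul_right_tens:
  "comul_right A Q (x \<otimes>\<^sub>h y) = to_HHH (HHH_mul A (x \<otimes>\<^sub>h HH_rep (H_comul A y)) Q)"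
  unfolding comul_right_def by (rule hlift_htens[OF comul_right_aux])

lemma hlinear_comul_left: "hlinear (comul_left A Q)"
  unfolding comul_left_def by (rule hlinear_hlift_hbilinear[OF comul_left_aux])

lemma hlinear_comul_right: "hlinear (comul_right A Q)"
  unfolding comul_right_def by (rule hlinear_hlift_hbilinear[OF comul_right_aux])

lemmas [hlin] = hlinear_comp[OF hlinear_comul_left] hlinear_comp[OF hlinear_comul_right]

lemma hlinear_comul_left_arg [hlin]: "hlinear f \<Longrightarrow> hlinear (\<lambda>x. comul_left A (f x) Z)"
  unfolding comul_left_def by (intro hlinear_hlift_fun hlin)

lemma hlinear_comul_right_arg [hlin]: "hlinear f \<Longrightarrow> hlinear (\<lambda>x. comul_right A (f x) Z)"
  unfolding comul_right_def by (intro hlinear_hlift_fun hlin)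

text \<open>All representatives disappear here, by the identity (\<Delta> x W) \<otimes> y =
  (\<Delta> x \<otimes> y) (W \<otimes> 1): the one acted upon by \<open>H_comul_mul_rep\<close>,
  the one of the product by \<open>HHH_mul_rep_left\<close>, and the one whose coproduct is taken by
  \<open>H_comul_fun_mul\<close>.\<close>

lemma twist_left_eq: "twist_left A (to_HH W) = comul_left A (hassoc (W \<otimes>\<^sub>h H_one A)) W"
proof -
  let ?Q = "hassoc (W \<otimes>\<^sub>h H_one A)"
  have "HH_tensor_H (comul_act A x (to_HH W)) y
      = to_HHH (HHH_mul A (hassoc (HH_rep (H_comul A x) \<otimes>\<^sub>h y)) ?Q)" for x y
    using HHH_mul_rep_left[of "HH_mul A (HH_rep (H_comul A x)) W" y "H_one A \<otimes>\<^sub>h H_one A \<otimes>\<^sub>h H_one A"]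
    by (simp add: HH_tensor_H_def comul_act_def H_comul_mul_rep HHH_mul_hassoc)
  then have "twist_left A (to_HH W) = comul_left A ?Q (HH_rep (to_HH W))"
    by (simp add: twist_left_def comul_left_def)
  also have "\<dots> = comul_left A ?Q W"
  proof (rule HH_rep_cong[OF hlinear_comul_left])
    fix f and x y :: "('a, 'u) hd fps"
    let ?X = "HH_rep (H_comul A x)"
    have "hassoc (HH_mul A (H_fun A (fps_const f) \<otimes>\<^sub>h H_one A) ?X \<otimes>\<^sub>h y)
        = HHH_mul A (H_fun A (fps_const f) \<otimes>\<^sub>h H_one A \<otimes>\<^sub>h H_one A) (hassoc (?X \<otimes>\<^sub>h y))"
      "hassoc (?X \<otimes>\<^sub>h H_mul A (H_fun A (fps_const f)) y)
        = HHH_mul A (H_one A \<otimes>\<^sub>h H_one A \<otimes>\<^sub>h H_fun A (fps_const f)) (hassoc (?X \<otimes>\<^sub>h y))"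
      by (simp_all add: HHH_mul_hassoc flip: hassoc_htens)
    then show "comul_left A ?Q (H_mul A (H_fun A (fps_const f)) x \<otimes>\<^sub>h y)
        = comul_left A ?Q (x \<otimes>\<^sub>h H_mul A (H_fun A (fps_const f)) y)"
      by (simp add: comul_left_tens H_comul_fun_mul HHH_mul_rep_left HHH_mul_assoc to_HHH_fun_mul)
  qed
  finally show ?thesis .
qed

lemma twist_right_eq: "twist_right A (to_HH W) = comul_right A (H_one A \<otimes>\<^sub>h W) W"
proof -
  let ?Q = "H_one A \<otimes>\<^sub>h W"
  have "H_tensor_HH x (comul_act A y (to_HH W)) = to_HHH (HHH_mul A (x \<otimes>\<^sub>h HH_rep (H_comul A y)) ?Q)" for x y
    using HHH_mul_rep_right[of x "HH_mul A (HH_rep (H_comul A y)) W" "H_one A \<otimes>\<^sub>h H_one A \<otimes>\<^sub>h H_one A"]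
    by (simp add: H_tensor_HH_def comul_act_def H_comul_mul_rep HHH_mul_tens)
  then have "twist_right A (to_HH W) = comul_right A ?Q (HH_rep (to_HH W))"
    by (simp add: twist_right_def comul_right_def)
  also have "\<dots> = comul_right A ?Q W"
  proof (rule HH_rep_cong[OF hlinear_comul_right])
    fix f and x y :: "('a, 'u) hd fps"
    let ?X = "HH_rep (H_comul A y)"
    have "x \<otimes>\<^sub>h HH_mul A (H_fun A (fps_const f) \<otimes>\<^sub>h H_one A) ?X
        = HHH_mul A (H_one A \<otimes>\<^sub>h H_fun A (fps_const f) \<otimes>\<^sub>h H_one A) (x \<otimes>\<^sub>h ?X)"
      "H_mul A (H_fun A (fps_const f)) x \<otimes>\<^sub>h ?X
        = HHH_mul A (H_fun A (fps_const f) \<otimes>\<^sub>h H_one A \<otimes>\<^sub>h H_one A) (x \<otimes>\<^sub>h ?X)"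
      by (simp_all add: HHH_mul_tens)
    then show "comul_right A ?Q (H_mul A (H_fun A (fps_const f)) x \<otimes>\<^sub>h y)
        = comul_right A ?Q (x \<otimes>\<^sub>h H_mul A (H_fun A (fps_const f)) y)"
      by (simp add: comul_right_tens H_comul_fun_mul HHH_mul_rep_right HHH_mul_assoc to_HHH_fun_mul)
  qed
  finally show ?thesis .
qed

lemma H_in_mul: "H_mul A (H_in u) (H_in v) = H_in (hmul A u v)"
  by (simp add: H_in_def mul_tens)

lemma H_in2_mul: "HH_mul A (H_in2 s) (H_in2 t) = H_in2 (hmul2 A s t)"
  by (rule hbilinear_eq_tens[where X = s and Y = t], (intro hbilinearI hlin)+)
    (simp add: H_in2_tens mul_tens H_in_mul)

lemma H_in3_mul: "HHH_mul A (H_in3 s) (H_in3 t) = H_in3 (hmul3 A s t)"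
  by (rule hbilinear_eq_tens[where X = s and Y = t], (intro hbilinearI hlin)+)
    (simp add: H_in3_tens mul_tens H_in_mul H_in2_mul)

lemma H_fun_in: "H_mul A (H_fun A \<phi>) (H_in u) = hmap diffop_fun \<phi> \<otimes>\<^sub>h u"
  "H_mul A (H_in u) (H_fun A \<phi>) = hmap diffop_fun \<phi> \<otimes>\<^sub>h u"
  by (simp_all add: H_in_def H_fun_def mul_tens)

lemma mero2_to_H2_tens: "mero2_to_H2 (\<phi> \<otimes>\<^sub>h t) = HH_mul A (H_fun A \<phi> \<otimes>\<^sub>h H_one A) (H_in2 t)"
proof -
  note aux = mero2_to_H2_aux
  have "mero2_to_H2 (fps_const f \<otimes>\<^sub>h fps_const u \<otimes>\<^sub>h fps_const v)
      = fps_const ((diffop_fun f \<otimes> u) \<otimes> (diffop_fun 1 \<otimes> v))" for f :: "'a mero" and u v :: 'u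
    unfolding mero2_to_H2_def fps_const_tens[symmetric]
    by (subst hmap_fps_const[OF clinear_tlift[OF aux(2)]], subst tlift_tens[OF aux(2)])
      (subst tlift_tens[OF aux(1)], rule refl)
  then have 1: "mero2_to_H2 (fps_const f \<otimes>\<^sub>h fps_const u \<otimes>\<^sub>h fps_const v)
      = HH_mul A (H_fun A (fps_const f) \<otimes>\<^sub>h H_one A) (H_in2 (fps_const u \<otimes>\<^sub>h fps_const v))"
    for f :: "'a mero" and u v :: 'u
    by (simp add: H_in2_tens mul_tens H_fun_mul H_in_def fps_const_tens)
  have 2: "mero2_to_H2 (fps_const f \<otimes>\<^sub>h fps_const u \<otimes>\<^sub>h v)
      = HH_mul A (H_fun A (fps_const f) \<otimes>\<^sub>h H_one A) (H_in2 (fps_const u \<otimes>\<^sub>h v))" for f :: "'a mero" and u v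
    by (rule hlinear_eq_const[where x = v], (intro hlin)+, rule 1)
  have 3: "mero2_to_H2 (fps_const f \<otimes>\<^sub>h t)
      = HH_mul A (H_fun A (fps_const f) \<otimes>\<^sub>h H_one A) (H_in2 t)" for f :: "'a mero"
    by (rule hlinear_eq_const_tens[where z = t], (intro hlin)+, rule 2)
  show ?thesis by (rule hlinear_eq_const[where x = \<phi>], (intro hlin)+, rule 3)
qed

lemma mero2_to_H2_tens2: "mero2_to_H2 (\<phi> \<otimes>\<^sub>h (u :: 'u fps) \<otimes>\<^sub>h v) = (hmap diffop_fun \<phi> \<otimes>\<^sub>h u) \<otimes>\<^sub>h H_in v"
  by (simp add: mero2_to_H2_tens H_in2_tens mul_tens H_fun_in)

lemma mero3_to_H3_aux:
  "hbilinear (\<lambda>\<phi> t. HHH_mul A (H_fun A \<phi> \<otimes>\<^sub>h H_one A \<otimes>\<^sub>h H_one A) (H_in3 t))"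
  by (intro hbilinearI hlin)

lemma hlinear_mero3_to_H3: "hlinear (mero3_to_H3 A)"
  unfolding mero3_to_H3_def by (rule hlinear_hlift_hbilinear[OF mero3_to_H3_aux])

lemmas [hlin] = hlinear_comp[OF hlinear_mero3_to_H3]

lemma mero3_to_H3_tens:
  "mero3_to_H3 A (\<phi> \<otimes>\<^sub>h t) = HHH_mul A (H_fun A \<phi> \<otimes>\<^sub>h H_one A \<otimes>\<^sub>h H_one A) (H_in3 t)"
  unfolding mero3_to_H3_def by (rule hlift_htens[OF mero3_to_H3_aux])

lemma hbilinear_mero2_mul: "hbilinear (mero2_mul A :: ('n::finite, 'u) mero2 \<Rightarrow> _)"
  and hbilinear_mero3_mul: "hbilinear (mero3_mul A :: ('n::finite, 'u) mero3 \<Rightarrow> _)"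
  unfolding mero2_mul_def mero3_mul_def
  by (intro hbilinear_htensor_mult hbilinear_mero_mult hbilinear_hmul)+

lemmas hlinear_mero2_mul [hlin] = hbilinear_left[OF hbilinear_mero2_mul] hbilinear_right[OF hbilinear_mero2_mul]
lemmas hlinear_mero3_mul [hlin] = hbilinear_left[OF hbilinear_mero3_mul] hbilinear_right[OF hbilinear_mero3_mul]

lemma mero2_mul_tens:
  "mero2_mul A (\<phi> \<otimes>\<^sub>h s) (\<psi> \<otimes>\<^sub>h t) = hcauchy (*) \<phi> \<psi> \<otimes>\<^sub>h hmul2 A s t"
  unfolding mero2_mul_def by (rule htensor_mult_htens[OF hbilinear_mero_mult hbilinear_hmul2])

lemma mero3_mul_tens:
  "mero3_mul A (\<phi> \<otimes>\<^sub>h s) (\<psi> \<otimes>\<^sub>h t) = hcauchy (*) \<phi> \<psi> \<otimes>\<^sub>h hmul3 A s t"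
  unfolding mero3_mul_def by (rule htensor_mult_htens[OF hbilinear_mero_mult hbilinear_hmul3])

lemma mero3_mul_assoc: "mero3_mul A (mero3_mul A x y) z = mero3_mul A x (mero3_mul A y z)"
  unfolding mero3_mul_def
  by (rule htensor_mult_assoc[OF hbilinear_mero_mult hbilinear_hmul3 mero_mult_assoc hmul3_assoc])

lemma H_in2_fun: "HH_mul A (H_in2 t) (HH_mul A (H_fun A \<phi> \<otimes>\<^sub>h H_one A) Y)
    = HH_mul A (H_fun A \<phi> \<otimes>\<^sub>h H_one A) (HH_mul A (H_in2 t) Y)"
proof -
  have "HH_mul A (H_in2 t) (H_fun A \<phi> \<otimes>\<^sub>h H_one A) = HH_mul A (H_fun A \<phi> \<otimes>\<^sub>h H_one A) (H_in2 t)"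
    by (rule hlinear_eq_tens[where z = t], (intro hlin)+) (simp add: H_in2_tens mul_tens H_fun_in)
  then show ?thesis by (simp flip: HH_mul_assoc)
qed

lemma H_in3_fun:
  "HHH_mul A (H_in3 t) (HHH_mul A (H_fun A \<phi> \<otimes>\<^sub>h H_one A \<otimes>\<^sub>h H_one A) Y)
    = HHH_mul A (H_fun A \<phi> \<otimes>\<^sub>h H_one A \<otimes>\<^sub>h H_one A) (HHH_mul A (H_in3 t) Y)"
  "HHH_mul A (H_in3 t) (HHH_mul A (H_one A \<otimes>\<^sub>h H_fun A \<phi> \<otimes>\<^sub>h H_one A) Y)
    = HHH_mul A (H_one A \<otimes>\<^sub>h H_fun A \<phi> \<otimes>\<^sub>h H_one A) (HHH_mul A (H_in3 t) Y)"
proof -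
  have 2: "HH_mul A (H_in2 s) (H_fun A \<phi> \<otimes>\<^sub>h H_one A) = HH_mul A (H_fun A \<phi> \<otimes>\<^sub>h H_one A) (H_in2 s)" for s
    using H_in2_fun[of s \<phi> "H_one A \<otimes>\<^sub>h H_one A"] by simp
  have "HHH_mul A (H_in3 t) (H_fun A \<phi> \<otimes>\<^sub>h H_one A \<otimes>\<^sub>h H_one A) = HHH_mul A (H_fun A \<phi> \<otimes>\<^sub>h H_one A \<otimes>\<^sub>h H_one A) (H_in3 t)"
    by (rule hlinear_eq_tens[where z = t], (intro hlin)+) (simp add: H_in3_tens mul_tens H_fun_in)
  moreover have "HHH_mul A (H_in3 t) (H_one A \<otimes>\<^sub>h H_fun A \<phi> \<otimes>\<^sub>h H_one A) = HHH_mul A (H_one A \<otimes>\<^sub>h H_fun A \<phi> \<otimes>\<^sub>h H_one A) (H_in3 t)"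
    by (rule hlinear_eq_tens[where z = t], (intro hlin)+) (simp add: H_in3_tens mul_tens 2)
  ultimately show "HHH_mul A (H_in3 t) (HHH_mul A (H_fun A \<phi> \<otimes>\<^sub>h H_one A \<otimes>\<^sub>h H_one A) Y)
    = HHH_mul A (H_fun A \<phi> \<otimes>\<^sub>h H_one A \<otimes>\<^sub>h H_one A) (HHH_mul A (H_in3 t) Y)"
    "HHH_mul A (H_in3 t) (HHH_mul A (H_one A \<otimes>\<^sub>h H_fun A \<phi> \<otimes>\<^sub>h H_one A) Y)
    = HHH_mul A (H_one A \<otimes>\<^sub>h H_fun A \<phi> \<otimes>\<^sub>h H_one A) (HHH_mul A (H_in3 t) Y)"
    by (simp_all flip: HHH_mul_assoc)
qed

lemma mero2_to_H2_mul: "HH_mul A (mero2_to_H2 G) (mero2_to_H2 K) = mero2_to_H2 (mero2_mul A G K)"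
proof -
  have 1: "HH_mul A (mero2_to_H2 (\<phi> \<otimes>\<^sub>h s)) (mero2_to_H2 (\<psi> \<otimes>\<^sub>h t))
      = mero2_to_H2 (mero2_mul A (\<phi> \<otimes>\<^sub>h s) (\<psi> \<otimes>\<^sub>h t))" for \<phi> \<psi> s t
    by (simp add: mero2_to_H2_tens mero2_mul_tens HH_mul_assoc H_in2_fun H_in2_mul)
      (simp add: mul_tens H_fun_mul_H_fun flip: HH_mul_assoc)
  show ?thesis
    by (rule hbilinear_eq_tens[where X = G and Y = K], (intro hbilinearI hlin)+, rule 1)
qed

lemma mero3_to_H3_mul: "HHH_mul A (mero3_to_H3 A G) (mero3_to_H3 A K) = mero3_to_H3 A (mero3_mul A G K)"
proof -
  have 1: "HHH_mul A (mero3_to_H3 A (\<phi> \<otimes>\<^sub>h s)) (mero3_to_H3 A (\<psi> \<otimes>\<^sub>h t))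
      = mero3_to_H3 A (mero3_mul A (\<phi> \<otimes>\<^sub>h s) (\<psi> \<otimes>\<^sub>h t))" for \<phi> \<psi> s t
    by (simp add: mero3_to_H3_tens mero3_mul_tens HHH_mul_assoc H_in3_fun H_in3_mul)
      (simp add: mul_tens H_fun_mul_H_fun flip: HHH_mul_assoc)
  show ?thesis
    by (rule hbilinear_eq_tens[where X = G and Y = K], (intro hbilinearI hlin)+, rule 1)
qed

lemma H_comul_fun_in:
  "H_comul A (hmap diffop_fun \<phi> \<otimes>\<^sub>h u) = to_HH (HH_mul A (H_fun A \<phi> \<otimes>\<^sub>h H_one A) (H_in2 (hcomul A u)))"
proof -
  have mix: "HH_mix (diffop_fun f \<otimes> diffop_fun 1) t = HH_mul A (H_fun A (fps_const f) \<otimes>\<^sub>h H_one A) (H_in2 t)"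
    for f :: "'a mero" and t
    by (rule hlinear_eq_tens[where z = t], (intro hlin)+)
      (simp add: HH_mix_tens H_in2_tens mul_tens H_fun_mul H_in_def)
  have 1: "H_comul A (hmap diffop_fun (fps_const f) \<otimes>\<^sub>h u)
      = to_HH (HH_mul A (H_fun A (fps_const f) \<otimes>\<^sub>h H_one A) (H_in2 (hcomul A u)))" for f :: "'a mero"
    unfolding mix[symmetric] hmap_diffop_fun_const
    by (rule H_comul_tens) (simp add: bidiff_tens mult.assoc)
  show ?thesis by (rule hlinear_eq_const[where x = \<phi>], (intro hlin)+, rule 1)
qed

lemma H_comul_in: "H_comul A (H_in u) = to_HH (H_in2 (hcomul A u))"
  using H_comul_fun_in[of 1 u] by (simp add: fps_const_one_fun H_fun_one flip: H_in_def)

lemma hlinear_comul_id: "hlinear (comul_id A)"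
  unfolding comul_id_def[abs_def] by (intro hlin hlinear_comul)

lemma hlinear_id_comul: "hlinear (id_comul A)"
  unfolding id_comul_def[abs_def] by (intro hlin hlinear_comul)

lemma comul_id_tens: "comul_id A (u \<otimes>\<^sub>h v) = hassoc (hcomul A u \<otimes>\<^sub>h v)"
  by (simp add: comul_id_def htensor_map_htens hlinear_comul hlinear_id)

lemma id_comul_tens: "id_comul A (u \<otimes>\<^sub>h v) = u \<otimes>\<^sub>h hcomul A v"
  by (simp add: id_comul_def htensor_map_htens hlinear_comul hlinear_id)

text \<open>The coproduct of a function f is f \<otimes> 1, so on functions of \<lambda> the
  coproduct of H acts through that of the quantum algebra alone.\<close>

lemma comul_left_mero2:
  "comul_left A Q (mero2_to_H2 F) = to_HHH (HHH_mul A (mero3_to_H3 A ((id \<boxtimes> comul_id A) F)) Q)"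
proof -
  have 1: "comul_left A Q (mero2_to_H2 (\<phi> \<otimes>\<^sub>h u \<otimes>\<^sub>h v))
      = to_HHH (HHH_mul A (mero3_to_H3 A ((id \<boxtimes> comul_id A) (\<phi> \<otimes>\<^sub>h u \<otimes>\<^sub>h v))) Q)" for \<phi> u v
  proof -
    have "hassoc (HH_mul A (H_fun A \<phi> \<otimes>\<^sub>h H_one A) (H_in2 (hcomul A u)) \<otimes>\<^sub>h H_in v)
        = HHH_mul A (H_fun A \<phi> \<otimes>\<^sub>h H_one A \<otimes>\<^sub>h H_one A) (hassoc (H_in2 (hcomul A u) \<otimes>\<^sub>h H_in v))"
      by (simp add: HHH_mul_hassoc flip: hassoc_htens)
    then show ?thesis
      by (simp add: mero2_to_H2_tens2 comul_left_tens H_comul_fun_in HHH_mul_rep_left htensor_map_htens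
          hlinear_id hlinear_comul_id comul_id_tens mero3_to_H3_tens H_in3_hassoc)
  qed
  have 2: "comul_left A Q (mero2_to_H2 (\<phi> \<otimes>\<^sub>h t))
      = to_HHH (HHH_mul A (mero3_to_H3 A ((id \<boxtimes> comul_id A) (\<phi> \<otimes>\<^sub>h t))) Q)" for \<phi> t
    by (rule hlinear_eq_tens[where z = t], (intro hlin hlinear_comul_id)+, rule 1)
  show ?thesis by (rule hlinear_eq_tens[where z = F], (intro hlin hlinear_comul_id)+, rule 2)
qed

lemma comul_right_mero2:
  "comul_right A Q (mero2_to_H2 F) = to_HHH (HHH_mul A (mero3_to_H3 A ((id \<boxtimes> id_comul A) F)) Q)"
proof -
  have 1: "comul_right A Q (mero2_to_H2 (\<phi> \<otimes>\<^sub>h u \<otimes>\<^sub>h v))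
      = to_HHH (HHH_mul A (mero3_to_H3 A ((id \<boxtimes> id_comul A) (\<phi> \<otimes>\<^sub>h u \<otimes>\<^sub>h v))) Q)" for \<phi> u v
    by (simp add: mero2_to_H2_tens2 comul_right_tens H_comul_in HHH_mul_rep_right htensor_map_htens
        hlinear_id hlinear_id_comul id_comul_tens mero3_to_H3_tens H_in3_tens HHH_mul_tens H_fun_in)
  have 2: "comul_right A Q (mero2_to_H2 (\<phi> \<otimes>\<^sub>h t))
      = to_HHH (HHH_mul A (mero3_to_H3 A ((id \<boxtimes> id_comul A) (\<phi> \<otimes>\<^sub>h t))) Q)" for \<phi> t
    by (rule hlinear_eq_tens[where z = t], (intro hlin hlinear_id_comul)+, rule 1)
  show ?thesis by (rule hlinear_eq_tens[where z = F], (intro hlin hlinear_id_comul)+, rule 2)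
qed

lemma hassoc_mero2_to_H2:
  "hassoc (mero2_to_H2 F \<otimes>\<^sub>h H_one A) = mero3_to_H3 A (mero2_tensor F (hone A))"
proof (rule hlinear_eq_tens[where z = F], (intro hlin)+)
  fix \<phi> t
  have "hassoc (HH_mul A (H_fun A \<phi> \<otimes>\<^sub>h H_one A) (H_in2 t) \<otimes>\<^sub>h H_one A)
      = HHH_mul A (H_fun A \<phi> \<otimes>\<^sub>h H_one A \<otimes>\<^sub>h H_one A) (hassoc (H_in2 t \<otimes>\<^sub>h H_one A))"
    by (simp add: HHH_mul_hassoc flip: hassoc_htens)
  then show "hassoc (mero2_to_H2 (\<phi> \<otimes>\<^sub>h t) \<otimes>\<^sub>h H_one A) = mero3_to_H3 A (mero2_tensor (\<phi> \<otimes>\<^sub>h t) (hone A))"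
    by (simp add: mero2_to_H2_tens mero2_tensor_tens mero3_to_H3_tens H_in3_hassoc H_in_one)
qed

lemma F23_tens: "F23 A (\<phi> \<otimes>\<^sub>h t) = \<phi> \<otimes>\<^sub>h hone A \<otimes>\<^sub>h t"
  unfolding F23_def by (subst htensor_map_htens) (intro hlin | simp)+

lemma hlinear_F23 [hlin]: "hlinear f \<Longrightarrow> hlinear (\<lambda>x. F23 A (f x))"
  unfolding F23_def by (intro hlin)

text \<open>Functions in the second tensor factor may be moved to the first one.\<close>

lemma mero3_to_H3_F23:
  "to_HHH (HHH_mul A (mero3_to_H3 A G) (H_one A \<otimes>\<^sub>h mero2_to_H2 F))
    = to_HHH (mero3_to_H3 A (mero3_mul A G (F23 A F)))"
proof -
  have 1: "to_HHH (HHH_mul A (mero3_to_H3 A (\<psi> \<otimes>\<^sub>h s)) (H_one A \<otimes>\<^sub>h mero2_to_H2 (\<phi> \<otimes>\<^sub>h t)))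
      = to_HHH (mero3_to_H3 A (mero3_mul A (\<psi> \<otimes>\<^sub>h s) (F23 A (\<phi> \<otimes>\<^sub>h t))))" for \<phi> \<psi> s t
  proof -
    let ?f = "H_fun A \<psi> \<otimes>\<^sub>h H_one A \<otimes>\<^sub>h H_one A" and ?g = "H_one A \<otimes>\<^sub>h H_fun A \<phi> \<otimes>\<^sub>h H_one A"
      and ?g' = "H_fun A \<phi> \<otimes>\<^sub>h H_one A \<otimes>\<^sub>h H_one A"
    have "H_one A \<otimes>\<^sub>h mero2_to_H2 (\<phi> \<otimes>\<^sub>h t) = HHH_mul A ?g (H_in3 (hone A \<otimes>\<^sub>h t))"
      by (simp add: mero2_to_H2_tens HHH_mul_tens H_in3_tens H_in_one)
    then have "HHH_mul A (mero3_to_H3 A (\<psi> \<otimes>\<^sub>h s)) (H_one A \<otimes>\<^sub>h mero2_to_H2 (\<phi> \<otimes>\<^sub>h t))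
        = HHH_mul A (HHH_mul A ?f ?g) (HHH_mul A (H_in3 s) (H_in3 (hone A \<otimes>\<^sub>h t)))"
      by (simp add: mero3_to_H3_tens HHH_mul_assoc H_in3_fun)
    also have "HHH_mul A ?f ?g = HHH_mul A ?g ?f" by (simp add: mul_tens)
    finally have "to_HHH (HHH_mul A (mero3_to_H3 A (\<psi> \<otimes>\<^sub>h s)) (H_one A \<otimes>\<^sub>h mero2_to_H2 (\<phi> \<otimes>\<^sub>h t)))
        = to_HHH (HHH_mul A ?g' (HHH_mul A ?f (HHH_mul A (H_in3 s) (H_in3 (hone A \<otimes>\<^sub>h t)))))"
      by (simp add: HHH_mul_assoc to_HHH_fun_mul)
    also have "HHH_mul A ?g' (HHH_mul A ?f (HHH_mul A (H_in3 s) (H_in3 (hone A \<otimes>\<^sub>h t))))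
        = mero3_to_H3 A (mero3_mul A (\<psi> \<otimes>\<^sub>h s) (F23 A (\<phi> \<otimes>\<^sub>h t)))"
      by (simp add: F23_tens mero3_mul_tens mero3_to_H3_tens H_in3_mul)
        (simp add: mul_tens H_fun_mul_H_fun mero_mult_commute[of \<phi>] flip: HHH_mul_assoc)
    finally show ?thesis .
  qed
  show ?thesis
    by (rule hbilinear_eq_tens[where X = G and Y = F], (intro hbilinearI hlin)+, rule 1)
qed

end

section \<open>Evaluation of polydifferential operators at constant functions\<close>

lemma clinear_diffop_vac: "clinear (\<lambda>D. diffop_apply D 1)"
  by (intro clin)

text \<open>It sends D \<otimes> u to the function D 1 with coefficient u. The constant function 1
  plays the part of a vacuum vector: it is annihilated by every product ending in a partial
  derivative.\<close>

definition H_vac :: "('n::finite, 'u::complex_vector) hd fps \<Rightarrow> ('n mero \<otimes> 'u) fps"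
  where "H_vac = hmap (tmap (\<lambda>D. diffop_apply D 1) id)"

lemma hlinear_H_vac: "hlinear H_vac"
  unfolding H_vac_def by (intro hlinear_hmap clinear_tmap clinear_diffop_vac clinear_id)

lemmas [hlin] = hlinear_comp[OF hlinear_H_vac]

lemma H_vac_tens: "H_vac (fps_const D \<otimes>\<^sub>h u) = fps_const (diffop_apply D 1) \<otimes>\<^sub>h u"
  unfolding H_vac_def
  by (simp add: hmap_tmap_tens[OF clinear_diffop_vac clinear_id(2)] hmap_fps_const[OF clinear_diffop_vac] hmap_id)

lemma H_vac_fun: "H_vac (hmap diffop_fun \<phi> \<otimes>\<^sub>h u) = \<phi> \<otimes>\<^sub>h u"
  by (rule hlinear_eq_const[where x = \<phi>], (intro hlin)+) (simp add: hmap_diffop_fun_const H_vac_tens)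

lemma H_vac_in: "H_vac (H_in u) = 1 \<otimes>\<^sub>h u"
  by (simp add: H_in_def H_vac_tens)

definition mero_tens_mult :: "('n::finite mero \<otimes> 'a::complex_vector) fps \<Rightarrow> ('n mero \<otimes> 'b::complex_vector) fps \<Rightarrow>
    ('n mero \<otimes> 'a \<otimes> 'b) fps"
  where "mero_tens_mult X Y = hmap (tmap (tlift (*)) id) (hmap tinterchange (X \<otimes>\<^sub>h Y))"

lemma clinear_tlift_mult: "clinear (tlift ((*) :: 'n::finite mero \<Rightarrow> _))"
  by (rule clinear_tlift[OF cbilinear_mult_mero])

lemma hlinear_mero_tens_mult [hlin]:
  "hlinear f \<Longrightarrow> hlinear (\<lambda>x. mero_tens_mult (f x) Y)"
  "hlinear g \<Longrightarrow> hlinear (\<lambda>x. mero_tens_mult X (g x))"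
  unfolding mero_tens_mult_def
  by (rule hlinear_comp[OF hlinear_hmap[OF clinear_tmap[OF clinear_tlift_mult clinear_id(2)]]],
      (intro hlin; assumption))+

lemma hmap_tlift_mult: "hmap (tlift (*)) (\<phi> \<otimes>\<^sub>h \<psi>) = hcauchy (*) \<phi> (\<psi> :: 'n::finite mero fps)"
proof -
  note [hlin] = hlinear_comp[OF hlinear_hmap[OF clinear_tlift_mult]]
  show ?thesis
    by (rule hbilinear_eq_const[where x = \<phi> and y = \<psi>], (intro hbilinearI hlin)+)
      (simp add: mero_mult_const hmap_fps_const[OF clinear_tlift_mult] tlift_tens[OF cbilinear_mult_mero]
        flip: fps_const_tens)
qed

lemma mero_tens_mult_tens:
  "mero_tens_mult (\<phi> \<otimes>\<^sub>h u) (\<psi> \<otimes>\<^sub>h v) = hcauchy (*) \<phi> \<psi> \<otimes>\<^sub>h u \<otimes>\<^sub>h v"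
  by (simp add: mero_tens_mult_def hinterchange_htens hmap_tmap_tens[OF clinear_tlift_mult clinear_id(2)]
      hmap_tlift_mult hmap_id)

definition HH_vac :: "(('n::finite, 'u::complex_vector) hd \<otimes> ('n, 'u) hd) fps \<Rightarrow> ('n, 'u) mero2"
  where "HH_vac = hlift (\<lambda>x y. mero_tens_mult (H_vac (fps_const x)) (H_vac (fps_const y)))"

definition HHH_vac :: "(('n::finite, 'u::complex_vector) hd \<otimes> ('n, 'u) hd \<otimes> ('n, 'u) hd) fps \<Rightarrow> ('n, 'u) mero3"
  where "HHH_vac = hlift (\<lambda>x y. mero_tens_mult (H_vac (fps_const x)) (HH_vac (fps_const y)))"

lemma HH_vac_aux: "hbilinear (\<lambda>x y. mero_tens_mult (H_vac x) (H_vac y))"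
  by (intro hbilinearI hlin)

lemma hlinear_HH_vac: "hlinear HH_vac"
  unfolding HH_vac_def by (rule hlinear_hlift_hbilinear[OF HH_vac_aux])

lemmas [hlin] = hlinear_comp[OF hlinear_HH_vac]

lemma HHH_vac_aux: "hbilinear (\<lambda>x y. mero_tens_mult (H_vac x) (HH_vac y))"
  by (intro hbilinearI hlin)

lemma hlinear_HHH_vac: "hlinear HHH_vac"
  unfolding HHH_vac_def by (rule hlinear_hlift_hbilinear[OF HHH_vac_aux])

lemmas [hlin] = hlinear_comp[OF hlinear_HHH_vac]

lemma HH_vac_tens: "HH_vac (x \<otimes>\<^sub>h y) = mero_tens_mult (H_vac x) (H_vac y)"
  unfolding HH_vac_def by (rule hlift_htens[OF HH_vac_aux])

lemma HHH_vac_tens: "HHH_vac (x \<otimes>\<^sub>h y) = mero_tens_mult (H_vac x) (HH_vac y)"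
  unfolding HHH_vac_def by (rule hlift_htens[OF HHH_vac_aux])

lemma htens_zero [simp]: "0 \<otimes>\<^sub>h y = 0" "x \<otimes>\<^sub>h 0 = 0"
  by (rule hlinear_zero[of "\<lambda>x. x \<otimes>\<^sub>h y"] hlinear_zero[of "\<lambda>y. x \<otimes>\<^sub>h y"]; intro hlin)+

lemma mero_tens_mult_zero [simp]: "mero_tens_mult 0 Y = 0" "mero_tens_mult X 0 = 0"
  by (rule hlinear_zero[of "\<lambda>X. mero_tens_mult X Y"] hlinear_zero[of "\<lambda>Y. mero_tens_mult X Y"]; intro hlin)+

lemma hscale_complex: "hscale c d = c * (d :: complex fps)"
  by (simp add: fps_eq_iff hscale_nth fps_mult_nth_atMost scaleC_complex_def)

lemma hlinear_hscale_left [hlin]: "hlinear f \<Longrightarrow> hlinear (\<lambda>x. hscale (f x) y)"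
  by (rule hlinearI) (simp_all add: hlinear_plus hlinear_hscale hscale_add_left hscale_hscale hscale_complex)

text \<open>If R and L are adjoint for a pairing, so are their powers, and hence their exponentials
  because the pairing commutes with \<hbar>-adic sums in both arguments. The pairings used are
  \<open>comul_left\<close> and \<open>comul_right\<close>.\<close>

lemma hExp_adjoint:
  fixes R :: "'a::complex_vector fps \<Rightarrow> 'a fps" and L :: "'b::complex_vector fps \<Rightarrow> 'b fps"
  assumes B: "\<And>Q. hlinear (B Q)" "\<And>Z. hlinear (\<lambda>Q. B Q Z)" "\<And>Q Z. B Q (R Z) = B (L Q) Z"
  shows "B Q (hExp R Z) = B (hExp L Q) Z"
proof -
  have pow: "B Q ((R ^^ n) Z) = B ((L ^^ n) Q) Z" for n
  proof (induction n arbitrary: Q)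
    case (Suc n)
    have "B Q ((R ^^ Suc n) Z) = B (L Q) ((R ^^ n) Z)" by (simp add: B(3))
    also have "\<dots> = B ((L ^^ Suc n) Q) Z" by (simp add: Suc funpow_swap1)
    finally show ?case .
  qed simp
  have "B Q (hExp R Z) = hseries (\<lambda>n. (1 / fact n) *\<^sub>C B ((L ^^ n) Q) Z)"
    by (simp add: hExp_def hlinear_hseries[OF B(1)] hlinear_scaleC[OF B(1)] pow)
  also have "\<dots> = B (hExp L Q) Z"
    by (simp add: hExp_def hlinear_hseries[OF B(2)] hlinear_scaleC[OF B(2)])
  finally show ?thesis .
qed

text \<open>Only the term of order zero of the exponential series survives.\<close>

lemma hExp_annihilated:
  assumes "hlinear \<Phi>" "\<And>z. \<Phi> (S z) = 0"
  shows "\<Phi> (hExp S z) = \<Phi> z"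
  using hExp_commute[of \<Phi> S "\<lambda>_. 0"] assms hExp_fixed[of "\<lambda>_. 0" "\<Phi> z"] by (simp add: hlinear_const_zero)

lemma sum_lists_Suc:
  "(\<Sum>xs \<in> {xs. length xs = Suc n}. f xs)
    = (\<Sum>i\<in>UNIV. \<Sum>xs \<in> {xs. length xs = n}. f (i # xs))"
  unfolding sum.cartesian_product
  by (rule sum.reindex_bij_witness[where i = "\<lambda>(i, xs). i # xs" and j = "\<lambda>xs. (hd xs, tl xs)"])
    (auto simp: length_Suc_conv)

context hopf_ops
begin

lemma H_vac_partial: "H_vac (H_mul A x (H_partial A i)) = 0"
proof -
  have 1: "H_vac (H_mul A (fps_const D \<otimes>\<^sub>h u) (H_partial A i)) = 0" for D :: "'a diffop" and u
    by (simp add: H_partial_def mul_tens diffop_fps_const H_vac_tens mero_partial_one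
        clinear_zero[OF clinear_diffop_apply])
  show ?thesis
    by (rule hlinear_eq_const_tens[of "\<lambda>x. H_vac (H_mul A x (H_partial A i))" "\<lambda>_. 0"], (intro hlin)+, rule 1)
qed

text \<open>The three function values are multiplied in the end, so it does not matter which factor
  a function stood in. Thus \<open>HHH_vac\<close> can be read off from the class in the threefold
  tensor product over R.\<close>

lemma HHH_vac_balance:
  "HHH_vac (H_mul A (H_fun A (fps_const f)) x \<otimes>\<^sub>h y \<otimes>\<^sub>h z) = HHH_vac (x \<otimes>\<^sub>h H_mul A (H_fun A (fps_const f)) y \<otimes>\<^sub>h z)" (is ?L)
  "HHH_vac (x \<otimes>\<^sub>h H_mul A (H_fun A (fps_const f)) y \<otimes>\<^sub>h z) = HHH_vac (x \<otimes>\<^sub>h y \<otimes>\<^sub>h H_mul A (H_fun A (fps_const f)) z)" (is ?R)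
proof -
  let ?f = "H_mul A (H_fun A (fps_const f))"
  have 1: "HHH_vac (?f (fps_const D \<otimes>\<^sub>h u) \<otimes>\<^sub>h (fps_const E \<otimes>\<^sub>h v) \<otimes>\<^sub>h (fps_const G \<otimes>\<^sub>h w))
      = HHH_vac ((fps_const D \<otimes>\<^sub>h u) \<otimes>\<^sub>h ?f (fps_const E \<otimes>\<^sub>h v) \<otimes>\<^sub>h (fps_const G \<otimes>\<^sub>h w))"
    "HHH_vac ((fps_const D \<otimes>\<^sub>h u) \<otimes>\<^sub>h ?f (fps_const E \<otimes>\<^sub>h v) \<otimes>\<^sub>h (fps_const G \<otimes>\<^sub>h w))
      = HHH_vac ((fps_const D \<otimes>\<^sub>h u) \<otimes>\<^sub>h (fps_const E \<otimes>\<^sub>h v) \<otimes>\<^sub>h ?f (fps_const G \<otimes>\<^sub>h w))"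
    for D E G and u v w :: "'u fps"
    by (simp_all add: H_fun_mul HHH_vac_tens HH_vac_tens H_vac_tens mero_tens_mult_tens mero_mult_const ac_simps)
  have 2: "HHH_vac (?f (fps_const D \<otimes>\<^sub>h u) \<otimes>\<^sub>h (fps_const E \<otimes>\<^sub>h v) \<otimes>\<^sub>h z)
      = HHH_vac ((fps_const D \<otimes>\<^sub>h u) \<otimes>\<^sub>h ?f (fps_const E \<otimes>\<^sub>h v) \<otimes>\<^sub>h z)"
    "HHH_vac ((fps_const D \<otimes>\<^sub>h u) \<otimes>\<^sub>h ?f (fps_const E \<otimes>\<^sub>h v) \<otimes>\<^sub>h z)
      = HHH_vac ((fps_const D \<otimes>\<^sub>h u) \<otimes>\<^sub>h (fps_const E \<otimes>\<^sub>h v) \<otimes>\<^sub>h ?f z)"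
    for D E and u v :: "'u fps"
    by (rule hlinear_eq_const_tens[where z = z], (intro hlin)+, rule 1)+
  have 3: "HHH_vac (?f (fps_const D \<otimes>\<^sub>h u) \<otimes>\<^sub>h y \<otimes>\<^sub>h z) = HHH_vac ((fps_const D \<otimes>\<^sub>h u) \<otimes>\<^sub>h ?f y \<otimes>\<^sub>h z)"
    "HHH_vac ((fps_const D \<otimes>\<^sub>h u) \<otimes>\<^sub>h ?f y \<otimes>\<^sub>h z) = HHH_vac ((fps_const D \<otimes>\<^sub>h u) \<otimes>\<^sub>h y \<otimes>\<^sub>h ?f z)"
    for D and u :: "'u fps"
    by (rule hlinear_eq_const_tens[where z = y], (intro hlin)+, rule 2)+
  show ?L ?R by (rule hlinear_eq_const_tens[where z = x], (intro hlin)+, rule 3)+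
qed

lemma HHH_vac_mero3: "HHH_vac (mero3_to_H3 A G) = G"
proof -
  have 1: "HHH_vac (mero3_to_H3 A (\<phi> \<otimes>\<^sub>h u \<otimes>\<^sub>h v \<otimes>\<^sub>h w)) = \<phi> \<otimes>\<^sub>h u \<otimes>\<^sub>h v \<otimes>\<^sub>h w" for \<phi> :: "'a mero fps" and u v w
    by (simp add: mero3_to_H3_tens H_in3_tens H_in2_tens mul_tens H_fun_in HHH_vac_tens HH_vac_tens
        H_vac_fun H_vac_in mero_tens_mult_tens)
  have 2: "HHH_vac (mero3_to_H3 A (\<phi> \<otimes>\<^sub>h u \<otimes>\<^sub>h t)) = \<phi> \<otimes>\<^sub>h u \<otimes>\<^sub>h t" for \<phi> :: "'a mero fps" and u t
    by (rule hlinear_eq_tens[where z = t], (intro hlin)+, rule 1)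
  have 3: "HHH_vac (mero3_to_H3 A (\<phi> \<otimes>\<^sub>h t)) = \<phi> \<otimes>\<^sub>h t" for \<phi> :: "'a mero fps" and t
    by (rule hlinear_eq_tens[where z = t], (intro hlin)+, rule 2)
  show ?thesis by (rule hlinear_eq_tens[where z = G], (intro hlin)+, rule 3)
qed

section \<open>Counit conditions\<close>

lemma cbilinear_hd_act: "cbilinear (hd_act :: 'n::finite mero \<Rightarrow> ('n, 'u) hd \<Rightarrow> _)"
proof (rule cbilinearI)
  have "clinear (\<lambda>f. fps_const (hd_act f x))" for x :: "('n, 'u) hd"
    unfolding hd_act_eq by (rule clinear_comp[OF hlinear_imp_clinear clinear_fps_const]) (intro hlin)
  then show "clinear (\<lambda>f. hd_act f x)" for x :: "('n, 'u) hd"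
    by (simp add: clinear_def clinear_plus[OF clinear_fps_const, symmetric]
        clinear_scaleC[OF clinear_fps_const, symmetric])
  show "clinear (hd_act f :: ('n, 'u) hd \<Rightarrow> _)" for f
    unfolding hd_act_def
    by (intro clinear_tmap cbilinear_right[OF cbilinear_diffop_comp] clinear_id(2))
qed

lemma hcauchy_hd_act: "hcauchy hd_act \<phi> (x :: ('n::finite, 'u) hd fps) = H_mul A (H_fun A \<phi>) x"
proof -
  note b = hbilinear_hcauchy[OF cbilinear_hd_act]
  note [hlin] = hbilinear_left[OF b] hbilinear_right[OF b]
  show ?thesis
    by (rule hbilinear_eq_const[where x = \<phi> and y = x], (intro hbilinearI hlin)+)
      (simp add: hcauchy_fps_const[OF cbilinear_hd_act] hd_act_eq)
qed

lemma H_counit_aux: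
  "cbilinear (\<lambda>D u. hscale (hcounit A (fps_const u)) (fps_const (diffop_apply D 1)))"
  by (intro cbilinearI clinear_comp[OF hlinear_imp_clinear[OF hlinear_hscale_const]]
      clinear_comp[OF clinear_fps_const] clin clinear_comp[OF hlinear_imp_clinear clinear_fps_const, of "\<lambda>u. hscale (hcounit A u) _"])
    (intro hlin)

lemma hlinear_H_counit: "hlinear (H_counit A)"
  unfolding H_counit_def by (rule hlinear_hlift[OF H_counit_aux])

lemmas hlinear_H_counit_comp [hlin] = hlinear_comp[OF hlinear_H_counit]

lemma H_counit_tens: "H_counit A (fps_const D \<otimes>\<^sub>h u) = hscale (hcounit A u) (fps_const (diffop_apply D 1))"
proof -
  have 1: "H_counit A (fps_const D \<otimes>\<^sub>h fps_const a) = hscale (hcounit A (fps_const a)) (fps_const (diffop_apply D 1))" for a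
    unfolding H_counit_def using hlift_fps_const_tens[OF H_counit_aux] by (simp add: fps_const_tens)
  show ?thesis by (rule hlinear_eq_const[where x = u], (intro hlin)+, rule 1)
qed

lemma H_counit_fun: "H_counit A (hmap diffop_fun \<phi> \<otimes>\<^sub>h u) = hscale (hcounit A u) \<phi>"
  by (rule hlinear_eq_const[where x = \<phi>], (intro hlin)+) (simp add: hmap_diffop_fun_const H_counit_tens)

lemma H_counit_in: "H_counit A (H_in u) = hscale (hcounit A u) 1"
  by (simp add: H_in_def H_counit_tens)

lemma H_counit_fun_mul: "H_counit A (H_mul A (H_fun A (fps_const f)) x) = hcauchy (*) (fps_const f) (H_counit A x)"
proof -
  note l = hlinear_hscale[OF hbilinear_right[OF hbilinear_mero_mult hlinear_id(1)]]
  show ?thesis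
    by (rule hlinear_eq_const_tens[where z = x], (intro hlin)+)
      (simp add: H_fun_mul H_counit_tens l mero_mult_const)
qed

lemma H_counit_partial: "H_counit A (H_mul A x (H_partial A i)) = 0"
proof -
  have 1: "H_counit A (H_mul A (fps_const D \<otimes>\<^sub>h u) (H_partial A i)) = 0" for D :: "'a diffop" and u
    by (simp add: H_partial_def mul_tens diffop_fps_const H_counit_tens mero_partial_one
        clinear_zero[OF clinear_diffop_apply] hscale_zero)
  show ?thesis
    by (rule hlinear_eq_const_tens[of "\<lambda>x. H_counit A (H_mul A x (H_partial A i))" "\<lambda>_. 0"], (intro hlin)+, rule 1)
qed

lemma H_counit_in_zero: "hcounit A u = 0 \<Longrightarrow> H_counit A (H_mul A x (H_in u)) = 0"
  by (rule hlinear_eq_const_tens[where z = x and T = "\<lambda>_. 0"], (intro hlin)+)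
    (simp add: H_in_def mul_tens H_counit_tens counit_mult hlinear_zero[OF hlinear_hscale_left[OF hlinear_id(1)]])

lemma counit_pair_aux:
  "hbilinear (\<lambda>x y. H_mul A (H_fun A (H_counit A x)) y)"
  "hbilinear (\<lambda>x y. H_mul A (H_fun A (H_counit A y)) x)"
  by (intro hbilinearI hlin)+

lemma H_counit_id_tens: "hlinear (\<lambda>Z. hlift (\<lambda>x (y :: ('n::finite, 'u) hd). hcauchy hd_act (H_counit A (fps_const x)) (fps_const y)) Z)"
  "hlift (\<lambda>x y. hcauchy hd_act (H_counit A (fps_const x)) (fps_const y)) (x \<otimes>\<^sub>h y)
    = H_mul A (H_fun A (H_counit A x)) y"
  unfolding hcauchy_hd_act
  by (rule hlinear_hlift_hbilinear[OF counit_pair_aux(1)] hlift_htens[OF counit_pair_aux(1)])+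

lemma H_id_counit_tens: "hlinear (\<lambda>Z. hlift (\<lambda>(x :: ('n::finite, 'u) hd) y. hcauchy hd_act (H_counit A (fps_const y)) (fps_const x)) Z)"
  "hlift (\<lambda>x y. hcauchy hd_act (H_counit A (fps_const y)) (fps_const x)) (x \<otimes>\<^sub>h y)
    = H_mul A (H_fun A (H_counit A y)) x"
  unfolding hcauchy_hd_act
  by (rule hlinear_hlift_hbilinear[OF counit_pair_aux(2)] hlift_htens[OF counit_pair_aux(2)])+

lemma H_fun_commute: "H_mul A (H_fun A \<phi>) (H_mul A (H_fun A \<psi>) x) = H_mul A (H_fun A \<psi>) (H_mul A (H_fun A \<phi>) x)"
  by (simp add: H_fun_mul_H_fun mero_mult_commute[of \<phi>] flip: H_mul_assoc)

lemma H_counit_id_to_HH: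
  "H_counit_id A (to_HH W) = hlift (\<lambda>x y. hcauchy hd_act (H_counit A (fps_const x)) (fps_const y)) W"
  unfolding H_counit_id_def
  by (rule HH_rep_cong[OF H_counit_id_tens(1)])
    (simp add: H_counit_id_tens(2) H_counit_fun_mul H_fun_commute[of _ "fps_const _"] flip: H_fun_mul_H_fun,
      simp add: H_mul_assoc H_fun_commute)

lemma H_id_counit_to_HH:
  "H_id_counit A (to_HH W) = hlift (\<lambda>x y. hcauchy hd_act (H_counit A (fps_const y)) (fps_const x)) W"
  unfolding H_id_counit_def
  by (rule HH_rep_cong[OF H_id_counit_tens(1)])
    (simp add: H_id_counit_tens(2) H_counit_fun_mul flip: H_fun_mul_H_fun,
      simp add: H_mul_assoc H_fun_commute)

lemma counit_id_aux:
  "hbilinear (\<lambda>x y. hscale (hcounit A x) y)" "hbilinear (\<lambda>x y. hscale (hcounit A y) x)"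
  by (intro hbilinearI hlin)+

lemma hlinear_counit_id: "hlinear (counit_id A)" "hlinear (id_counit A)"
  unfolding counit_id_def id_counit_def
  by (rule hlinear_hlift_hbilinear[OF counit_id_aux(1)] hlinear_hlift_hbilinear[OF counit_id_aux(2)])+

lemma counit_id_tens: "counit_id A (x \<otimes>\<^sub>h y) = hscale (hcounit A x) y"
  "id_counit A (x \<otimes>\<^sub>h y) = hscale (hcounit A y) x"
  unfolding counit_id_def id_counit_def
  by (rule hlift_htens[OF counit_id_aux(1)] hlift_htens[OF counit_id_aux(2)])+

text \<open>Applying the counit to the first factor of the coproduct yields \<epsilon>(u) 1 + u = u,
  and \<epsilon>(1) = 1 finishes the argument.\<close>

lemma counit_primitive:
  assumes "hcomul A u = u \<otimes>\<^sub>h hone A + hone A \<otimes>\<^sub>h u"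
  shows "hcounit A u = 0"
proof -
  have "hscale (hcounit A u) (hone A) + u = u"
    using counit_id_comul[of u] unfolding assms
    by (simp add: hlinear_plus[OF hlinear_counit_id(1)] counit_id_tens counit_one hscale_one)
  then have "hcounit A (hscale (hcounit A u) (hone A)) = 0" by (simp add: hlinear_zero[OF hlinear_counit])
  then show ?thesis by (simp add: hlinear_hscale[OF hlinear_counit] counit_one hscale_complex)
qed

definition mero1_to_H :: "('n::finite mero \<otimes> 'u) fps \<Rightarrow> ('n, 'u) hd fps"
  where "mero1_to_H = hmap (tmap diffop_fun id)"

lemma hlinear_mero1_to_H [hlin]: "hlinear f \<Longrightarrow> hlinear (\<lambda>x. mero1_to_H (f x))"
  unfolding mero1_to_H_def
  by (rule hlinear_comp[OF hlinear_hmap[OF clinear_tmap[OF clinear_diffop_fun clinear_id(2)]]])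

lemma mero1_to_H_tens: "mero1_to_H (\<phi> \<otimes>\<^sub>h u) = hmap diffop_fun \<phi> \<otimes>\<^sub>h u"
  by (simp add: mero1_to_H_def hmap_tmap_tens[OF clinear_diffop_fun clinear_id(2)] hmap_id)

text \<open>\<open>H_vac\<close> is a left inverse of \<open>mero1_to_H\<close>, so a counit
  condition in H is equivalent to the one for functions.\<close>

lemma mero1_to_H_eq_one: "mero1_to_H G = H_one A \<longleftrightarrow> G = 1 \<otimes>\<^sub>h hone A"
proof -
  have "H_vac (mero1_to_H G) = G" for G :: "('a mero \<otimes> 'u) fps"
    by (rule hlinear_eq_tens[where z = G], (intro hlin)+) (simp add: mero1_to_H_tens H_vac_fun)
  moreover have "mero1_to_H (1 \<otimes>\<^sub>h hone A) = (H_one A :: ('a, 'u) hd fps)"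
    by (simp add: mero1_to_H_tens fps_const_one_fun H_one_def)
  ultimately show ?thesis by metis
qed

lemma H_counit_id_mero2:
  "hlift (\<lambda>x y. hcauchy hd_act (H_counit A (fps_const x)) (fps_const y)) (mero2_to_H2 F)
    = mero1_to_H ((id \<boxtimes> counit_id A) F)"
proof -
  note [hlin] = hlinear_comp[OF H_counit_id_tens(1)]
  note s = hlinear_hscale[OF hlinear_H_fun[OF hlinear_id(1)]] hlinear_hscale[OF hlinear_H_mul(1)[OF hlinear_id(1)]]
    hlinear_hscale[OF hlinear_htens_right[OF hlinear_id(1)]] hlinear_hscale[OF hlinear_mero1_to_H[OF hlinear_id(1)]]
  have 1: "hlift (\<lambda>x y. hcauchy hd_act (H_counit A (fps_const x)) (fps_const y)) (mero2_to_H2 (\<phi> \<otimes>\<^sub>h u \<otimes>\<^sub>h v))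
    = mero1_to_H ((id \<boxtimes> counit_id A) (\<phi> \<otimes>\<^sub>h u \<otimes>\<^sub>h v))" for \<phi> :: "'a mero fps" and u v
    by (simp add: mero2_to_H2_tens2 H_counit_id_tens(2) H_counit_fun htensor_map_htens hlinear_id
        hlinear_counit_id counit_id_tens s H_fun_in mero1_to_H_tens)
  have 2: "hlift (\<lambda>x y. hcauchy hd_act (H_counit A (fps_const x)) (fps_const y)) (mero2_to_H2 (\<phi> \<otimes>\<^sub>h t))
    = mero1_to_H ((id \<boxtimes> counit_id A) (\<phi> \<otimes>\<^sub>h t))" for \<phi> :: "'a mero fps" and t
    by (rule hlinear_eq_tens[where z = t], (intro hlin hlinear_counit_id)+, rule 1)
  show ?thesis by (rule hlinear_eq_tens[where z = F], (intro hlin hlinear_counit_id)+, rule 2)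
qed

lemma H_id_counit_mero2:
  "hlift (\<lambda>x y. hcauchy hd_act (H_counit A (fps_const y)) (fps_const x)) (mero2_to_H2 F)
    = mero1_to_H ((id \<boxtimes> id_counit A) F)"
proof -
  note [hlin] = hlinear_comp[OF H_id_counit_tens(1)]
  note s = hlinear_hscale[OF hlinear_H_fun[OF hlinear_id(1)]] hlinear_hscale[OF hlinear_H_mul(1)[OF hlinear_id(1)]]
    hlinear_hscale[OF hlinear_htens_right[OF hlinear_id(1)]] hlinear_hscale[OF hlinear_mero1_to_H[OF hlinear_id(1)]]
  have 1: "hlift (\<lambda>x y. hcauchy hd_act (H_counit A (fps_const y)) (fps_const x)) (mero2_to_H2 (\<phi> \<otimes>\<^sub>h u \<otimes>\<^sub>h v))
    = mero1_to_H ((id \<boxtimes> id_counit A) (\<phi> \<otimes>\<^sub>h u \<otimes>\<^sub>h v))" for \<phi> :: "'a mero fps" and u v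
    by (simp add: mero2_to_H2_tens2 H_id_counit_tens(2) H_counit_in htensor_map_htens hlinear_id
        hlinear_counit_id counit_id_tens s H_fun_one mero1_to_H_tens)
  have 2: "hlift (\<lambda>x y. hcauchy hd_act (H_counit A (fps_const y)) (fps_const x)) (mero2_to_H2 (\<phi> \<otimes>\<^sub>h t))
    = mero1_to_H ((id \<boxtimes> id_counit A) (\<phi> \<otimes>\<^sub>h t))" for \<phi> :: "'a mero fps" and t
    by (rule hlinear_eq_tens[where z = t], (intro hlin hlinear_counit_id)+, rule 1)
  show ?thesis by (rule hlinear_eq_tens[where z = F], (intro hlin hlinear_counit_id)+, rule 2)
qed

end

section \<open>Dynamical twists\<close>

text \<open>The family \<open>k\<close> stands for the basis of \<eta> inside the quantum algebra.
  In the application its commutativity comes from the commutative subalgebra of series over U\<eta>,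
  and its primitivity from the coproduct on \<eta>.\<close>

locale dynamical_family = hopf_ops A for A :: "'u::complex_vector hopf" +
  fixes k :: "'n::finite \<Rightarrow> 'u fps"
  assumes k_commute: "hmul A (k i) (k j) = hmul A (k j) (k i)"
    and k_primitive: "hcomul A (k i) = k i \<otimes>\<^sub>h hone A + hone A \<otimes>\<^sub>h k i"
begin

abbreviation par :: "'n \<Rightarrow> ('n, 'u) hd fps"
  where "par \<equiv> H_partial A"

abbreviation kin :: "'n \<Rightarrow> ('n, 'u) hd fps"
  where "kin i \<equiv> H_in (k i)"

abbreviation e :: "('n, 'u) hd fps"
  where "e \<equiv> H_one A"

definition theta12 :: "(('n, 'u) hd \<otimes> ('n, 'u) hd) fps"
  where "theta12 = (\<Sum>i\<in>UNIV. par i \<otimes>\<^sub>h kin i)"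

text \<open>Here \<open>kappa_left\<close> and \<open>kappa_right\<close> are \<open>(\<Delta> \<otimes> id) \<theta>\<close> and \<open>(id \<otimes> \<Delta>) \<theta>\<close>.\<close>

definition kappa_left :: "(('n, 'u) hd \<otimes> ('n, 'u) hd \<otimes> ('n, 'u) hd) fps"
  where "kappa_left = (\<Sum>i\<in>UNIV. hassoc ((par i \<otimes>\<^sub>h e + e \<otimes>\<^sub>h par i) \<otimes>\<^sub>h kin i))"

definition kappa_right :: "(('n, 'u) hd \<otimes> ('n, 'u) hd \<otimes> ('n, 'u) hd) fps"
  where "kappa_right = (\<Sum>i\<in>UNIV. par i \<otimes>\<^sub>h (kin i \<otimes>\<^sub>h e + e \<otimes>\<^sub>h kin i))"

definition shift_op :: "('n, 'u) mero3 \<Rightarrow> ('n, 'u) mero3"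
  where "shift_op G = (\<Sum>i\<in>UNIV. mero3_mul A (1 \<otimes>\<^sub>h hone A \<otimes>\<^sub>h hone A \<otimes>\<^sub>h k i)
    (hmap (tmap (mero_partial i) id) G))"

lemma hlinear_right: "hlinear (\<lambda>X. HH_mul A X Y)" "hlinear (\<lambda>X. HHH_mul A X Q)"
  and hlinear_left: "hlinear (\<lambda>X. HH_mul A Y X)" "hlinear (\<lambda>X. HHH_mul A Q X)"
  by (intro hlin)+

lemmas mul_sum = hlinear_sum[OF hlinear_right(1)] hlinear_sum[OF hlinear_right(2)]
  hlinear_sum[OF hlinear_left(1)] hlinear_sum[OF hlinear_left(2)]

lemmas mul_plus = hlinear_plus[OF hlinear_right(1)] hlinear_plus[OF hlinear_right(2)]
  hlinear_plus[OF hlinear_left(1)] hlinear_plus[OF hlinear_left(2)]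

lemmas htens_plus = hlinear_plus[OF hlinear_htens_left[OF hlinear_id(1)]]
  hlinear_plus[OF hlinear_htens_right[OF hlinear_id(1)]]

lemmas hassoc_plus = hlinear_plus[OF hlinear_hmap[OF clinear_tassoc]]

lemma par_commute: "H_mul A (par i) (par j) = H_mul A (par j) (par i)"
  by (simp add: H_partial_def mul_tens diffop_fps_const diffop_partial_commute[of i])

lemma par_in: "H_mul A (H_in u) (par i) = H_mul A (par i) (H_in u)"
  by (simp add: H_partial_def H_in_def mul_tens)

lemma kin_commute: "H_mul A (kin i) (kin j) = H_mul A (kin j) (kin i)"
  by (simp add: H_in_mul k_commute[of i])

text \<open>By multiplicativity, \<Delta>(x \<partial>_i) \<otimes> y h_i is the product of \<Delta>
  x \<otimes> y and \<Delta> \<partial>_i \<otimes> h_i, and the second factor is absorbed into Q.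
  This is the adjointness required by \<open>hExp_adjoint\<close>.\<close>

lemma comul_left_theta:
  "comul_left A Q (HH_mul A Z theta12) = comul_left A (HHH_mul A kappa_left Q) Z"
proof (rule hlinear_eq_tens[where z = Z], (intro hlin)+)
  fix x y :: "('n, 'u) hd fps"
  let ?X = "HH_rep (H_comul A x)"
  let ?\<delta> = "\<lambda>i. par i \<otimes>\<^sub>h e + e \<otimes>\<^sub>h par i"
  have 1: "comul_left A Q (HH_mul A (x \<otimes>\<^sub>h y) (par i \<otimes>\<^sub>h kin i))
      = to_HHH (HHH_mul A (hassoc (?X \<otimes>\<^sub>h y)) (HHH_mul A (hassoc (?\<delta> i \<otimes>\<^sub>h kin i)) Q))" for i
  proof -
    have "HH_mix (diffop_partial i \<otimes> diffop_fun 1 + diffop_fun 1 \<otimes> diffop_partial i) (hcomul A (hone A)) = ?\<delta> i"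
      by (simp add: comul_one clinear_plus[OF clinear_HH_mix] HH_mix_tens H_partial_def H_one_def)
    then have "H_comul A (H_mul A x (par i)) = to_HH (HH_mul A ?X (?\<delta> i))"
      using H_comul_mul[of "diffop_partial i \<otimes> diffop_fun 1 + diffop_fun 1 \<otimes> diffop_partial i"
          "diffop_partial i" x "hone A"]
      by (simp add: clinear_plus[OF clinear_bidiff] bidiff_tens mero_partial_mult flip: H_partial_def)
    then show ?thesis
      by (simp add: HH_mul_tens comul_left_tens HHH_mul_rep_left flip: HHH_mul_assoc HHH_mul_hassoc)
  qed
  show "comul_left A Q (HH_mul A (x \<otimes>\<^sub>h y) theta12) = comul_left A (HHH_mul A kappa_left Q) (x \<otimes>\<^sub>h y)"
    by (simp add: theta12_def kappa_left_def mul_sum hlinear_sum[OF hlinear_comul_left] 1 comul_left_tens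
        hlinear_sum[OF hlinear_hmap[OF clinear_abs_hhh]])
qed

lemma comul_right_theta:
  "comul_right A Q (HH_mul A Z theta12) = comul_right A (HHH_mul A kappa_right Q) Z"
proof (rule hlinear_eq_tens[where z = Z], (intro hlin)+)
  fix x y :: "('n, 'u) hd fps"
  let ?X = "HH_rep (H_comul A y)"
  let ?\<delta> = "\<lambda>i. kin i \<otimes>\<^sub>h e + e \<otimes>\<^sub>h kin i"
  have 1: "comul_right A Q (HH_mul A (x \<otimes>\<^sub>h y) (par i \<otimes>\<^sub>h kin i))
      = to_HHH (HHH_mul A (x \<otimes>\<^sub>h ?X) (HHH_mul A (par i \<otimes>\<^sub>h ?\<delta> i) Q))" for i
  proof -
    have "HH_mix (diffop_fun 1 \<otimes> diffop_fun 1) (hcomul A (k i)) = ?\<delta> i"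
      by (simp add: k_primitive hlinear_plus[OF hlinear_HH_mix[OF hlinear_id(1)]] HH_mix_tens H_in_def H_one_def)
    then have "H_comul A (H_mul A y (kin i)) = to_HH (HH_mul A ?X (?\<delta> i))"
      using H_comul_mul[of "diffop_fun 1 \<otimes> diffop_fun 1" "diffop_fun 1" y "k i"]
      by (simp add: bidiff_tens flip: H_in_def)
    then show ?thesis
      by (simp add: HH_mul_tens comul_right_tens HHH_mul_rep_right flip: HHH_mul_assoc HHH_mul_tens)
  qed
  show "comul_right A Q (HH_mul A (x \<otimes>\<^sub>h y) theta12) = comul_right A (HHH_mul A kappa_right Q) (x \<otimes>\<^sub>h y)"
    by (simp add: theta12_def kappa_right_def mul_sum hlinear_sum[OF hlinear_comul_right] 1 comul_right_tens
        hlinear_sum[OF hlinear_hmap[OF clinear_abs_hhh]])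
qed

lemma hassoc_theta: "hassoc (theta12 \<otimes>\<^sub>h e) = (\<Sum>i\<in>UNIV. par i \<otimes>\<^sub>h kin i \<otimes>\<^sub>h e)"
  and one_theta: "e \<otimes>\<^sub>h theta12 = (\<Sum>i\<in>UNIV. e \<otimes>\<^sub>h par i \<otimes>\<^sub>h kin i)"
  by (simp_all add: theta12_def hlinear_sum[OF hlinear_htens_left[OF hlinear_id(1)]] hassoc_htens
      hlinear_sum[OF hlinear_htens_right[OF hlinear_id(1)]] hlinear_sum[OF hlinear_hmap[OF clinear_tassoc]])

lemma theta_kappa_eq: "hassoc (theta12 \<otimes>\<^sub>h e) + kappa_left = e \<otimes>\<^sub>h theta12 + kappa_right"
  unfolding hassoc_theta one_theta kappa_left_def kappa_right_def
  by (simp add: htens_plus hassoc_plus hassoc_htens sum.distrib algebra_simps)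

lemma sums_commute:
  assumes "\<And>i j. HHH_mul A (a i) (b j) = HHH_mul A (b j) (a i)"
  shows "HHH_mul A (\<Sum>i\<in>(UNIV :: 'n set). a i) (\<Sum>j\<in>(UNIV :: 'n set). b j)
    = HHH_mul A (\<Sum>j\<in>UNIV. b j) (\<Sum>i\<in>UNIV. a i)"
  unfolding mul_sum by (subst sum.swap) (simp add: assms)

text \<open>Within one tensor factor, derivatives meet derivatives here, and elements of the family
  \<open>k\<close> meet each other in the companion lemma for \<open>kappa_right\<close>. Both
  families commute, and a mixed pair commutes since its members act on different components of
  H.\<close>

lemma theta_kappa_left_commute:
  "HHH_mul A (hassoc (theta12 \<otimes>\<^sub>h e)) kappa_left = HHH_mul A kappa_left (hassoc (theta12 \<otimes>\<^sub>h e))"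
  unfolding hassoc_theta kappa_left_def
  by (rule sums_commute) (simp add: htens_plus hassoc_plus hassoc_htens mul_plus mul_tens par_commute par_in)

lemma theta_kappa_right_commute:
  "HHH_mul A (e \<otimes>\<^sub>h theta12) kappa_right = HHH_mul A kappa_right (e \<otimes>\<^sub>h theta12)"
  unfolding one_theta kappa_right_def
  by (rule sums_commute) (simp add: htens_plus mul_plus mul_tens par_in kin_commute)

definition Xi :: "(('n, 'u) hd \<otimes> ('n, 'u) hd \<otimes> ('n, 'u) hd) fps \<Rightarrow> (('n, 'u) hd \<otimes> ('n, 'u) hd \<otimes> ('n, 'u) hd) fps"
  where "Xi = hExp (\<lambda>X. HHH_mul A X (hassoc (theta12 \<otimes>\<^sub>h e) + kappa_left))"

lemma hlinear_Xi: "hlinear Xi"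
  unfolding Xi_def by (intro hlinear_hExp hlinear_right)

lemmas [hlin] = hlinear_comp[OF hlinear_Xi]

lemma Xi_eq:
  "hExp (\<lambda>X. HHH_mul A X (hassoc (theta12 \<otimes>\<^sub>h e))) (hExp (\<lambda>X. HHH_mul A X kappa_left) z) = Xi z" (is ?L)
  "hExp (\<lambda>X. HHH_mul A X (e \<otimes>\<^sub>h theta12)) (hExp (\<lambda>X. HHH_mul A X kappa_right) z) = Xi z" (is ?R)
proof -
  show ?L unfolding Xi_def mul_plus
    by (rule hExp_plus[symmetric]; (intro hlinear_right)?) (simp add: HHH_mul_assoc theta_kappa_left_commute)
  show ?R unfolding Xi_def theta_kappa_eq mul_plus
    by (rule hExp_plus[symmetric]; (intro hlinear_right)?) (simp add: HHH_mul_assoc theta_kappa_right_commute)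
qed

lemma Xi_mul: "Xi (HHH_mul A Y X) = HHH_mul A Y (Xi X)"
  unfolding Xi_def by (rule hExp_commute[symmetric]) (intro hlinear_left, simp add: HHH_mul_assoc)

text \<open>Left multiplication by \<open>Y\<close> is right multiplication by \<open>Y\<close> plus the commutator with \<open>Y\<close>, and the
  two commute.\<close>

lemma hExp_left_mult:
  "hExp (\<lambda>X. HHH_mul A Y X) z
    = hExp (\<lambda>X. HHH_mul A X Y) (hExp (\<lambda>X. HHH_mul A Y X - HHH_mul A X Y) z)"
proof -
  have "hExp (\<lambda>X. HHH_mul A X Y + (HHH_mul A Y X - HHH_mul A X Y)) z
      = hExp (\<lambda>X. HHH_mul A X Y) (hExp (\<lambda>X. HHH_mul A Y X - HHH_mul A X Y) z)"
    by (rule hExp_plus) (intro hlin, intro hlin, simp add: hlinear_minus[OF hlinear_right(2)] HHH_mul_assoc)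
  then show ?thesis by simp
qed

lemma hExp_left_right:
  "hExp (\<lambda>X. HHH_mul A Y X) (hExp (\<lambda>X. HHH_mul A X Z) z)
    = hExp (\<lambda>X. HHH_mul A X Z) (hExp (\<lambda>X. HHH_mul A Y X) z)"
proof (rule hExp_commute)
  show "hlinear (hExp (HHH_mul A Y))" by (intro hlinear_hExp hlinear_left)
  show "hExp (HHH_mul A Y) (HHH_mul A X Z) = HHH_mul A (hExp (HHH_mul A Y) X) Z" for X
    by (rule hExp_commute[symmetric]) (intro hlinear_right, simp add: HHH_mul_assoc)
qed

text \<open>By the Leibniz rule the commutator of a derivative with G is the derivative of G. The
  premise lets the elements of \<open>k\<close> in the third factor pass through G, so only this
  derivative term remains.\<close>

lemma shift_op_eq:
  assumes "\<And>i. mero3_mul A (1 \<otimes>\<^sub>h hone A \<otimes>\<^sub>h hone A \<otimes>\<^sub>h k i) G = mero3_mul A G (1 \<otimes>\<^sub>h hone A \<otimes>\<^sub>h hone A \<otimes>\<^sub>h k i)"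
  shows "HHH_mul A kappa_left (mero3_to_H3 A G) - HHH_mul A (mero3_to_H3 A G) kappa_left
    = mero3_to_H3 A (shift_op G)"
proof -
  let ?e = "\<lambda>i. 1 \<otimes>\<^sub>h hone A \<otimes>\<^sub>h hone A \<otimes>\<^sub>h k i :: ('n, 'u) mero3"
  let ?\<delta> = "\<lambda>i. par i \<otimes>\<^sub>h e \<otimes>\<^sub>h e + e \<otimes>\<^sub>h par i \<otimes>\<^sub>h e"
  let ?d = "\<lambda>i. hmap (tmap (mero_partial i) id) :: ('n, 'u) mero3 \<Rightarrow> _"
  have \<iota>e: "mero3_to_H3 A (?e i) = e \<otimes>\<^sub>h e \<otimes>\<^sub>h kin i" for i
    by (simp add: mero3_to_H3_tens H_fun_one H_in3_tens H_in2_tens H_in_one)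
  \<comment> \<open>The derivatives sit in the first two factors and the element of \<open>k\<close>
    in the third, so the order of the product is immaterial. With the latter on the left, the
    derivatives meet G first.\<close>
  have kap: "hassoc ((par i \<otimes>\<^sub>h e + e \<otimes>\<^sub>h par i) \<otimes>\<^sub>h kin i) = HHH_mul A (?\<delta> i) (mero3_to_H3 A (?e i))"
    "hassoc ((par i \<otimes>\<^sub>h e + e \<otimes>\<^sub>h par i) \<otimes>\<^sub>h kin i) = HHH_mul A (mero3_to_H3 A (?e i)) (?\<delta> i)" for i
    by (simp_all add: \<iota>e htens_plus hassoc_plus hassoc_htens mul_plus mul_tens)
  have fun_par: "H_mul A (par i) (H_fun A \<phi>) = H_fun A (hmap (mero_partial i) \<phi>) + H_mul A (H_fun A \<phi>) (par i)"
    for i and \<phi> :: "'n mero fps"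
  proof (rule hlinear_eq_const[where x = \<phi>], (intro hlin)+)
    fix f :: "'n mero"
    show "H_mul A (par i) (H_fun A (fps_const f))
        = H_fun A (hmap (mero_partial i) (fps_const f)) + H_mul A (H_fun A (fps_const f)) (par i)"
      by (simp add: H_partial_def H_fun_def hmap_diffop_fun_const hmap_fps_const[OF clinear_mero_partial]
          mul_tens diffop_fps_const diffop_partial_fun clinear_plus[OF clinear_fps_const] htens_plus
          del: fps_const_add)
  qed
  have in_\<delta>: "HHH_mul A (?\<delta> i) (H_in3 t) = HHH_mul A (H_in3 t) (?\<delta> i)" for i t
  proof -
    have 1: "HHH_mul A (?\<delta> i) (H_in3 (u \<otimes>\<^sub>h s)) = HHH_mul A (H_in3 (u \<otimes>\<^sub>h s)) (?\<delta> i)" for u s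
      by (rule hlinear_eq_tens[where z = s], (intro hlin)+)
        (simp add: H_in3_tens H_in2_tens mul_plus mul_tens par_in)
    show ?thesis by (rule hlinear_eq_tens[where z = t], (intro hlin)+, rule 1)
  qed
  have \<delta>: "HHH_mul A (?\<delta> i) (mero3_to_H3 A G) = mero3_to_H3 A (?d i G) + HHH_mul A (mero3_to_H3 A G) (?\<delta> i)" for i G
  proof (rule hlinear_eq_tens[where z = G], (intro hlin)+)
    fix \<phi> :: "'n mero fps" and t :: "('u \<otimes> 'u \<otimes> 'u) fps"
    let ?f = "\<lambda>\<phi>. H_fun A \<phi> \<otimes>\<^sub>h e \<otimes>\<^sub>h e"
    have "HHH_mul A (?\<delta> i) (?f \<phi>) = ?f (hmap (mero_partial i) \<phi>) + HHH_mul A (?f \<phi>) (?\<delta> i)"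
      by (simp add: mul_plus mul_tens fun_par htens_plus algebra_simps)
    then show "HHH_mul A (?\<delta> i) (mero3_to_H3 A (\<phi> \<otimes>\<^sub>h t))
        = mero3_to_H3 A (?d i (\<phi> \<otimes>\<^sub>h t)) + HHH_mul A (mero3_to_H3 A (\<phi> \<otimes>\<^sub>h t)) (?\<delta> i)"
      by (simp only: mero3_to_H3_tens hmap_mero_partial_tens HHH_mul_assoc in_\<delta>[symmetric])
        (simp only: HHH_mul_assoc[symmetric] mul_plus)
  qed
  have "HHH_mul A (hassoc ((par i \<otimes>\<^sub>h e + e \<otimes>\<^sub>h par i) \<otimes>\<^sub>h kin i)) (mero3_to_H3 A G)
      - HHH_mul A (mero3_to_H3 A G) (hassoc ((par i \<otimes>\<^sub>h e + e \<otimes>\<^sub>h par i) \<otimes>\<^sub>h kin i))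
      = mero3_to_H3 A (mero3_mul A (?e i) (?d i G))" for i
  proof -
    have "HHH_mul A (hassoc ((par i \<otimes>\<^sub>h e + e \<otimes>\<^sub>h par i) \<otimes>\<^sub>h kin i)) (mero3_to_H3 A G)
        = HHH_mul A (mero3_to_H3 A (?e i)) (mero3_to_H3 A (?d i G) + HHH_mul A (mero3_to_H3 A G) (?\<delta> i))"
      by (simp only: kap(2) HHH_mul_assoc \<delta>)
    also have "\<dots> = mero3_to_H3 A (mero3_mul A (?e i) (?d i G)) + HHH_mul A (mero3_to_H3 A (mero3_mul A G (?e i))) (?\<delta> i)"
      by (simp only: mul_plus mero3_to_H3_mul HHH_mul_assoc[symmetric] assms)
    also have "HHH_mul A (mero3_to_H3 A (mero3_mul A G (?e i))) (?\<delta> i)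
        = HHH_mul A (mero3_to_H3 A G) (hassoc ((par i \<otimes>\<^sub>h e + e \<otimes>\<^sub>h par i) \<otimes>\<^sub>h kin i))"
      by (simp only: kap(2) HHH_mul_assoc mero3_to_H3_mul[symmetric])
    finally show ?thesis unfolding diff_eq_eq .
  qed
  then show ?thesis
    by (simp only: kappa_left_def mul_sum shift_op_def hlinear_sum[OF hlinear_mero3_to_H3] sum_subtractf[symmetric])
qed

lemma hExp_shift_op:
  "hExp (\<lambda>X. HHH_mul A kappa_left X - HHH_mul A X kappa_left) (mero3_to_H3 A (mero2_tensor F (hone A)))
    = mero3_to_H3 A (hExp shift_op (mero2_tensor F (hone A)))"
proof (rule hExp_intertwine[symmetric])
  let ?e = "\<lambda>i. 1 \<otimes>\<^sub>h hone A \<otimes>\<^sub>h hone A \<otimes>\<^sub>h k i :: ('n, 'u) mero3"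
  let ?d = "\<lambda>i. hmap (tmap (mero_partial i) id) :: ('n, 'u) mero3 \<Rightarrow> _"
  \<comment> \<open>\<open>shift_op_eq\<close> applies on the centralizer of the third-factor
    elements. This set is stable under \<open>shift_op\<close>, because the family \<open>k\<close>
    commutes and the derivatives touch only the function component.\<close>
  let ?C = "{G. \<forall>i. mero3_mul A (?e i) G = mero3_mul A G (?e i)}"
  show "hlinear (mero3_to_H3 A)" by (rule hlinear_mero3_to_H3)
  show "mero3_to_H3 A (shift_op G) = HHH_mul A kappa_left (mero3_to_H3 A G) - HHH_mul A (mero3_to_H3 A G) kappa_left"
    if "G \<in> ?C" for G
    using shift_op_eq[of G] that by simp
  have d_e: "?d i (mero3_mul A (?e j) G) = mero3_mul A (?e j) (?d i G)"
    "?d i (mero3_mul A G (?e j)) = mero3_mul A (?d i G) (?e j)" for i j G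
    by (rule hlinear_eq_tens[where z = G], (intro hlin)+,
        simp only: mero3_mul_tens hmap_mero_partial_tens mero_mult_one)+
  have e_e: "mero3_mul A (?e i) (?e j) = mero3_mul A (?e j) (?e i)" for i j
    by (simp add: mero3_mul_tens mul_tens k_commute[of i])
  show "shift_op G \<in> ?C" if "G \<in> ?C" for G
  proof (intro CollectI allI)
    fix j
    have "mero3_mul A (?e j) (mero3_mul A (?e i) (?d i G)) = mero3_mul A (mero3_mul A (?e i) (?d i G)) (?e j)" for i
    proof -
      have "mero3_mul A (?e j) (mero3_mul A (?e i) (?d i G)) = mero3_mul A (?e i) (?d i (mero3_mul A (?e j) G))"
        by (simp add: d_e e_e[of j i] flip: mero3_mul_assoc)
      also have "mero3_mul A (?e j) G = mero3_mul A G (?e j)" using that by simp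
      finally show ?thesis by (simp only: d_e mero3_mul_assoc)
    qed
    then show "mero3_mul A (?e j) (shift_op G) = mero3_mul A (shift_op G) (?e j)"
      by (simp add: shift_op_def hlinear_sum[OF hlinear_mero3_mul(1)[OF hlinear_id(1)]]
          hlinear_sum[OF hlinear_mero3_mul(2)[OF hlinear_id(1)]])
  qed
  have 1: "mero3_mul A (?e i) (mero2_tensor (\<phi> \<otimes>\<^sub>h t) (hone A)) = mero3_mul A (mero2_tensor (\<phi> \<otimes>\<^sub>h t) (hone A)) (?e i)"
    for i and \<phi> :: "'n mero fps" and t
    by (rule hlinear_eq_tens[where z = t], (intro hlin)+)
      (simp add: mero2_tensor_tens hassoc_htens mero3_mul_tens mul_tens)
  have "mero3_mul A (?e i) (mero2_tensor F (hone A)) = mero3_mul A (mero2_tensor F (hone A)) (?e i)" for i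
    by (rule hlinear_eq_tens[where z = F], (intro hlin)+, rule 1)
  then show "mero2_tensor F (hone A) \<in> ?C" by simp
qed

text \<open>The n-th power of \<open>shift_op\<close> expands into a sum over all index lists of
  length n, each new index being put in front. This identifies its exponential with the formal
  Taylor expansion that defines \<open>F12_shifted\<close>.\<close>

lemma hExp_shift_op_series:
  "hExp shift_op (mero2_tensor F (hone A)) = hseries (\<lambda>n. (1 / fact n) *\<^sub>C
    (\<Sum>is \<in> {is. length is = n}. mero2_tensor (foldr mero2_partial is F)
      (foldr (\<lambda>i. hmul A (k i)) is (hone A))))"
proof -
  have step1: "mero3_mul A (1 \<otimes>\<^sub>h hone A \<otimes>\<^sub>h hone A \<otimes>\<^sub>h k i) (hmap (tmap (mero_partial i) id) (mero2_tensor (\<phi> \<otimes>\<^sub>h t) w))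
      = mero2_tensor (hmap (tmap (mero_partial i) id) (\<phi> \<otimes>\<^sub>h t)) (hmul A (k i) w)"
    for i and \<phi> :: "'n mero fps" and t w
    by (rule hlinear_eq_tens[where z = t], (intro hlin)+)
      (simp only: mero2_tensor_tens hassoc_htens hmap_mero_partial_tens mero3_mul_tens mul_tens
        hmul_one mero_mult_one)
  have step: "mero3_mul A (1 \<otimes>\<^sub>h hone A \<otimes>\<^sub>h hone A \<otimes>\<^sub>h k i) (hmap (tmap (mero_partial i) id) (mero2_tensor G w))
      = mero2_tensor (mero2_partial i G) (hmul A (k i) w)" for i G w
    unfolding mero2_partial_def by (rule hlinear_eq_tens[where z = G], (intro hlin)+, rule step1)
  have shift: "shift_op (mero2_tensor G w) = (\<Sum>i\<in>UNIV. mero2_tensor (mero2_partial i G) (hmul A (k i) w))" for G w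
    by (simp add: shift_op_def step)
  have lin: "hlinear shift_op"
    unfolding shift_op_def[abs_def] by (intro hlin)
  have "(shift_op ^^ n) (mero2_tensor F (hone A)) = (\<Sum>is \<in> {is. length is = n}.
      mero2_tensor (foldr mero2_partial is F) (foldr (\<lambda>i. hmul A (k i)) is (hone A)))" for n
  proof (induction n)
    case (Suc n)
    then show ?case
      by (simp add: hlinear_sum[OF lin] shift sum_lists_Suc) (rule sum.swap)
  qed simp
  then show ?thesis by (simp add: hExp_def)
qed

text \<open>Balance relations multiply by functions from the left and \<open>Xi\<close> multiplies
  from the right, so the two are compatible. This is needed because functions can be moved between
  tensor factors only in the quotient.\<close>

lemma to_HHH_Xi:
  assumes "to_HHH X = to_HHH Y"
  shows "to_HHH (Xi X) = to_HHH (Xi Y)"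
proof (rule to_HHH_cong[OF _ _ _ assms])
  show "hlinear (\<lambda>X. to_HHH (Xi X))" by (intro hlin)
  fix f :: "'n mero" and x y z :: "('n, 'u) hd fps"
  let ?f = "H_fun A (fps_const f)"
  have *: "H_mul A ?f x \<otimes>\<^sub>h y \<otimes>\<^sub>h z = HHH_mul A (?f \<otimes>\<^sub>h e \<otimes>\<^sub>h e) (x \<otimes>\<^sub>h y \<otimes>\<^sub>h z)"
    "x \<otimes>\<^sub>h H_mul A ?f y \<otimes>\<^sub>h z = HHH_mul A (e \<otimes>\<^sub>h ?f \<otimes>\<^sub>h e) (x \<otimes>\<^sub>h y \<otimes>\<^sub>h z)"
    "x \<otimes>\<^sub>h y \<otimes>\<^sub>h H_mul A ?f z = HHH_mul A (e \<otimes>\<^sub>h e \<otimes>\<^sub>h ?f) (x \<otimes>\<^sub>h y \<otimes>\<^sub>h z)"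
    by (simp_all add: mul_tens)
  show "to_HHH (Xi (H_mul A ?f x \<otimes>\<^sub>h y \<otimes>\<^sub>h z)) = to_HHH (Xi (x \<otimes>\<^sub>h H_mul A ?f y \<otimes>\<^sub>h z))"
    "to_HHH (Xi (x \<otimes>\<^sub>h H_mul A ?f y \<otimes>\<^sub>h z)) = to_HHH (Xi (x \<otimes>\<^sub>h y \<otimes>\<^sub>h H_mul A ?f z))"
    unfolding * Xi_mul by (rule to_HHH_fun_mul)+
qed

text \<open>Every summand of the exponent of \<open>Xi\<close> puts a partial derivative rightmost
  in some tensor factor, where it kills the constant function. Hence \<open>HHH_vac\<close> ignores
  \<open>Xi\<close>, and it is a left inverse of \<open>mero3_to_H3\<close>.\<close>

lemma to_HHH_Xi_inject:
  "to_HHH (Xi (mero3_to_H3 A G)) = to_HHH (Xi (mero3_to_H3 A K)) \<longleftrightarrow> G = K"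
proof
  have ann1: "HHH_vac (HHH_mul A (x \<otimes>\<^sub>h y \<otimes>\<^sub>h z) (hassoc (theta12 \<otimes>\<^sub>h e) + kappa_left)) = 0"
    for x y z :: "('n, 'u) hd fps"
    unfolding hassoc_theta kappa_left_def
    by (simp add: mul_plus mul_sum htens_plus hassoc_plus hassoc_htens mul_tens
        hlinear_sum[OF hlinear_HHH_vac] hlinear_plus[OF hlinear_HHH_vac] HHH_vac_tens HH_vac_tens H_vac_partial)
  have ann2: "HHH_vac (HHH_mul A (x \<otimes>\<^sub>h Y) (hassoc (theta12 \<otimes>\<^sub>h e) + kappa_left)) = 0"
    for x :: "('n, 'u) hd fps" and Y
    by (rule hlinear_eq_tens[where z = Y and T = "\<lambda>_. 0"], (intro hlin)+, rule ann1)
  have ann: "HHH_vac (HHH_mul A X (hassoc (theta12 \<otimes>\<^sub>h e) + kappa_left)) = 0" for X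
    by (rule hlinear_eq_tens[where z = X and T = "\<lambda>_. 0"], (intro hlin)+, rule ann2)
  have vac: "HHH_vac (Xi X) = HHH_vac X" for X
    unfolding Xi_def by (rule hExp_annihilated[OF hlinear_HHH_vac ann])
  assume "to_HHH (Xi (mero3_to_H3 A G)) = to_HHH (Xi (mero3_to_H3 A K))"
  then have "HHH_vac (Xi (mero3_to_H3 A G)) = HHH_vac (Xi (mero3_to_H3 A K))"
    by (rule to_HHH_cong[OF hlinear_HHH_vac HHH_vac_balance])
  then show "G = K" by (simp add: vac HHH_vac_mero3)
qed simp

theorem twistor_iff:
  assumes zw: "\<And>i. mero2_mul A F (1 \<otimes>\<^sub>h (k i \<otimes>\<^sub>h hone A + hone A \<otimes>\<^sub>h k i))
      = mero2_mul A (1 \<otimes>\<^sub>h (k i \<otimes>\<^sub>h hone A + hone A \<otimes>\<^sub>h k i)) F"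
  shows "twistor A (to_HH (HH_mul A (mero2_to_H2 F) (hexp (HH_mul A) (e \<otimes>\<^sub>h e) theta12))) \<longleftrightarrow>
      mero3_mul A ((id \<boxtimes> comul_id A) F) (hExp shift_op (mero2_tensor F (hone A))) =
        mero3_mul A ((id \<boxtimes> id_comul A) F) (F23 A F) \<and>
      (id \<boxtimes> counit_id A) F = 1 \<otimes>\<^sub>h hone A \<and>
      (id \<boxtimes> id_counit A) F = 1 \<otimes>\<^sub>h hone A"
proof -
  define W where "W = hExp (\<lambda>X. HH_mul A X theta12) (mero2_to_H2 F)"
  let ?\<theta> = "hassoc (theta12 \<otimes>\<^sub>h e)"
  \<comment> \<open>\<open>hexp\<close> exponentiates left multiplication by \<theta>, whereas the
    argument needs right multiplication. The two agree on the elements commuting with \<theta>, a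
    set that contains the unit and is stable under multiplication by \<theta>.\<close>
  have "hExp (HH_mul A theta12) (e \<otimes>\<^sub>h e) = hExp (\<lambda>X. HH_mul A X theta12) (e \<otimes>\<^sub>h e)"
    by (rule hExp_intertwine[where \<Phi> = "\<lambda>X. X" and C = "{X. HH_mul A theta12 X = HH_mul A X theta12}"])
      (simp_all add: hlinear_id HH_mul_assoc[symmetric])
  then have W: "HH_mul A (mero2_to_H2 F) (hexp (HH_mul A) (e \<otimes>\<^sub>h e) theta12) = W"
    unfolding hexp_eq_hExp W_def
    using hExp_commute[of "HH_mul A (mero2_to_H2 F)" "\<lambda>X. HH_mul A X theta12" "\<lambda>X. HH_mul A X theta12" "e \<otimes>\<^sub>h e"]
      hlinear_left(1)[of "mero2_to_H2 F"]
    by (simp add: HH_mul_assoc)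

  have "hassoc (W \<otimes>\<^sub>h e) = hExp (\<lambda>X. HHH_mul A X ?\<theta>) (mero3_to_H3 A (mero2_tensor F (hone A)))"
    unfolding W_def hassoc_mero2_to_H2[symmetric]
    by (rule hExp_commute[where \<Phi> = "\<lambda>X. hassoc (X \<otimes>\<^sub>h e)"], intro hlin) (simp add: HHH_mul_hassoc)
  then have "hExp (\<lambda>X. HHH_mul A kappa_left X) (hassoc (W \<otimes>\<^sub>h e))
      = Xi (mero3_to_H3 A (hExp shift_op (mero2_tensor F (hone A))))"
    by (simp only: hExp_left_right hExp_left_mult[of kappa_left] hExp_shift_op Xi_eq)
  moreover have "comul_left A (hassoc (W \<otimes>\<^sub>h e)) W
      = comul_left A (hExp (\<lambda>X. HHH_mul A kappa_left X) (hassoc (W \<otimes>\<^sub>h e))) (mero2_to_H2 F)"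
    \<comment> \<open>Only the second W, whose coproduct is taken, is unfolded; the W inside the
      other argument stays whole and receives the exponential.\<close>
    by (subst (2) W_def, rule hExp_adjoint[where B = "comul_left A"])
      (intro hlin hlinear_comul_left, intro hlin, rule comul_left_theta)
  ultimately have left: "twist_left A (to_HH W) = to_HHH (Xi (mero3_to_H3 A
      (mero3_mul A ((id \<boxtimes> comul_id A) F) (hExp shift_op (mero2_tensor F (hone A))))))"
    by (simp add: twist_left_eq comul_left_mero2 Xi_mul flip: mero3_to_H3_mul)

  have zw': "HHH_mul A kappa_right (e \<otimes>\<^sub>h mero2_to_H2 F) = HHH_mul A (e \<otimes>\<^sub>h mero2_to_H2 F) kappa_right"
  proof -
    have "kin i \<otimes>\<^sub>h e + e \<otimes>\<^sub>h kin i = mero2_to_H2 (1 \<otimes>\<^sub>h (k i \<otimes>\<^sub>h hone A + hone A \<otimes>\<^sub>h k i))" for i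
      by (simp add: mero2_to_H2_tens H_fun_one hlinear_plus[OF hlinear_H_in2'] H_in2_tens H_in_one)
    then show ?thesis
      by (simp add: kappa_right_def mul_sum mul_tens mero2_to_H2_mul zw)
  qed
  have "e \<otimes>\<^sub>h W = hExp (\<lambda>X. HHH_mul A X (e \<otimes>\<^sub>h theta12)) (e \<otimes>\<^sub>h mero2_to_H2 F)"
    unfolding W_def
    by (rule hExp_commute[where \<Phi> = "\<lambda>X. e \<otimes>\<^sub>h X"], intro hlin) (simp add: mul_tens)
  then have "hExp (\<lambda>X. HHH_mul A kappa_right X) (e \<otimes>\<^sub>h W) = hExp (\<lambda>X. HHH_mul A X (e \<otimes>\<^sub>h theta12))
      (hExp (\<lambda>X. HHH_mul A X kappa_right)
        (hExp (\<lambda>X. HHH_mul A kappa_right X - HHH_mul A X kappa_right) (e \<otimes>\<^sub>h mero2_to_H2 F)))"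
    by (simp only: hExp_left_right hExp_left_mult[of kappa_right])
  also have "\<dots> = Xi (e \<otimes>\<^sub>h mero2_to_H2 F)"
    \<comment> \<open>By zero weight the commutator with \<open>kappa_right\<close> vanishes, so its
      exponential acts as the identity and no shift of \<lambda> arises on this side.\<close>
    by (subst hExp_fixed) (intro hlin, simp_all add: zw' Xi_eq)
  finally have "hExp (\<lambda>X. HHH_mul A kappa_right X) (e \<otimes>\<^sub>h W) = Xi (e \<otimes>\<^sub>h mero2_to_H2 F)" .
  moreover have "comul_right A (e \<otimes>\<^sub>h W) W
      = comul_right A (hExp (\<lambda>X. HHH_mul A kappa_right X) (e \<otimes>\<^sub>h W)) (mero2_to_H2 F)"
    by (subst (2) W_def, rule hExp_adjoint[where B = "comul_right A"])
      (intro hlin hlinear_comul_right, intro hlin, rule comul_right_theta)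
  ultimately have "twist_right A (to_HH W)
      = to_HHH (Xi (HHH_mul A (mero3_to_H3 A ((id \<boxtimes> id_comul A) F)) (e \<otimes>\<^sub>h mero2_to_H2 F)))"
    by (simp add: twist_right_eq comul_right_mero2 Xi_mul)
  also have "\<dots> = to_HHH (Xi (mero3_to_H3 A (mero3_mul A ((id \<boxtimes> id_comul A) F) (F23 A F))))"
    by (rule to_HHH_Xi[OF mero3_to_H3_F23])
  finally have right: "twist_right A (to_HH W)
      = to_HHH (Xi (mero3_to_H3 A (mero3_mul A ((id \<boxtimes> id_comul A) F) (F23 A F))))" .

  \<comment> \<open>In each term of \<theta> the first factor is a partial derivative, which the
    counit of H annihilates from the right, and the second is a primitive element, on which the
    counit vanishes. So neither counit map sees the exponential.\<close>
  have ann: "hlift (\<lambda>x y. hcauchy hd_act (H_counit A (fps_const x)) (fps_const y)) (HH_mul A X theta12) = 0"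
    "hlift (\<lambda>x y. hcauchy hd_act (H_counit A (fps_const y)) (fps_const x)) (HH_mul A X theta12) = 0" for X
  proof -
    note [hlin] = hlinear_comp[OF H_counit_id_tens(1)] hlinear_comp[OF H_id_counit_tens(1)]
    have z: "H_mul A (H_fun A 0) x = 0" for x
      by (rule hlinear_zero[of "\<lambda>\<phi>. H_mul A (H_fun A \<phi>) x"]) (intro hlin)
    note c = H_counit_in_zero[OF counit_primitive[OF k_primitive]]
    show "hlift (\<lambda>x y. hcauchy hd_act (H_counit A (fps_const x)) (fps_const y)) (HH_mul A X theta12) = 0"
      by (rule hlinear_eq_tens[where z = X and T = "\<lambda>_. 0"], (intro hlin)+)
        (simp add: theta12_def mul_sum mul_tens hlinear_sum[OF H_counit_id_tens(1)] H_counit_id_tens(2)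
          H_counit_partial z)
    show "hlift (\<lambda>x y. hcauchy hd_act (H_counit A (fps_const y)) (fps_const x)) (HH_mul A X theta12) = 0"
      by (rule hlinear_eq_tens[where z = X and T = "\<lambda>_. 0"], (intro hlin)+)
        (simp add: theta12_def mul_sum mul_tens hlinear_sum[OF H_id_counit_tens(1)] H_id_counit_tens(2) c z)
  qed
  have "H_counit_id A (to_HH W) = mero1_to_H ((id \<boxtimes> counit_id A) F)"
    "H_id_counit A (to_HH W) = mero1_to_H ((id \<boxtimes> id_counit A) F)"
    unfolding H_counit_id_to_HH H_id_counit_to_HH W_def
      hExp_annihilated[OF H_counit_id_tens(1) ann(1)] hExp_annihilated[OF H_id_counit_tens(1) ann(2)]
    by (rule H_counit_id_mero2 H_id_counit_mero2)+
  then show ?thesis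
    unfolding W twistor_def left right to_HHH_Xi_inject by (simp add: mero1_to_H_eq_one)
qed

end

lemma h_elem_in_series:
  assumes "x \<in> \<eta>"
  shows "h_elem x \<in> hseries_in (uea_sub \<eta>)"
proof -
  have "prod_list (map uea_in [x]) \<in> uea_sub \<eta>"
    unfolding uea_sub_def using assms by (intro complex_vector.span_base CollectI exI[of _ "[x]"]) simp
  then show ?thesis
    by (auto simp: hseries_in_def h_elem_def uea_sub_def complex_vector.span_zero)
qed

theorem theorem7p5:
  fixes A :: "'g::complex_lie_algebra uea hopf"
    and R :: "('g uea \<otimes> 'g uea) fps"
    and \<eta> :: "'g set"
    and h :: "'n::finite \<Rightarrow> 'g"
    and F :: "('n mero \<otimes> 'g uea \<otimes> 'g uea) fps"
  assumes "quantum_enveloping_algebra A"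
    and "quasi_triangular A R"
    and "inj h" and "complex_vector.independent (range h)"
    and "\<eta> = complex_vector.span (range h)"
    and "\<forall>x\<in>\<eta>. \<forall>y\<in>\<eta>. lie x y = 0"
    and "commutative_subalgebra A (hseries_in (uea_sub \<eta>))"
    and "\<forall>x\<in>\<eta>. hcomul A (h_elem x) = delta A x"
    and "zero_weight A \<eta> F"
  shows "twistor A (dynamical_twistor A h F) \<longleftrightarrow>
      mero3_mul A ((id \<boxtimes> comul_id A) F) (F12_shifted A h F) =
        mero3_mul A ((id \<boxtimes> id_comul A) F) (F23 A F) \<and>
      (id \<boxtimes> counit_id A) F = 1 \<otimes>\<^sub>h hone A \<and>
      (id \<boxtimes> id_counit A) F = 1 \<otimes>\<^sub>h hone A"
proof -
  have mem: "h i \<in> \<eta>" for i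
    unfolding assms(5) by (intro complex_vector.span_base) simp
  interpret dynamical_family A "\<lambda>i. h_elem (h i)"
  proof
    show "topological_hopf_algebra A"
      using assms(1) by (simp add: quantum_enveloping_algebra_def)
    show "hmul A (h_elem (h i)) (h_elem (h j)) = hmul A (h_elem (h j)) (h_elem (h i))" for i j
      using assms(7) h_elem_in_series[OF mem] unfolding commutative_subalgebra_def by blast
    show "hcomul A (h_elem (h i)) = h_elem (h i) \<otimes>\<^sub>h hone A + hone A \<otimes>\<^sub>h h_elem (h i)" for i
      using assms(8) mem[of i] by (simp add: delta_def)
  qed
  have "theta A h = theta12"
    by (simp add: theta_def theta12_def H_partial_def H_in_def)
  then have "dynamical_twistor A h F
      = to_HH (HH_mul A (mero2_to_H2 F) (hexp (HH_mul A) (H_one A \<otimes>\<^sub>h H_one A) theta12))"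
    by (simp add: dynamical_twistor_def Theta_def)
  moreover have "F12_shifted A h F = hExp shift_op (mero2_tensor F (hone A))"
    by (simp add: F12_shifted_def hExp_shift_op_series)
  ultimately show ?thesis
    using twistor_iff[of F] assms(9) mem by (simp add: zero_weight_def delta_def)
qed

end
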